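(* Let $\Lambda\colon V\times V\to\mathbb{K}$ be an even continuous bilinear form and $z\in\mathbb{K}$. Let $R\ge\frac12$ and let $a,b\in\widehat{\mathcal{W}}_R(V,\star_{z\Lambda})$. Then $$a\star_{z\Lambda}b=\mu\circ\mathrm{e}^{zP_\Lambda}(a\otimes b)=\sum_{k=0}^\infty\frac{z^k}{k!}\,\mu\circ P_\Lambda^k(a\otimes b)$$ converges absolutely in $\widehat{\mathcal{W}}_R(V)$. The same statement holds for the projective limit version $\widehat{\mathcal{W}}_{R^-}(V,\star_{z\Lambda})$ and $R>\frac12$.
   Context: $\mathbb{K}=\mathbb{R}$ or $\mathbb{C}$, and $V=V_{\mathbf 0}\oplus V_{\mathbf 1}$ is a $\mathbb{Z}_2$-graded Hausdorff locally convex $\mathbb{K}$-vector space such that the projections onto $V_{\mathbf 0}$ and $V_{\mathbf 1}$ are continuous. In exponents of $-1$ a homogeneous vector denotes its parity. Symmetric algebra: $S_n$ acts from the right on $V^{\otimes n}$ by $(v_1\otimes\cdots\otimes v_n)\triangleleft\sigma=\pm\, v_{\sigma(1)}\otimes\cdots\otimes v_{\sigma(n)}$ for homogeneous $v_i$, where $\pm$ is the Koszul sign ($-1$ to the number of pairs $i<j$ with $\sigma(i)>\sigma(j)$ and $v_{\sigma(i)},v_{\sigma(j)}$ both odd). $\mathcal{S}_n(v)=\frac1{n!}\sum_{\sigma} v\triangleleft\sigma$, $\mathrm{S}^n(V)=\operatorname{im}\mathcal{S}_n\subseteq V^{\otimes n}$, $\mathrm{S}^0(V)=\mathbb{K}$,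 $\mathrm{S}^\bullet(V)=\bigoplus_n \mathrm{S}^n(V)$, with product $\mu(v\otimes w)=vw=\mathcal{S}(v\otimes w)$, $\mathcal{S}=\bigoplus_n\mathcal{S}_n$. Star product: $\Lambda$ is even if $\Lambda(v,w)=0$ for homogeneous $v,w$ of different parity. $P_\Lambda\colon \mathrm{S}^\bullet(V)\otimes \mathrm{S}^\bullet(V)\to \mathrm{S}^{\bullet-1}(V)\otimes \mathrm{S}^{\bullet-1}(V)$ is the linear extension of $$P_\Lambda(v_1\cdots v_n\otimes w_1\cdots w_m)=\sum_{k=1}^n\sum_{\ell=1}^m(-1)^{v_k(v_{k+1}+\cdots+v_n)+w_\ell(w_1+\cdots+w_{\ell-1})}\Lambda(v_k,w_\ell)\,v_1\cdots\widehat{v_k}\cdots v_n\otimes w_1\cdots\widehat{w_\ell}\cdots w_m$$ (homogeneous vectors; hats denote omission; $P_\Lambda$ vanishes if one factor is in $\mathrm{S}^0(V)$). On $\mathrm{S}^\bullet(V)$ one sets $a\star_{z\Lambda}b=\sum_{k\ge0}\frac{z^k}{k!}\mu(P_\Lambda^k(a\otimes b))$, a finite sum. Topology: for a continuous seminorm $p$ on $V$ let $p^n=p\otimes\cdots\otimes p$ be the projective tensor seminorm on $V^{\otimes n}$ ($p^0=|\cdot|$) and $p_R(v)=\sum_{n\ge0}p^n(v_n)\,n!^R$ for $v=\sum_nv_n$. $\mathcal{W}_R(V,\star_{z\Lambda})$ is $\mathrm{S}^\bullet(V)$ with product $\star_{z\Lambda}$ and the topology of all $p_R$ ($p$ a continuous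 seminorm on $V$); $\mathcal{W}_{R^-}(V,\star_{z\Lambda})$ is the same algebra with the topology of all $p_{R-\epsilon}$, $\epsilon>0$. For $R\ge\frac12$ (resp. $R>\frac12$) the product $\star_{z\Lambda}$ is continuous and extends to the completion $\widehat{\mathcal{W}}_R$ (resp. $\widehat{\mathcal{W}}_{R^-}$), still denoted $\star_{z\Lambda}$. Likewise each bilinear map $(a,b)\mapsto\mu\circ P_\Lambda^k(a\otimes b)$ is continuous and denotes its continuous bilinear extension to the completion. *)

theory Defs
  imports "HOL-Analysis.Analysis" "HOL-Library.Function_Algebras" "HOL-Combinatorics.Permutations"
begin

section \<open>Graded locally convex spaces\<close>

text \<open>
  The scalars are a type \<open>'k\<close> of class \<^class>\<open>real_normed_field\<close>, whose norm is multiplicative.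
  Both \<^typ>\<open>real\<close> and \<^typ>\<open>complex\<close> are instances, and by Gelfand--Mazur every instance is
  isometrically isomorphic to one of them.
\<close>

definition seminorm :: "('k::real_normed_field \<Rightarrow> 'v::ab_group_add \<Rightarrow> 'v) \<Rightarrow> ('v \<Rightarrow> real) \<Rightarrow> bool" where
  "seminorm scl p \<longleftrightarrow>
     (\<forall>x y. p (x + y) \<le> p x + p y) \<and> (\<forall>c x. p (scl c x) = norm c * p x)"

definition continuous_seminorm ::
  "('k::real_normed_field \<Rightarrow> 'v::{ab_group_add,topological_space} \<Rightarrow> 'v) \<Rightarrow> ('v \<Rightarrow> real) \<Rightarrow> bool" where
  "continuous_seminorm scl p \<longleftrightarrow> seminorm scl p \<and> continuous_on UNIV p"

text \<open>
  The radius of the seminorm balls may be taken to be 1 because seminorms can be rescaled.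
  Continuity of the scalar multiplication follows from the axioms.
\<close>

locale hausdorff_lcs = vector_space scl
  for scl :: "'k::real_normed_field \<Rightarrow> 'v::{topological_ab_group_add,t2_space} \<Rightarrow> 'v" +
  assumes locally_convex:
    "open U \<Longrightarrow> 0 \<in> U \<Longrightarrow> \<exists>p. continuous_seminorm scl p \<and> {x. p x < 1} \<subseteq> U"

text \<open>
  A grading is a family \<open>V\<close> indexed by \<^typ>\<open>bool\<close>: \<open>V False\<close> is the even and \<open>V True\<close> the
  odd part. \<open>hpart V e\<close> is the projection onto \<open>V e\<close> along the other summand.
\<close>

definition hpart :: "(bool \<Rightarrow> 'v::ab_group_add set) \<Rightarrow> bool \<Rightarrow> 'v \<Rightarrow> 'v" where
  "hpart V e v = (THE u. u \<in> V e \<and> v - u \<in> V (\<not> e))"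

locale graded_lcs = hausdorff_lcs scl
  for scl :: "'k::real_normed_field \<Rightarrow> 'v::{topological_ab_group_add,t2_space} \<Rightarrow> 'v" +
  fixes V :: "bool \<Rightarrow> 'v set"
  assumes grading_subspace: "subspace (V e)"
    and grading_disjoint: "V False \<inter> V True = {0}"
    and grading_spans: "\<exists>a\<in>V False. \<exists>b\<in>V True. v = a + b"
    and continuous_hpart: "continuous_on UNIV (hpart V e)"

definition continuous_bilinear_form ::
  "('k::real_normed_field \<Rightarrow> 'v::{ab_group_add,topological_space} \<Rightarrow> 'v) \<Rightarrow> ('v \<Rightarrow> 'v \<Rightarrow> 'k) \<Rightarrow> bool" where
  "continuous_bilinear_form scl \<Lambda> \<longleftrightarrow>
     (\<forall>v. Vector_Spaces.linear scl (*) (\<Lambda> v)) \<and>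
     (\<forall>w. Vector_Spaces.linear scl (*) (\<lambda>v. \<Lambda> v w)) \<and>
     continuous_on UNIV (\<lambda>(v, w). \<Lambda> v w)"

definition even_form :: "(bool \<Rightarrow> 'v set) \<Rightarrow> ('v \<Rightarrow> 'v \<Rightarrow> 'k::zero) \<Rightarrow> bool" where
  "even_form V \<Lambda> \<longleftrightarrow> (\<forall>e. \<forall>v\<in>V e. \<forall>w\<in>V (\<not> e). \<Lambda> v w = 0)"


section \<open>Tensor algebra\<close>

text \<open>
  Over a field, the pure tensor \<open>v\<^sub>1 \<otimes> \<dots> \<otimes> v\<^sub>n\<close> may be realised as the functional that evaluates
  multilinear forms at \<open>(v\<^sub>1, \<dots>, v\<^sub>n)\<close>: multilinear forms separate the points of the tensor
  power, and the span of the evaluation functionals has the universal property. All tensor powers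
  are treated at once by letting a form take lists of vectors of arbitrary length, being
  multilinear on each length separately. The span of all pure tensors is then the direct sum of
  the tensor powers, and \<open>tens scl []\<close> is the unit of the scalars in degree 0.

  The same idea applied to pairs of lists gives the tensor product of the tensor algebra with
  itself.
\<close>

type_synonym ('k, 'v) tensor = "('v list \<Rightarrow> 'k) \<Rightarrow> 'k"
type_synonym ('k, 'v) tensor2 = "('v list \<Rightarrow> 'v list \<Rightarrow> 'k) \<Rightarrow> 'k"

definition multilin ::
  "('k::field \<Rightarrow> 'v::ab_group_add \<Rightarrow> 'v) \<Rightarrow> ('v list \<Rightarrow> 'k) \<Rightarrow> bool" where
  "multilin scl f \<longleftrightarrow>
     (\<forall>xs i. i < length xs \<longrightarrow> Vector_Spaces.linear scl (*) (\<lambda>v. f (xs[i := v])))"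

definition multilin2 ::
  "('k::field \<Rightarrow> 'v::ab_group_add \<Rightarrow> 'v) \<Rightarrow> ('v list \<Rightarrow> 'v list \<Rightarrow> 'k) \<Rightarrow> bool" where
  "multilin2 scl g \<longleftrightarrow>
     (\<forall>xs. multilin scl (\<lambda>ys. g xs ys)) \<and> (\<forall>ys. multilin scl (\<lambda>xs. g xs ys))"

definition tens :: "('k::field \<Rightarrow> 'v::ab_group_add \<Rightarrow> 'v) \<Rightarrow> 'v list \<Rightarrow> ('k, 'v) tensor" where
  "tens scl xs = (\<lambda>f. if multilin scl f then f xs else 0)"

definition tscale :: "'k::times \<Rightarrow> ('f \<Rightarrow> 'k) \<Rightarrow> 'f \<Rightarrow> 'k" where
  "tscale c t = (\<lambda>f. c * t f)"

definition tensor_algebra ::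
  "('k::field \<Rightarrow> 'v::ab_group_add \<Rightarrow> 'v) \<Rightarrow> ('k, 'v) tensor set" where
  "tensor_algebra scl = module.span tscale (range (tens scl))"

definition tprod ::
  "('k::field \<Rightarrow> 'v::ab_group_add \<Rightarrow> 'v) \<Rightarrow> ('k, 'v) tensor \<Rightarrow> ('k, 'v) tensor \<Rightarrow> ('k, 'v) tensor2" where
  "tprod scl s t = (\<lambda>g. if multilin2 scl g then s (\<lambda>xs. t (\<lambda>ys. g xs ys)) else 0)"

text \<open>
  For \<open>\<phi>\<close> multilinear, \<open>tlift \<phi>\<close> is the linear map with \<open>tens scl xs \<mapsto> \<phi> xs\<close>, and
  \<open>tlift2 \<phi>\<close> is the linear map with \<open>tprod scl (tens scl xs) (tens scl ys) \<mapsto> \<phi> xs ys\<close>.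
\<close>

definition tlift :: "('v list \<Rightarrow> 'f \<Rightarrow> 'k) \<Rightarrow> ('k, 'v) tensor \<Rightarrow> 'f \<Rightarrow> 'k" where
  "tlift \<phi> t = (\<lambda>f. t (\<lambda>xs. \<phi> xs f))"

definition tlift2 :: "('v list \<Rightarrow> 'v list \<Rightarrow> 'f \<Rightarrow> 'k) \<Rightarrow> ('k, 'v) tensor2 \<Rightarrow> 'f \<Rightarrow> 'k" where
  "tlift2 \<phi> t = (\<lambda>f. t (\<lambda>xs ys. \<phi> xs ys f))"

text \<open>The component in the \<open>n\<close>-th tensor power.\<close>

definition tcomp ::
  "('k::field \<Rightarrow> 'v::ab_group_add \<Rightarrow> 'v) \<Rightarrow> nat \<Rightarrow> ('k, 'v) tensor \<Rightarrow> ('k, 'v) tensor" where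
  "tcomp scl n = tlift (\<lambda>xs. if length xs = n then tens scl xs else 0)"

text \<open>
  Multilinear extension of a formula given on homogeneous vectors: \<open>\<phi> es vs\<close> is the value on
  \<open>vs\<close> when the \<open>i\<close>-th vector has parity \<open>es ! i\<close>.
\<close>

definition hom_ext ::
  "(bool \<Rightarrow> 'v::ab_group_add set) \<Rightarrow> (bool list \<Rightarrow> 'v list \<Rightarrow> 'a::comm_monoid_add) \<Rightarrow> 'v list \<Rightarrow> 'a" where
  "hom_ext V \<phi> xs = (\<Sum>es | length es = length xs. \<phi> es (map2 (hpart V) es xs))"


section \<open>Symmetric algebra\<close>

definition koszul :: "bool list \<Rightarrow> (nat \<Rightarrow> nat) \<Rightarrow> 'k::comm_ring_1" where
  "koszul es \<sigma> = (- 1) ^ card {(i, j). i < j \<and> j < length es \<and> \<sigma> j < \<sigma> i \<and> es ! \<sigma> i \<and> es ! \<sigma> j}"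

definition symmetrize ::
  "('k::field_char_0 \<Rightarrow> 'v::ab_group_add \<Rightarrow> 'v) \<Rightarrow> (bool \<Rightarrow> 'v set) \<Rightarrow> ('k, 'v) tensor \<Rightarrow> ('k, 'v) tensor" where
  "symmetrize scl V = tlift (hom_ext V (\<lambda>es vs.
     tscale (1 / fact (length vs))
       (\<Sum>\<sigma> | \<sigma> permutes {..<length vs}. tscale (koszul es \<sigma>) (tens scl (permute_list \<sigma> vs)))))"

definition sym_algebra ::
  "('k::field_char_0 \<Rightarrow> 'v::ab_group_add \<Rightarrow> 'v) \<Rightarrow> (bool \<Rightarrow> 'v set) \<Rightarrow> ('k, 'v) tensor set" where
  "sym_algebra scl V = symmetrize scl V ` tensor_algebra scl"

text \<open>The product \<open>v\<^sub>1 \<cdots> v\<^sub>n\<close> of vectors in the symmetric algebra.\<close>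

definition sym_prod ::
  "('k::field_char_0 \<Rightarrow> 'v::ab_group_add \<Rightarrow> 'v) \<Rightarrow> (bool \<Rightarrow> 'v set) \<Rightarrow> 'v list \<Rightarrow> ('k, 'v) tensor" where
  "sym_prod scl V vs = symmetrize scl V (tens scl vs)"

definition sym_mult ::
  "('k::field_char_0 \<Rightarrow> 'v::ab_group_add \<Rightarrow> 'v) \<Rightarrow> (bool \<Rightarrow> 'v set) \<Rightarrow> ('k, 'v) tensor2 \<Rightarrow> ('k, 'v) tensor" where
  "sym_mult scl V = tlift2 (\<lambda>xs ys. symmetrize scl V (tens scl (xs @ ys)))"


section \<open>Star product\<close>

definition omit :: "nat \<Rightarrow> 'a list \<Rightarrow> 'a list" where
  "omit k xs = take k xs @ drop (Suc k) xs"

text \<open>The right-hand side of the defining formula of \<open>P\<^sub>\<Lambda>\<close>, with positions counted from 0.\<close>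

definition contraction ::
  "('k::field_char_0 \<Rightarrow> 'v::ab_group_add \<Rightarrow> 'v) \<Rightarrow> (bool \<Rightarrow> 'v set) \<Rightarrow> ('v \<Rightarrow> 'v \<Rightarrow> 'k) \<Rightarrow>
     bool list \<Rightarrow> 'v list \<Rightarrow> bool list \<Rightarrow> 'v list \<Rightarrow> ('k, 'v) tensor2" where
  "contraction scl V \<Lambda> es vs ds ws =
     (\<Sum>k<length vs. \<Sum>l<length ws.
        tscale ((- 1) ^ (of_bool (es ! k) * (\<Sum>i\<in>{k<..<length vs}. of_bool (es ! i)) +
                         of_bool (ds ! l) * (\<Sum>j<l. of_bool (ds ! j))) * \<Lambda> (vs ! k) (ws ! l))
          (tprod scl (sym_prod scl V (omit k vs)) (sym_prod scl V (omit l ws))))"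

text \<open>
  \<open>P_op\<close> is defined on the tensor product of two copies of the full tensor algebra; \<open>P\<^sub>\<Lambda>\<close> is its
  restriction to the tensor product of two copies of the symmetric algebra. That this restriction
  satisfies the defining formula on products \<open>v\<^sub>1 \<cdots> v\<^sub>n \<otimes> w\<^sub>1 \<cdots> w\<^sub>m\<close> of homogeneous vectors is
  lemma \<open>P_op_sym_prod\<close> below.
\<close>

definition P_op ::
  "('k::field_char_0 \<Rightarrow> 'v::ab_group_add \<Rightarrow> 'v) \<Rightarrow> (bool \<Rightarrow> 'v set) \<Rightarrow> ('v \<Rightarrow> 'v \<Rightarrow> 'k) \<Rightarrow>
     ('k, 'v) tensor2 \<Rightarrow> ('k, 'v) tensor2" where
  "P_op scl V \<Lambda> = tlift2 (\<lambda>xs ys.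
     hom_ext V (\<lambda>es vs. hom_ext V (\<lambda>ds ws. contraction scl V \<Lambda> es vs ds ws) ys) xs)"

definition star_coeff ::
  "('k::field_char_0 \<Rightarrow> 'v::ab_group_add \<Rightarrow> 'v) \<Rightarrow> (bool \<Rightarrow> 'v set) \<Rightarrow> ('v \<Rightarrow> 'v \<Rightarrow> 'k) \<Rightarrow> nat \<Rightarrow>
     ('k, 'v) tensor \<Rightarrow> ('k, 'v) tensor \<Rightarrow> ('k, 'v) tensor" where
  "star_coeff scl V \<Lambda> k a b = sym_mult scl V ((P_op scl V \<Lambda> ^^ k) (tprod scl a b))"

text \<open>For \<open>a\<close> and \<open>b\<close> in the symmetric algebra only finitely many terms are nonzero.\<close>

definition star ::
  "('k::field_char_0 \<Rightarrow> 'v::ab_group_add \<Rightarrow> 'v) \<Rightarrow> (bool \<Rightarrow> 'v set) \<Rightarrow> ('v \<Rightarrow> 'v \<Rightarrow> 'k) \<Rightarrow> 'k \<Rightarrow>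
     ('k, 'v) tensor \<Rightarrow> ('k, 'v) tensor \<Rightarrow> ('k, 'v) tensor" where
  "star scl V \<Lambda> z a b =
     (\<Sum>k | star_coeff scl V \<Lambda> k a b \<noteq> 0. tscale (z ^ k / fact k) (star_coeff scl V \<Lambda> k a b))"


section \<open>Topology and completion\<close>

text \<open>
  The projective seminorm \<open>p\<^sup>n\<close> on the \<open>n\<close>-th tensor power. The coefficients are needed only for
  \<open>n = 0\<close>, where the seminorm is the absolute value.
\<close>

definition tensor_seminorm ::
  "('k::real_normed_field \<Rightarrow> 'v::ab_group_add \<Rightarrow> 'v) \<Rightarrow> nat \<Rightarrow> ('v \<Rightarrow> real) \<Rightarrow> ('k, 'v) tensor \<Rightarrow> real" where
  "tensor_seminorm scl n p t =
     Inf {(\<Sum>xs\<in>X. norm (c xs) * prod_list (map p xs)) | X c.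
            finite X \<and> (\<forall>xs\<in>X. length xs = n) \<and> t = (\<Sum>xs\<in>X. tscale (c xs) (tens scl xs))}"

definition weyl_seminorm ::
  "('k::real_normed_field \<Rightarrow> 'v::ab_group_add \<Rightarrow> 'v) \<Rightarrow> real \<Rightarrow> ('v \<Rightarrow> real) \<Rightarrow> ('k, 'v) tensor \<Rightarrow> real" where
  "weyl_seminorm scl R p t = (\<Sum>n. tensor_seminorm scl n p (tcomp scl n t) * fact n powr R)"

definition weyl_seminorms ::
  "('k::real_normed_field \<Rightarrow> 'v::{ab_group_add,topological_space} \<Rightarrow> 'v) \<Rightarrow> real \<Rightarrow>
     (('k, 'v) tensor \<Rightarrow> real) set" where
  "weyl_seminorms scl R = {weyl_seminorm scl R p | p. continuous_seminorm scl p}"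

definition weyl_seminorms_minus ::
  "('k::real_normed_field \<Rightarrow> 'v::{ab_group_add,topological_space} \<Rightarrow> 'v) \<Rightarrow> real \<Rightarrow>
     (('k, 'v) tensor \<Rightarrow> real) set" where
  "weyl_seminorms_minus scl R =
     {weyl_seminorm scl (R - \<epsilon>) p | p \<epsilon>. continuous_seminorm scl p \<and> \<epsilon> > 0}"

definition seminorm_topology :: "'t::ab_group_add set \<Rightarrow> ('t \<Rightarrow> real) set \<Rightarrow> 't topology" where
  "seminorm_topology S Q =
     topology_generated_by {{y \<in> S. q (y - x) < r} | q x r. q \<in> Q \<and> x \<in> S \<and> r > 0}"

text \<open>
  \<open>\<iota>\<close> exhibits the type \<open>'w\<close> as a completion of the subspace \<open>S\<close> with the topology given by the
  seminorms in \<open>Q\<close>. Completeness and the Hausdorff property are part of the sort of \<open>'w\<close>; the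
  uniformity of a \<^class>\<open>uniform_topological_group_add\<close> is the one of the additive group. This
  determines the completion up to unique isomorphism.
\<close>

definition is_completion ::
  "('k::real_normed_field \<Rightarrow> 't::ab_group_add \<Rightarrow> 't) \<Rightarrow> 't set \<Rightarrow> ('t \<Rightarrow> real) set \<Rightarrow>
     ('k \<Rightarrow> 'w::{uniform_topological_group_add,topological_ab_group_add,t2_space,complete_uniform_space} \<Rightarrow> 'w) \<Rightarrow>
     ('t \<Rightarrow> 'w) \<Rightarrow> bool" where
  "is_completion scl S Q scl' \<iota> \<longleftrightarrow>
     hausdorff_lcs scl' \<and>
     (\<forall>x\<in>S. \<forall>y\<in>S. \<iota> (x + y) = \<iota> x + \<iota> y) \<and>
     (\<forall>c. \<forall>x\<in>S. \<iota> (scl c x) = scl' c (\<iota> x)) \<and>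
     embedding_map (seminorm_topology S Q) euclidean \<iota> \<and>
     closure (\<iota> ` S) = UNIV"

text \<open>The continuous bilinear extension of \<open>\<beta>\<close> from \<open>S\<close> to the completion; it is unique by density.\<close>

definition cont_ext ::
  "('k::field \<Rightarrow> 'w::{ab_group_add,t2_space} \<Rightarrow> 'w) \<Rightarrow> 't set \<Rightarrow> ('t \<Rightarrow> 'w) \<Rightarrow> ('t \<Rightarrow> 't \<Rightarrow> 't) \<Rightarrow>
     'w \<Rightarrow> 'w \<Rightarrow> 'w" where
  "cont_ext scl' S \<iota> \<beta> = (THE B.
     (\<forall>a. Vector_Spaces.linear scl' scl' (B a)) \<and>
     (\<forall>b. Vector_Spaces.linear scl' scl' (\<lambda>a. B a b)) \<and>
     continuous_on UNIV (\<lambda>(a, b). B a b) \<and>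
     (\<forall>x\<in>S. \<forall>y\<in>S. B (\<iota> x) (\<iota> y) = \<iota> (\<beta> x y)))"

definition converges_absolutely_to ::
  "('k::real_normed_field \<Rightarrow> 'w::{topological_space,ab_group_add} \<Rightarrow> 'w) \<Rightarrow> (nat \<Rightarrow> 'w) \<Rightarrow> 'w \<Rightarrow> bool" where
  "converges_absolutely_to scl' x s \<longleftrightarrow>
     x sums s \<and> (\<forall>q. continuous_seminorm scl' q \<longrightarrow> summable (\<lambda>k. q (x k)))"


section \<open>Koszul signs\<close>

definition sgb :: "bool \<Rightarrow> 'k::comm_ring_1" where "sgb b = (if b then -1 else 1)"

lemma sgb_sq [simp]: "sgb b * sgb b = (1::'k::comm_ring_1)" by (simp add: sgb_def)

lemma minus_one_power_card:
  "finite A \<Longrightarrow> (- 1) ^ card {x\<in>A. P x} = (\<Prod>x\<in>A. sgb (P x) :: 'k::comm_ring_1)"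
proof (induction A rule: finite_induct)
  case (insert x A)
  have "{y \<in> insert x A. P y} = (if P x then insert x {y\<in>A. P y} else {y\<in>A. P y})" by auto
  with insert show ?case by (auto simp: sgb_def)
qed simp

definition pairs :: "nat \<Rightarrow> (nat \<times> nat) set" where "pairs n = {(i, j). i < j \<and> j < n}"

lemma finite_pairs [simp]: "finite (pairs n)"
  by (rule finite_subset[of _ "{..<n} \<times> {..<n}"]) (auto simp: pairs_def)

definition disord :: "bool list \<Rightarrow> (nat \<Rightarrow> nat) \<Rightarrow> nat \<Rightarrow> nat \<Rightarrow> bool" where
  "disord es \<sigma> i j \<longleftrightarrow> es ! \<sigma> i \<and> es ! \<sigma> j \<and> (i < j) \<noteq> (\<sigma> i < \<sigma> j)"

lemma disord_commute:
  assumes "inj \<sigma>" "i \<noteq> j" shows "disord es \<sigma> i j = disord es \<sigma> j i"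
proof -
  have "\<sigma> i \<noteq> \<sigma> j" using assms by (auto dest: injD)
  then show ?thesis using assms(2) by (auto simp: disord_def)
qed

lemma koszul_prod:
  assumes "inj \<sigma>" "length es = n"
  shows "koszul es \<sigma> = (\<Prod>(i, j)\<in>pairs n. sgb (disord es \<sigma> i j) :: 'k::comm_ring_1)"
proof -
  have "{(i, j). i < j \<and> j < length es \<and> \<sigma> j < \<sigma> i \<and> es ! \<sigma> i \<and> es ! \<sigma> j} =
        {x \<in> pairs n. disord es \<sigma> (fst x) (snd x)}"
  proof (rule set_eqI, clarify)
    fix i j
    have "i < j \<Longrightarrow> \<sigma> i \<noteq> \<sigma> j" using injD[OF assms(1), of i j] by blast
    then show "(i, j) \<in> {(i, j). i < j \<and> j < length es \<and> \<sigma> j < \<sigma> i \<and> es ! \<sigma> i \<and> es ! \<sigma> j} \<longleftrightarrow>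
        (i, j) \<in> {x \<in> pairs n. disord es \<sigma> (fst x) (snd x)}"
      unfolding pairs_def disord_def assms(2)[symmetric] mem_Collect_eq prod.case fst_conv snd_conv
      by linarith
  qed
  then have "koszul es \<sigma> = (- 1 :: 'k) ^ card {x \<in> pairs n. disord es \<sigma> (fst x) (snd x)}"
    by (simp only: koszul_def)
  also have "\<dots> = (\<Prod>x\<in>pairs n. sgb (disord es \<sigma> (fst x) (snd x)))"
    by (rule minus_one_power_card) simp
  finally show ?thesis by (simp add: case_prod_beta')
qed

lemma koszul_sq: "koszul es \<sigma> * koszul es \<sigma> = (1::'k::comm_ring_1)"
  unfolding koszul_def by (simp add: minus_one_power_iff)

lemma koszul_compose:
  assumes t: "\<tau> permutes {..<n}" and s: "\<sigma> permutes {..<n}" and n: "length es = n"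
  shows "koszul es (\<tau> \<circ> \<sigma>) = koszul es \<tau> * (koszul (permute_list \<tau> es) \<sigma> :: 'k::comm_ring_1)"
proof -
  have inj: "inj \<sigma>" "inj \<tau>" "inj (\<tau> \<circ> \<sigma>)"
    using t s by (auto intro: permutes_inj inj_compose)
  have lt: "\<sigma> i < n \<longleftrightarrow> i < n" for i using permutes_in_image[OF s, of i] by simp
  let ?q = "inv \<sigma>"
  have qs: "?q permutes {..<n}" using s by (rule permutes_inv)
  have ltq: "?q i < n \<longleftrightarrow> i < n" for i using permutes_in_image[OF qs, of i] by simp
  have sq: "\<sigma> (?q i) = i" "?q (\<sigma> i) = i" for i using s by (auto simp: permutes_inverses)
  have neq: "\<sigma> i \<noteq> \<sigma> j" "?q i \<noteq> ?q j" if "i < j" for i j using sq that by (metis less_irrefl)+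
  have "(\<Prod>(a, b)\<in>pairs n. sgb (disord es \<tau> a b)) =
        (\<Prod>(i, j)\<in>pairs n. sgb (disord es \<tau> (\<sigma> i) (\<sigma> j)) :: 'k)"
  proof (rule prod.reindex_bij_witness[where
        i = "\<lambda>(i, j). (min (\<sigma> i) (\<sigma> j), max (\<sigma> i) (\<sigma> j))" and
        j = "\<lambda>(a, b). (min (?q a) (?q b), max (?q a) (?q b))"], goal_cases)
    case (1 a) then show ?case by (auto simp: pairs_def sq min_def max_def)
  next
    case (2 a) then show ?case using neq(2)[of "fst a" "snd a"]
      by (auto simp: pairs_def ltq min_def max_def)
  next
    case (3 a) then show ?case by (auto simp: pairs_def sq min_def max_def)
  next
    case (4 a) then show ?case using neq(1)[of "fst a" "snd a"]
      by (auto simp: pairs_def lt min_def max_def)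
  next
    case (5 a) then show ?case using disord_commute[OF inj(2), of "fst a" "snd a" es]
      by (auto simp: pairs_def sq min_def max_def)
  qed
  then have "koszul es \<tau> * (koszul (permute_list \<tau> es) \<sigma> :: 'k) =
     (\<Prod>x\<in>pairs n. (case x of (i, j) \<Rightarrow> sgb (disord es \<tau> (\<sigma> i) (\<sigma> j))) *
                   (case x of (i, j) \<Rightarrow> sgb (disord (permute_list \<tau> es) \<sigma> i j)))"
    by (simp add: koszul_prod[OF inj(2) n] koszul_prod[OF inj(1), of _ n] n prod.distrib)
  also have "\<dots> = (\<Prod>(i, j)\<in>pairs n. sgb (disord es (\<tau> \<circ> \<sigma>) i j))"
  proof (rule prod.cong[OF refl], clarify)
    fix i j assume "(i, j) \<in> pairs n"
    then have ij: "i < j" "j < n" "i < n" by (auto simp: pairs_def)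
    have "permute_list \<tau> es ! \<sigma> i = es ! \<tau> (\<sigma> i)" "permute_list \<tau> es ! \<sigma> j = es ! \<tau> (\<sigma> j)"
      using ij t n lt by (auto simp: permute_list_nth)
    then show "sgb (disord es \<tau> (\<sigma> i) (\<sigma> j)) * sgb (disord (permute_list \<tau> es) \<sigma> i j) =
          (sgb (disord es (\<tau> \<circ> \<sigma>) i j) :: 'k)"
      using ij by (auto simp: disord_def sgb_def)
  qed
  also have "\<dots> = koszul es (\<tau> \<circ> \<sigma>)" by (rule koszul_prod[OF inj(3) n, symmetric])
  finally show ?thesis ..
qed

definition skip :: "nat \<Rightarrow> nat \<Rightarrow> nat" where "skip k i = (if i < k then i else Suc i)"
definition unskip :: "nat \<Rightarrow> nat \<Rightarrow> nat" where "unskip m j = (if j < m then j else j - 1)"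

lemma length_omit: "k < length xs \<Longrightarrow> length (omit k xs) = length xs - 1"
  by (simp add: omit_def)

lemma omit_nth: "k < length xs \<Longrightarrow> i < length xs - 1 \<Longrightarrow> omit k xs ! i = xs ! skip k i"
  by (auto simp: omit_def nth_append skip_def min_def)

lemma skip_neq: "skip k i \<noteq> k" by (auto simp: skip_def)
lemma skip_less_iff: "skip k i < skip k j \<longleftrightarrow> i < j" by (auto simp: skip_def)
lemma skip_lt: "k < n \<Longrightarrow> skip k i < n \<longleftrightarrow> i < n - 1" by (auto simp: skip_def)
lemma skip_unskip: "j \<noteq> m \<Longrightarrow> skip m (unskip m j) = j" by (auto simp: skip_def unskip_def)
lemma unskip_skip: "unskip m (skip m j) = j" by (auto simp: skip_def unskip_def)
lemma unskip_less_iff: "a \<noteq> m \<Longrightarrow> b \<noteq> m \<Longrightarrow> unskip m a < unskip m b \<longleftrightarrow> a < b"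
  by (auto simp: unskip_def)

definition omit_perm :: "nat \<Rightarrow> nat \<Rightarrow> (nat \<Rightarrow> nat) \<Rightarrow> nat \<Rightarrow> nat" where
  "omit_perm n k \<sigma> i = (if i < n - 1 then unskip (\<sigma> k) (\<sigma> (skip k i)) else i)"

lemma omit_perm:
  assumes s: "\<sigma> permutes {..<n}" and k: "k < n"
  shows "omit_perm n k \<sigma> permutes {..<n-1}"
    and "\<And>i. i < n - 1 \<Longrightarrow> skip (\<sigma> k) (omit_perm n k \<sigma> i) = \<sigma> (skip k i)"
proof -
  have inj: "inj \<sigma>" using s by (rule permutes_inj)
  have lt: "\<sigma> i < n \<longleftrightarrow> i < n" for i using permutes_in_image[OF s, of i] by simp
  have neq: "\<sigma> (skip k i) \<noteq> \<sigma> k" for i using inj skip_neq by (metis injD)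
  show sk: "skip (\<sigma> k) (omit_perm n k \<sigma> i) = \<sigma> (skip k i)" if "i < n - 1" for i
    using that neq by (simp add: omit_perm_def skip_unskip)
  show "omit_perm n k \<sigma> permutes {..<n-1}"
  proof (rule bij_imp_permutes)
    have im: "omit_perm n k \<sigma> ` {..<n-1} \<subseteq> {..<n-1}"
    proof clarify
      fix i assume "i < n - 1" then show "omit_perm n k \<sigma> i < n - 1"
        using sk[of i] skip_lt[of "\<sigma> k" n "omit_perm n k \<sigma> i"] lt k by (simp add: skip_lt)
    qed
    moreover have "inj_on (omit_perm n k \<sigma>) {..<n-1}"
    proof (rule inj_onI)
      fix i j assume "i \<in> {..<n-1}" "j \<in> {..<n-1}" "omit_perm n k \<sigma> i = omit_perm n k \<sigma> j"
      then have "\<sigma> (skip k i) = \<sigma> (skip k j)" using sk[of i] sk[of j] by simp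
      then have "skip k i = skip k j" using inj by (auto dest: injD)
      then show "i = j" by (metis unskip_skip)
    qed
    ultimately show "bij_betw (omit_perm n k \<sigma>) {..<n-1} {..<n-1}"
      by (simp add: bij_betw_def endo_inj_surj)
  qed (simp add: omit_perm_def)
qed

lemma omit_permute_list:
  assumes s: "\<sigma> permutes {..<length xs}" and k: "k < length xs"
  shows "omit k (permute_list \<sigma> xs) = permute_list (omit_perm (length xs) k \<sigma>) (omit (\<sigma> k) xs)"
proof (rule nth_equalityI)
  have sk: "\<sigma> k < length xs" using permutes_in_image[OF s, of k] k by simp
  show "length (omit k (permute_list \<sigma> xs)) =
        length (permute_list (omit_perm (length xs) k \<sigma>) (omit (\<sigma> k) xs))"
    using k sk by (simp add: length_omit)
  fix i assume "i < length (omit k (permute_list \<sigma> xs))"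
  then have i: "i < length xs - 1" using k by (simp add: length_omit)
  have p: "omit_perm (length xs) k \<sigma> permutes {..<length xs - 1}" using omit_perm(1)[OF s k] .
  have pi: "omit_perm (length xs) k \<sigma> i < length xs - 1" using permutes_in_image[OF p, of i] i by simp
  have "omit k (permute_list \<sigma> xs) ! i = xs ! \<sigma> (skip k i)"
    using i k s skip_lt[OF k] by (simp add: omit_nth permute_list_nth)
  also have "\<dots> = permute_list (omit_perm (length xs) k \<sigma>) (omit (\<sigma> k) xs) ! i"
    using i k s sk p pi by (simp add: omit_nth permute_list_nth length_omit omit_perm(2))
  finally show "omit k (permute_list \<sigma> xs) ! i =
        permute_list (omit_perm (length xs) k \<sigma>) (omit (\<sigma> k) xs) ! i" .
qed

lemma pairs_split:
  assumes "k < n"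
  shows "(\<Prod>(i, j)\<in>pairs n. F i j) =
    (\<Prod>(i, j)\<in>pairs (n - 1). F (skip k i) (skip k j)) *
    (\<Prod>j\<in>{..<n} - {k}. if j < k then F j k else F k j :: 'k::comm_monoid_mult)"
proof -
  let ?A = "(\<lambda>(i, j). (skip k i, skip k j)) ` pairs (n - 1)"
  let ?h = "\<lambda>j. if j < k then (j, k) else (k, j)"
  let ?B = "?h ` ({..<n} - {k})"
  have "pairs n = ?A \<union> ?B"
  proof (intro equalityI subsetI)
    fix x assume "x \<in> pairs n"
    then obtain i j where x: "x = (i, j)" "i < j" "j < n" by (auto simp: pairs_def)
    show "x \<in> ?A \<union> ?B"
    proof (cases "i = k \<or> j = k")
      case True then show ?thesis using x by (auto simp: image_iff)
    next
      case False
      then have "(unskip k i, unskip k j) \<in> pairs (n - 1)" "x = (skip k (unskip k i), skip k (unskip k j))"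
        using x assms by (auto simp: pairs_def skip_unskip unskip_less_iff) (auto simp: unskip_def)
      then show ?thesis by force
    qed
  next
    fix x assume "x \<in> ?A \<union> ?B"
    then show "x \<in> pairs n" using assms
      by (auto simp: pairs_def skip_less_iff skip_lt split: if_splits)
  qed
  moreover have "?A \<inter> ?B = {}" by (auto split: if_splits simp: skip_neq skip_neq[symmetric])
  moreover have "inj_on (\<lambda>(i, j). (skip k i, skip k j)) (pairs (n - 1))"
    by (rule inj_onI) (auto, (metis unskip_skip)+)
  moreover have "inj_on ?h ({..<n} - {k})" by (rule inj_onI) (auto split: if_splits)
  ultimately have "(\<Prod>(i, j)\<in>pairs n. F i j) =
      (\<Prod>(i, j)\<in>pairs (n-1). F (skip k i) (skip k j)) *
      (\<Prod>j\<in>{..<n} - {k}. case ?h j of (i, j) \<Rightarrow> F i j)"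
  proof -
    assume a: "pairs n = ?A \<union> ?B" "?A \<inter> ?B = {}"
      "inj_on (\<lambda>(i, j). (skip k i, skip k j)) (pairs (n - 1))" "inj_on ?h ({..<n} - {k})"
    have "(\<Prod>(i, j)\<in>pairs n. F i j) = (\<Prod>(i, j)\<in>?A. F i j) * (\<Prod>(i, j)\<in>?B. F i j)"
      unfolding a(1) by (rule prod.union_disjoint) (use a(2) in auto)
    also have "(\<Prod>(i, j)\<in>?A. F i j) = (\<Prod>(i, j)\<in>pairs (n-1). F (skip k i) (skip k j))"
      by (subst prod.reindex[OF a(3)]) (simp add: o_def case_prod_beta')
    also have "(\<Prod>(i, j)\<in>?B. F i j) = (\<Prod>j\<in>{..<n} - {k}. case ?h j of (i, j) \<Rightarrow> F i j)"
      by (subst prod.reindex[OF a(4)]) (simp only: o_def)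
    finally show ?thesis .
  qed
  also have "(\<Prod>j\<in>{..<n} - {k}. case ?h j of (i, j) \<Rightarrow> F i j) =
     (\<Prod>j\<in>{..<n} - {k}. if j < k then F j k else F k j)"
    by (rule prod.cong) auto
  finally show ?thesis .
qed

definition rsign :: "bool list \<Rightarrow> nat \<Rightarrow> 'k::comm_ring_1" where
  "rsign es k = (\<Prod>j\<in>{..<length es} - {k}. sgb (es ! k \<and> es ! j \<and> k < j))"
definition lsign :: "bool list \<Rightarrow> nat \<Rightarrow> 'k::comm_ring_1" where
  "lsign es k = (\<Prod>j\<in>{..<length es} - {k}. sgb (es ! k \<and> es ! j \<and> j < k))"

lemma sgb_power: "(- 1) ^ (of_bool a * of_bool b) = (sgb (a \<and> b) :: 'k::comm_ring_1)"
  by (auto simp: sgb_def)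

lemma rsign_eq:
  assumes "k < length es"
  shows "(- 1) ^ (of_bool (es ! k) * (\<Sum>i\<in>{k<..<length es}. of_bool (es ! i))) = (rsign es k :: 'k::comm_ring_1)"
proof -
  have "rsign es k = (\<Prod>j\<in>{k<..<length es}. sgb (es ! k \<and> es ! j \<and> k < j) :: 'k)"
    unfolding rsign_def by (rule prod.mono_neutral_right) (auto simp: sgb_def)
  then show ?thesis
    by (simp only: sum_distrib_left power_sum sgb_power) (rule prod.cong, auto)
qed

lemma lsign_eq:
  assumes "k < length es"
  shows "(- 1) ^ (of_bool (es ! k) * (\<Sum>i<k. of_bool (es ! i))) = (lsign es k :: 'k::comm_ring_1)"
proof -
  have "lsign es k = (\<Prod>j<k. sgb (es ! k \<and> es ! j \<and> j < k) :: 'k)"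
    unfolding lsign_def by (rule prod.mono_neutral_right) (use assms in \<open>auto simp: sgb_def\<close>)
  then show ?thesis
    by (simp only: sum_distrib_left power_sum sgb_power) (rule prod.cong, auto)
qed

lemma sign_perm_reindex:
  assumes s: "\<sigma> permutes {..<n}" and k: "k < n"
  shows "(\<Prod>i\<in>{..<n} - {\<sigma> k}. F i) = (\<Prod>j\<in>{..<n} - {k}. F (\<sigma> j) :: 'k::comm_ring_1)"
proof -
  have "bij_betw \<sigma> ({..<n} - {k}) ({..<n} - {\<sigma> k})"
    using permutes_inj[OF s] by (simp add: bij_betw_def inj_on_subset[of _ UNIV]
       image_set_diff permutes_image[OF s])
  then show ?thesis by (rule prod.reindex_bij_betw[symmetric])
qed

lemma koszul_omit:
  assumes s: "\<sigma> permutes {..<length es}" and k: "k < length es"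
  shows "koszul es \<sigma> = rsign (permute_list \<sigma> es) k * rsign es (\<sigma> k) *
           (koszul (omit (\<sigma> k) es) (omit_perm (length es) k \<sigma>) :: 'k::comm_ring_1)" (is ?R)
    and "koszul es \<sigma> = lsign (permute_list \<sigma> es) k * lsign es (\<sigma> k) *
           (koszul (omit (\<sigma> k) es) (omit_perm (length es) k \<sigma>) :: 'k::comm_ring_1)" (is ?L)
proof -
  let ?n = "length es"
  let ?p = "omit_perm ?n k \<sigma>"
  have inj: "inj \<sigma>" using s by (rule permutes_inj)
  have lt: "\<sigma> i < ?n \<longleftrightarrow> i < ?n" for i using permutes_in_image[OF s, of i] by simp
  have p: "?p permutes {..<?n-1}" by (rule omit_perm(1)[OF s k])
  have plt: "?p i < ?n - 1 \<longleftrightarrow> i < ?n - 1" for i using permutes_in_image[OF p, of i] by simp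
  have "koszul (omit (\<sigma> k) es) ?p = (\<Prod>(i, j)\<in>pairs (?n - 1). sgb (disord (omit (\<sigma> k) es) ?p i j) :: 'k)"
    by (rule koszul_prod[OF permutes_inj[OF p]]) (use lt k in \<open>simp add: length_omit\<close>)
  also have "\<dots> = (\<Prod>(i, j)\<in>pairs (?n - 1). sgb (disord es \<sigma> (skip k i) (skip k j)))"
  proof (rule prod.cong[OF refl], clarify)
    fix i j assume "(i, j) \<in> pairs (?n - 1)"
    then have ij: "i < j" "j < ?n - 1" "i < ?n - 1" by (auto simp: pairs_def)
    have "disord (omit (\<sigma> k) es) ?p i j = disord es \<sigma> (skip k i) (skip k j)"
      using ij k lt plt omit_perm(2)[OF s k, of i] omit_perm(2)[OF s k, of j]
        skip_less_iff[of "\<sigma> k" "?p i" "?p j"]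
      by (simp add: disord_def omit_nth skip_less_iff)
    then show "sgb (disord (omit (\<sigma> k) es) ?p i j) = (sgb (disord es \<sigma> (skip k i) (skip k j)) :: 'k)"
      by simp
  qed
  finally have K: "koszul es \<sigma> = koszul (omit (\<sigma> k) es) ?p *
      (\<Prod>j\<in>{..<?n} - {k}. if j < k then sgb (disord es \<sigma> j k) else sgb (disord es \<sigma> k j) :: 'k)"
    using koszul_prod[OF inj refl, of es, where 'k='k] by (simp add: pairs_split[OF k])
  have neq: "\<sigma> j \<noteq> \<sigma> k" if "j \<noteq> k" for j using that inj by (auto dest: injD)
  have nth: "permute_list \<sigma> es ! j = es ! \<sigma> j" if "j < ?n" for j
    using that s by (simp add: permute_list_nth)
  have "rsign (permute_list \<sigma> es) k * rsign es (\<sigma> k) =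
     (\<Prod>j\<in>{..<?n} - {k}. sgb (es ! \<sigma> k \<and> permute_list \<sigma> es ! j \<and> k < j) *
        sgb (es ! \<sigma> k \<and> es ! \<sigma> j \<and> \<sigma> k < \<sigma> j) :: 'k)"
    unfolding rsign_def using k by (simp add: sign_perm_reindex[OF s k] prod.distrib nth)
  also have "\<dots> = (\<Prod>j\<in>{..<?n} - {k}. if j < k then sgb (disord es \<sigma> j k) else sgb (disord es \<sigma> k j))"
  proof (rule prod.cong[OF refl], goal_cases)
    case (1 j)
    then have "j < ?n" "j \<noteq> k" "\<sigma> j \<noteq> \<sigma> k" using neq by auto
    then show ?case
      by (cases "j < k"; cases "\<sigma> j < \<sigma> k") (simp_all add: nth disord_def sgb_def)
  qed
  finally show ?R using K by (simp add: mult.commute)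
  have "lsign (permute_list \<sigma> es) k * lsign es (\<sigma> k) =
     (\<Prod>j\<in>{..<?n} - {k}. sgb (es ! \<sigma> k \<and> permute_list \<sigma> es ! j \<and> j < k) *
        sgb (es ! \<sigma> k \<and> es ! \<sigma> j \<and> \<sigma> j < \<sigma> k) :: 'k)"
    unfolding lsign_def using k by (simp add: sign_perm_reindex[OF s k] prod.distrib nth)
  also have "\<dots> = (\<Prod>j\<in>{..<?n} - {k}. if j < k then sgb (disord es \<sigma> j k) else sgb (disord es \<sigma> k j))"
  proof (rule prod.cong[OF refl], goal_cases)
    case (1 j)
    then have "j < ?n" "j \<noteq> k" "\<sigma> j \<noteq> \<sigma> k" using neq by auto
    then show ?case
      by (cases "j < k"; cases "\<sigma> j < \<sigma> k") (simp_all add: nth disord_def sgb_def)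
  qed
  finally show ?L using K by (simp add: mult.commute)
qed


section \<open>The defining formulas on tensors and on products of homogeneous vectors\<close>

lemma sum_fun_apply: "(\<Sum>i\<in>A. F i) x = (\<Sum>i\<in>A. F i x :: 'c::comm_monoid_add)"
  by (induction A rule: infinite_finite_induct) auto

lemma tscale_apply: "tscale c t f = c * t f"
  by (simp add: tscale_def)

lemma hom_ext_apply: "hom_ext V \<phi> xs f = hom_ext V (\<lambda>es vs. \<phi> es vs f) xs"
  by (simp add: hom_ext_def sum_fun_apply)

lemma map2_update:
  assumes "length es = length xs" "i < length xs"
  shows "map2 h es (xs[i := v]) = (map2 h es xs)[i := h (es ! i) v]"
  using assms by (auto intro!: nth_equalityI simp: nth_list_update)

lemma permute_list_update:
  assumes s: "\<sigma> permutes {..<length xs}" and i: "i < length xs"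
  shows "permute_list \<sigma> (xs[i := v]) = (permute_list \<sigma> xs)[inv \<sigma> i := v]"
proof (rule nth_equalityI)
  fix j assume "j < length (permute_list \<sigma> (xs[i := v]))"
  then have j: "j < length xs" by simp
  have "\<sigma> j < length xs" using permutes_in_image[OF s, of j] j by simp
  moreover have "inv \<sigma> i < length xs" using permutes_in_image[OF permutes_inv[OF s], of i] i by simp
  moreover have "inv \<sigma> i = j \<longleftrightarrow> i = \<sigma> j" using permutes_inverses[OF s] by metis
  ultimately show "permute_list \<sigma> (xs[i := v]) ! j = (permute_list \<sigma> xs)[inv \<sigma> i := v] ! j"
    using j s by (auto simp: permute_list_nth nth_list_update)
qed simp

lemma omit_update_same: "omit k (xs[k := v]) = omit k xs"
  by (simp add: omit_def)

lemma omit_update: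
  assumes "i \<noteq> k" "i < length xs" "k < length xs"
  shows "omit k (xs[i := v]) = (omit k xs)[unskip k i := v]"
proof (rule nth_equalityI)
  fix j assume "j < length (omit k (xs[i := v]))"
  then have j: "j < length xs - 1" using assms by (simp add: length_omit)
  have "unskip k i = j \<longleftrightarrow> i = skip k j" using assms(1) by (auto simp: skip_def unskip_def)
  moreover have "unskip k i < length xs - 1" using assms by (auto simp: unskip_def)
  ultimately show "omit k (xs[i := v]) ! j = (omit k xs)[unskip k i := v] ! j"
    using j assms skip_lt[of k "length xs" j]
    by (auto simp: omit_nth nth_list_update length_omit)
qed (use assms in \<open>simp add: length_omit\<close>)

context graded_lcs
begin

abbreviation lin :: "('v \<Rightarrow> 'k) \<Rightarrow> bool" where
  "lin \<equiv> Vector_Spaces.linear scl (*)"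

lemma lin_iff: "lin f \<longleftrightarrow> (\<forall>x y. f (x + y) = f x + f y) \<and> (\<forall>c x. f (scl c x) = c * f x)"
proof -
  have "vector_space ((*) :: 'k \<Rightarrow> 'k \<Rightarrow> 'k)"
    by unfold_locales (auto simp: algebra_simps)
  then show ?thesis using vector_space_axioms by (simp add: Vector_Spaces.linear_iff)
qed

lemma lin_sum: "(\<And>j. j \<in> A \<Longrightarrow> lin (f j)) \<Longrightarrow> lin (\<lambda>v. \<Sum>j\<in>A. f j v)"
  by (simp add: lin_iff sum.distrib sum_distrib_left)

lemma lin_cmult: "lin f \<Longrightarrow> lin (\<lambda>v. c * f v)"
  by (simp add: lin_iff algebra_simps)

lemma hpart_eqI:
  assumes "u \<in> V e" "v - u \<in> V (\<not> e)" shows "hpart V e v = u"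
  unfolding hpart_def
proof (rule the_equality)
  fix u' assume u': "u' \<in> V e \<and> v - u' \<in> V (\<not> e)"
  have "u' - u \<in> V e" using u' assms subspace_diff[OF grading_subspace] by blast
  moreover have "(v - u) - (v - u') \<in> V (\<not> e)"
    using u' assms subspace_diff[OF grading_subspace] by blast
  then have "u' - u \<in> V (\<not> e)" by simp
  ultimately have "u' - u \<in> V False \<inter> V True" by (cases e) auto
  then show "u' = u" using grading_disjoint by simp
qed (use assms in blast)

lemma hpart_props: "hpart V e v \<in> V e" "v - hpart V e v \<in> V (\<not> e)"
proof -
  obtain a b where ab: "a \<in> V False" "b \<in> V True" "v = a + b" using grading_spans by blast
  have "hpart V e v = (if e then b else a)" by (rule hpart_eqI) (use ab in auto)
  then show "hpart V e v \<in> V e" "v - hpart V e v \<in> V (\<not> e)" using ab by auto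
qed

lemma hpart_same: "v \<in> V e \<Longrightarrow> hpart V e v = v"
  by (rule hpart_eqI) (auto simp: subspace_0[OF grading_subspace])

lemma hpart_other: "v \<in> V d \<Longrightarrow> e \<noteq> d \<Longrightarrow> hpart V e v = 0"
  by (rule hpart_eqI) (auto simp: subspace_0[OF grading_subspace])

lemma hpart_add: "hpart V e (x + y) = hpart V e x + hpart V e y"
proof (rule hpart_eqI)
  have "(x - hpart V e x) + (y - hpart V e y) \<in> V (\<not> e)"
    using hpart_props subspace_add[OF grading_subspace] by blast
  then show "x + y - (hpart V e x + hpart V e y) \<in> V (\<not> e)" by (simp add: algebra_simps)
qed (use hpart_props subspace_add[OF grading_subspace] in blast)

lemma hpart_scale: "hpart V e (scl c x) = scl c (hpart V e x)"
proof (rule hpart_eqI)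
  have "scl c (x - hpart V e x) \<in> V (\<not> e)"
    using hpart_props subspace_scale[OF grading_subspace] by blast
  then show "scl c x - scl c (hpart V e x) \<in> V (\<not> e)" by (simp add: scale_right_diff_distrib)
qed (use hpart_props subspace_scale[OF grading_subspace] in blast)

definition mlin :: "nat \<Rightarrow> ('v list \<Rightarrow> 'k) \<Rightarrow> bool" where
  "mlin n f \<longleftrightarrow> (\<forall>xs i. length xs = n \<longrightarrow> i < n \<longrightarrow> lin (\<lambda>v. f (xs[i := v])))"

lemma multilin_iff: "multilin scl f \<longleftrightarrow> (\<forall>n. mlin n f)"
  by (auto simp: multilin_def mlin_def)

lemma mlin_sum: "(\<And>j. j \<in> A \<Longrightarrow> mlin n (f j)) \<Longrightarrow> mlin n (\<lambda>v. \<Sum>j\<in>A. f j v)"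
  by (auto simp: mlin_def intro!: lin_sum)

lemma mlin_cmult: "mlin n f \<Longrightarrow> mlin n (\<lambda>v. c * f v)"
  by (auto simp: mlin_def intro!: lin_cmult)

lemma mlin_permute:
  assumes "mlin n f" "\<sigma> permutes {..<n}" shows "mlin n (\<lambda>xs. f (permute_list \<sigma> xs))"
  unfolding mlin_def
proof (intro allI impI)
  fix xs :: "'v list" and i assume xs: "length xs = n" "i < n"
  have "inv \<sigma> i < n" using permutes_in_image[OF permutes_inv[OF assms(2)], of i] xs by simp
  then have "lin (\<lambda>v. f ((permute_list \<sigma> xs)[inv \<sigma> i := v]))"
    using assms(1) xs by (simp add: mlin_def)
  then show "lin (\<lambda>v. f (permute_list \<sigma> (xs[i := v])))"
    using assms(2) xs by (simp add: permute_list_update)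
qed

lemma mlin_hpart:
  assumes "mlin n f" "length es = n" shows "mlin n (\<lambda>xs. f (map2 (hpart V) es xs))"
  unfolding mlin_def
proof (intro allI impI)
  fix xs :: "'v list" and i assume xs: "length xs = n" "i < n"
  have "lin (\<lambda>v. f ((map2 (hpart V) es xs)[i := v]))"
    using assms xs by (simp add: mlin_def)
  then have "lin (\<lambda>v. f ((map2 (hpart V) es xs)[i := hpart V (es ! i) v]))"
    by (simp add: lin_iff hpart_add hpart_scale)
  then show "lin (\<lambda>v. f (map2 (hpart V) es (xs[i := v])))"
    using assms(2) xs by (simp add: map2_update)
qed

lemma mlin_cong: "(\<And>xs. length xs = n \<Longrightarrow> f xs = g xs) \<Longrightarrow> mlin n f \<longleftrightarrow> mlin n g"
  by (simp add: mlin_def)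

lemma mlin_hom_ext:
  assumes "\<And>es. length es = n \<Longrightarrow> mlin n (\<phi> es)" shows "mlin n (hom_ext V \<phi>)"
proof -
  have "mlin n (\<lambda>xs. \<Sum>es | length es = n. \<phi> es (map2 (hpart V) es xs))"
    by (rule mlin_sum) (use assms mlin_hpart in auto)
  then show ?thesis by (subst mlin_cong) (auto simp: hom_ext_def)
qed

lemma mlin_omit:
  assumes f: "mlin (n - 1) f" and k: "k < n" and L: "lin L"
  shows "mlin n (\<lambda>xs. L (xs ! k) * f (omit k xs))"
  unfolding mlin_def
proof (intro allI impI)
  fix xs :: "'v list" and i assume xs: "length xs = n" "i < n"
  show "lin (\<lambda>v. L (xs[i := v] ! k) * f (omit k (xs[i := v])))"
  proof (cases "i = k")
    case True
    then show ?thesis using L xs k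
      by (simp add: omit_update_same mult.commute[of _ "f (omit k xs)"] lin_cmult)
  next
    case False
    moreover have "unskip k i < n - 1" using False xs k by (auto simp: unskip_def)
    then have "lin (\<lambda>v. f ((omit k xs)[unskip k i := v]))"
      using f xs k by (simp add: mlin_def length_omit)
    ultimately show ?thesis using xs k by (simp add: omit_update lin_cmult)
  qed
qed

abbreviation homs :: "bool list \<Rightarrow> 'v list \<Rightarrow> bool" where
  "homs es vs \<equiv> list_all2 (\<lambda>e v. v \<in> V e) es vs"

lemma mlin_zero:
  assumes "mlin n f" "length xs = n" "i < n" "xs ! i = 0" shows "f xs = 0"
proof -
  have "lin (\<lambda>v. f (xs[i := v]))" using assms by (simp add: mlin_def)
  then have "f (xs[i := scl 0 0]) = 0 * f (xs[i := 0])" unfolding lin_iff by blast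
  then show ?thesis using assms(4) by (metis list_update_id mult_zero_left scale_zero_left)
qed

lemma hom_ext_homs:
  assumes h: "homs es vs" and m: "\<And>ds. length ds = length vs \<Longrightarrow> mlin (length vs) (\<phi> ds)"
  shows "hom_ext V \<phi> vs = \<phi> es vs"
proof -
  have len: "length es = length vs" using h by (rule list_all2_lengthD)
  have nth: "vs ! i \<in> V (es ! i)" if "i < length vs" for i
    using h that len by (simp add: list_all2_conv_all_nth)
  have fin: "finite {ds :: bool list. length ds = length vs}"
    using finite_lists_length_eq[of "UNIV :: bool set" "length vs"] by simp
  have "\<phi> ds (map2 (hpart V) ds vs) = 0" if ds: "length ds = length vs" "ds \<noteq> es" for ds
  proof -
    obtain i where i: "i < length vs" "ds ! i \<noteq> es ! i"
      using ds len nth_equalityI[of ds es] by auto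
    show ?thesis
      by (rule mlin_zero[OF m[OF ds(1)], of _ i]) (use i ds nth hpart_other in auto)
  qed
  moreover have "map2 (hpart V) es vs = vs"
    using len nth by (auto intro!: nth_equalityI simp: hpart_same)
  ultimately have "hom_ext V \<phi> vs = (\<Sum>ds\<in>{es}. \<phi> ds (map2 (hpart V) ds vs))"
    unfolding hom_ext_def by (intro sum.mono_neutral_right) (use fin len in auto)
  then show ?thesis using \<open>map2 (hpart V) es vs = vs\<close> by simp
qed

definition sym_eval :: "bool list \<Rightarrow> 'v list \<Rightarrow> ('v list \<Rightarrow> 'k) \<Rightarrow> 'k" where
  "sym_eval es vs f = 1 / fact (length vs) *
     (\<Sum>\<sigma> | \<sigma> permutes {..<length vs}. koszul es \<sigma> * f (permute_list \<sigma> vs))"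

lemma mlin_sym_eval: "mlin n f \<Longrightarrow> mlin n (\<lambda>vs. sym_eval es vs f)"
proof -
  assume f: "mlin n f"
  have "mlin n (\<lambda>vs. 1 / fact n * (\<Sum>\<sigma> | \<sigma> permutes {..<n}. koszul es \<sigma> * f (permute_list \<sigma> vs)))"
    by (intro mlin_cmult mlin_sum mlin_permute f) simp
  then show ?thesis by (subst mlin_cong) (auto simp: sym_eval_def)
qed

lemma multilin_hom_ext_sym_eval:
  "multilin scl f \<Longrightarrow> multilin scl (hom_ext V (\<lambda>es vs. sym_eval es vs f))"
  by (simp add: multilin_iff mlin_hom_ext mlin_sym_eval)

lemma multilin_0: "multilin scl (\<lambda>_. 0)"
  by (simp add: multilin_def lin_iff)

lemma symmetrize_tens:
  "sym_prod scl V vs f = (if multilin scl f then hom_ext V (\<lambda>es vs. sym_eval es vs f) vs else 0)"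
proof -
  have *: "hom_ext V (\<lambda>es vs. tscale (1 / fact (length vs))
       (\<Sum>\<sigma> | \<sigma> permutes {..<length vs}. tscale (koszul es \<sigma>) (tens scl (permute_list \<sigma> vs)))) xs f
     = (if multilin scl f then hom_ext V (\<lambda>es vs. sym_eval es vs f) xs else 0)" for xs
    by (simp add: hom_ext_apply tscale_apply sum_fun_apply tens_def sym_eval_def) (simp add: hom_ext_def)
  show ?thesis
    unfolding sym_prod_def symmetrize_def tlift_def *
    by (simp add: tens_def multilin_0 multilin_hom_ext_sym_eval)
qed

lemma sym_prod_homs:
  assumes "homs es vs" "multilin scl f" shows "sym_prod scl V vs f = sym_eval es vs f"
  using assms(2) hom_ext_homs[OF assms(1), of "\<lambda>es vs. sym_eval es vs f"]
  by (simp add: symmetrize_tens mlin_sym_eval multilin_iff)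

lemma mlin_sym_prod: "mlin n (\<lambda>vs. sym_prod scl V vs f)"
proof (cases "multilin scl f")
  case True
  then have "multilin scl (\<lambda>vs. hom_ext V (\<lambda>es vs. sym_eval es vs f) vs)"
    using multilin_hom_ext_sym_eval by simp
  then show ?thesis using True by (simp add: symmetrize_tens multilin_iff)
next
  case False
  then show ?thesis using multilin_0 by (simp add: symmetrize_tens) (simp add: multilin_iff)
qed

lemma homs_permute:
  assumes "homs es vs" "\<sigma> permutes {..<length vs}"
  shows "homs (permute_list \<sigma> es) (permute_list \<sigma> vs)"
  using assms list_all2_permute_list_iff[of \<sigma> vs] list_all2_lengthD[OF assms(1)] 
  by (auto simp: list_all2_conv_all_nth permute_list_nth) (metis lessThan_iff permutes_in_image)

lemma homs_omit:
  assumes "homs es vs" "k < length vs"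
  shows "homs (omit k es) (omit k vs)"
  using assms skip_lt[of k "length vs"]
  by (auto simp: list_all2_conv_all_nth length_omit omit_nth)

lemma sym_eval_permute:
  assumes t: "\<tau> permutes {..<length vs}" and l: "length es = length vs"
  shows "sym_eval (permute_list \<tau> es) (permute_list \<tau> vs) f = koszul es \<tau> * sym_eval es vs f"
proof -
  let ?n = "length vs"
  let ?P = "{\<sigma>. \<sigma> permutes {..<?n}}"
  have "koszul es \<tau> * (\<Sum>\<sigma>\<in>?P. koszul es \<sigma> * f (permute_list \<sigma> vs)) =
        koszul es \<tau> * (\<Sum>\<sigma>\<in>?P. koszul es (\<tau> \<circ> \<sigma>) * f (permute_list (\<tau> \<circ> \<sigma>) vs))"
    by (subst setum_permutations_compose_left[OF t]) simp
  also have "\<dots> = (\<Sum>\<sigma>\<in>?P. koszul es \<tau> * koszul es \<tau> *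
       (koszul (permute_list \<tau> es) \<sigma> * f (permute_list \<sigma> (permute_list \<tau> vs))))"
    unfolding sum_distrib_left
  proof (rule sum.cong[OF refl], clarify)
    fix \<sigma> assume s: "\<sigma> permutes {..<?n}"
    show "koszul es \<tau> * (koszul es (\<tau> \<circ> \<sigma>) * f (permute_list (\<tau> \<circ> \<sigma>) vs)) =
       koszul es \<tau> * koszul es \<tau> *
       (koszul (permute_list \<tau> es) \<sigma> * f (permute_list \<sigma> (permute_list \<tau> vs)))"
      using koszul_compose[OF t s l, where 'k='k] permute_list_compose[OF s, of \<tau>] by simp
  qed
  also have "\<dots> = (\<Sum>\<sigma>\<in>?P. koszul (permute_list \<tau> es) \<sigma> * f (permute_list \<sigma> (permute_list \<tau> vs)))"
    by (simp add: koszul_sq)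
  finally show ?thesis by (simp add: sym_eval_def mult.left_commute)
qed

lemma sym_prod_permute:
  assumes "homs es vs" "\<tau> permutes {..<length vs}"
  shows "sym_prod scl V (permute_list \<tau> vs) f = koszul es \<tau> * sym_prod scl V vs f"
proof (cases "multilin scl f")
  case True
  then show ?thesis
    using sym_prod_homs[OF homs_permute[OF assms] True] sym_prod_homs[OF assms(1) True]
      sym_eval_permute[OF assms(2) list_all2_lengthD[OF assms(1)]] by simp
qed (simp add: symmetrize_tens)

lemma tcomp_tens: "tcomp scl n (tens scl xs) = (if length xs = n then tens scl xs else 0)"
proof
  fix f
  have "multilin scl (\<lambda>xs. if length xs = n then f xs else 0)" if "multilin scl f"
    unfolding multilin_def
  proof (intro allI impI)
    fix us :: "'v list" and i assume "i < length us"
    then show "lin (\<lambda>v. if length (us[i := v]) = n then f (us[i := v]) else 0)"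
      using that by (cases "length us = n") (simp_all add: multilin_def, simp add: lin_iff)
  qed
  then have "multilin scl (\<lambda>us. (if length us = n then tens scl us else 0) f)"
    using multilin_0 by (cases "multilin scl f") (simp_all add: if_distribR tens_def cong: if_cong)
  then show "tcomp scl n (tens scl xs) f = (if length xs = n then tens scl xs else 0) f"
    by (simp add: tcomp_def tlift_def tens_def[of scl xs])
qed

lemma tens_eval: "multilin scl f \<Longrightarrow> tens scl xs f = f xs"
  by (simp add: tens_def)

lemma sym_mult_tens:
  "sym_mult scl V (tprod scl (tens scl xs) (tens scl ys)) = symmetrize scl V (tens scl (xs @ ys))"
proof
  fix f
  have m: "lin (\<lambda>v. sym_prod scl V (zs[i := v]) f)" if "i < length zs" for zs i
    using mlin_sym_prod[of "length zs" f] that by (simp add: mlin_def)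
  have l: "multilin scl (\<lambda>us. sym_prod scl V (us @ ws) f)" for ws
    unfolding multilin_def
  proof (intro allI impI)
    fix us :: "'v list" and i assume "i < length us"
    then show "lin (\<lambda>v. sym_prod scl V (us[i := v] @ ws) f)"
      using m[of i "us @ ws"] by (simp add: list_update_append)
  qed
  have r: "multilin scl (\<lambda>ws. sym_prod scl V (us @ ws) f)" for us
    unfolding multilin_def
  proof (intro allI impI)
    fix ws :: "'v list" and i assume "i < length ws"
    then show "lin (\<lambda>v. sym_prod scl V (us @ ws[i := v]) f)"
      using m[of "length us + i" "us @ ws"] by (simp add: list_update_append)
  qed
  show "sym_mult scl V (tprod scl (tens scl xs) (tens scl ys)) f = symmetrize scl V (tens scl (xs @ ys)) f"
    using l r unfolding sym_mult_def tlift2_def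
    by (simp add: tprod_def multilin2_def sym_prod_def[symmetric] tens_eval)
qed

lemma multilin_sym_prod_param:
  assumes g: "multilin2 scl g"
  shows "multilin scl (\<lambda>xs. sym_prod scl V us (g xs))"
proof -
  have "multilin scl (\<lambda>xs. g xs ys)" for ys using g by (simp add: multilin2_def)
  then have "mlin n (\<lambda>xs. g xs ys)" for n ys by (simp add: multilin_iff)
  then have "mlin n (\<lambda>xs. hom_ext V (\<lambda>es vs. sym_eval es vs (g xs)) us)" for n
    unfolding hom_ext_def sym_eval_def by (intro mlin_sum mlin_cmult)
  then show ?thesis using g by (simp add: symmetrize_tens multilin2_def) (simp add: multilin_iff)
qed

lemma tprod_sym_prod:
  "tprod scl (sym_prod scl V us) (sym_prod scl V us') g =
     (if multilin2 scl g then sym_prod scl V us (\<lambda>xs. sym_prod scl V us' (g xs)) else 0)"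
  by (simp add: tprod_def)

lemma mlin_tprod_left: "mlin n (\<lambda>us. tprod scl (sym_prod scl V us) t g)"
proof (cases "multilin2 scl g")
  case False
  then show ?thesis using multilin_0 by (simp add: tprod_def multilin_iff)
qed (simp add: tprod_def mlin_sym_prod)

lemma mlin_tprod_right:
  "mlin n (\<lambda>us'. tprod scl (sym_prod scl V us) (sym_prod scl V us') g)"
proof (cases "multilin2 scl g")
  case True
  have "mlin n (\<lambda>us'. hom_ext V (\<lambda>es vs. sym_eval es vs (\<lambda>xs. sym_prod scl V us' (g xs))) us)"
    unfolding hom_ext_def sym_eval_def by (intro mlin_sum mlin_cmult mlin_sym_prod)
  then show ?thesis using True
    by (simp add: tprod_sym_prod symmetrize_tens[of us] multilin_sym_prod_param)
next
  case False
  then show ?thesis using multilin_0 by (simp add: tprod_def multilin_iff)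
qed

lemma contraction_apply:
  assumes "length es = length vs" "length ds = length ws"
  shows "contraction scl V \<Lambda> es vs ds ws g =
     (\<Sum>k<length vs. \<Sum>l<length ws. rsign es k * lsign ds l * (\<Lambda> (vs ! k) (ws ! l) *
        tprod scl (sym_prod scl V (omit k vs)) (sym_prod scl V (omit l ws)) g))"
  unfolding contraction_def sum_fun_apply tscale_apply power_add
proof (intro sum.cong refl, goal_cases)
  case (1 k l)
  then show ?case
    using rsign_eq[of k es, where 'k='k] lsign_eq[of l ds, where 'k='k] assms
    by (simp add: mult.assoc)
qed

context
  fixes \<Lambda> :: "'v \<Rightarrow> 'v \<Rightarrow> 'k"
  assumes \<Lambda>: "continuous_bilinear_form scl \<Lambda>"
begin

lemma lin_\<Lambda>: "lin (\<Lambda> v)" "lin (\<lambda>v. \<Lambda> v w)"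
  using \<Lambda> by (auto simp: continuous_bilinear_form_def)

lemma mlin_contraction_left:
  assumes "length es = n" "length ds = length ws"
  shows "mlin n (\<lambda>vs. contraction scl V \<Lambda> es vs ds ws g)"
proof -
  have "mlin n (\<lambda>vs. \<Sum>k<n. \<Sum>l<length ws. rsign es k * lsign ds l * (\<Lambda> (vs ! k) (ws ! l) *
        tprod scl (sym_prod scl V (omit k vs)) (sym_prod scl V (omit l ws)) g))"
  proof (intro mlin_sum mlin_cmult, goal_cases)
    case (1 k l)
    then show ?case using mlin_omit[OF mlin_tprod_left _ lin_\<Lambda>(2), of k n] by simp
  qed
  then show ?thesis using assms by (subst mlin_cong) (auto simp: contraction_apply)
qed

lemma mlin_contraction_right:
  assumes "length es = length vs" "length ds = m"
  shows "mlin m (\<lambda>ws. contraction scl V \<Lambda> es vs ds ws g)"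
proof -
  have "mlin m (\<lambda>ws. \<Sum>k<length vs. \<Sum>l<m. rsign es k * lsign ds l * (\<Lambda> (vs ! k) (ws ! l) *
        tprod scl (sym_prod scl V (omit k vs)) (sym_prod scl V (omit l ws)) g))"
  proof (intro mlin_sum mlin_cmult, goal_cases)
    case (1 k l)
    then show ?case using mlin_omit[OF mlin_tprod_right _ lin_\<Lambda>(1), of l m] by simp
  qed
  then show ?thesis using assms by (subst mlin_cong) (auto simp: contraction_apply)
qed

lemma rsign_sq: "rsign es k * rsign es k = (1 :: 'k)"
  unfolding rsign_def by (simp flip: prod.distrib)

lemma lsign_sq: "lsign es k * lsign es k = (1 :: 'k)"
  unfolding lsign_def by (simp flip: prod.distrib)

lemma tprod_scale_left:
  "(\<And>f. s f = c * s' f) \<Longrightarrow> tprod scl s t g = c * tprod scl s' t g"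
  by (simp add: tprod_def)

lemma tprod_sym_scale_right:
  assumes "\<And>f. t f = c * t' f"
  shows "tprod scl (sym_prod scl V us) t g = c * tprod scl (sym_prod scl V us) t' g"
proof -
  have impl: "multilin scl (\<lambda>xs. t' (g xs)) \<Longrightarrow> multilin scl (\<lambda>xs. c * t' (g xs))"
    using mlin_cmult by (simp add: multilin_iff)
  show ?thesis
  proof (cases "c = 0")
    case True
    have "sym_prod scl V us (\<lambda>_. 0) = 0"
      using multilin_0 by (simp add: symmetrize_tens sym_eval_def hom_ext_def)
    then show ?thesis using assms True by (simp add: tprod_def)
  next
    case False
    have "multilin scl (\<lambda>xs. t' (g xs))" if m: "multilin scl (\<lambda>xs. c * t' (g xs))"
    proof -
      have "multilin scl (\<lambda>xs. inverse c * (c * t' (g xs)))"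
        using m mlin_cmult by (simp add: multilin_iff)
      then show ?thesis using False by (simp add: mult.assoc[symmetric])
    qed
    then have "multilin scl (\<lambda>xs. c * t' (g xs)) \<longleftrightarrow> multilin scl (\<lambda>xs. t' (g xs))"
      using impl by blast
    then show ?thesis
      by (simp add: tprod_def assms symmetrize_tens hom_ext_def sym_eval_def sum_distrib_left algebra_simps)
  qed
qed

lemma contraction_permute_left:
  assumes h: "homs es vs" and s: "\<sigma> permutes {..<length vs}" and d: "length ds = length ws"
  shows "contraction scl V \<Lambda> (permute_list \<sigma> es) (permute_list \<sigma> vs) ds ws g =
         koszul es \<sigma> * contraction scl V \<Lambda> es vs ds ws g"
proof -
  let ?n = "length vs"
  have len: "length es = ?n" using h by (rule list_all2_lengthD)
  let ?T = "\<lambda>k l. tprod scl (sym_prod scl V (omit k vs)) (sym_prod scl V (omit l ws)) g"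
  let ?G = "\<lambda>k. koszul es \<sigma> * (\<Sum>l<length ws. rsign es k * lsign ds l * (\<Lambda> (vs ! k) (ws ! l) * ?T k l))"
  have "contraction scl V \<Lambda> (permute_list \<sigma> es) (permute_list \<sigma> vs) ds ws g =
    (\<Sum>k<?n. \<Sum>l<length ws. rsign (permute_list \<sigma> es) k * lsign ds l * (\<Lambda> (permute_list \<sigma> vs ! k) (ws ! l) *
        tprod scl (sym_prod scl V (omit k (permute_list \<sigma> vs))) (sym_prod scl V (omit l ws)) g))"
    using len d by (simp add: contraction_apply)
  also have "\<dots> = (\<Sum>k<?n. ?G (\<sigma> k))"
    unfolding sum_distrib_left
  proof (intro sum.cong refl, goal_cases)
    case (1 k l)
    then have k: "k < ?n" by simp
    let ?p = "omit_perm ?n k \<sigma>"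
    have sk: "\<sigma> k < ?n" using permutes_in_image[OF s, of k] k by simp
    have "sym_prod scl V (omit k (permute_list \<sigma> vs)) f =
        koszul (omit (\<sigma> k) es) ?p * sym_prod scl V (omit (\<sigma> k) vs) f" for f
      using sym_prod_permute[OF homs_omit[OF h sk], of ?p f] omit_perm(1)[OF s k] sk
      by (simp add: omit_permute_list[OF s k] length_omit)
    then have "tprod scl (sym_prod scl V (omit k (permute_list \<sigma> vs))) (sym_prod scl V (omit l ws)) g =
        koszul (omit (\<sigma> k) es) ?p * ?T (\<sigma> k) l"
      by (rule tprod_scale_left)
    moreover have "koszul es \<sigma> * rsign es (\<sigma> k) =
        rsign (permute_list \<sigma> es) k * (koszul (omit (\<sigma> k) es) ?p :: 'k)"
      using koszul_omit(1)[of \<sigma> es k, where 'k='k] s k len rsign_sq[of es "\<sigma> k"]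
      by (simp add: mult.assoc mult.left_commute[of "rsign es (\<sigma> k)"])
    ultimately show ?case using k s
      by (simp add: permute_list_nth mult.assoc mult.left_commute mult.commute)
  qed
  also have "\<dots> = (\<Sum>k<?n. ?G k)"
    by (rule sum.permute[OF s, symmetric, unfolded o_def])
  also have "\<dots> = koszul es \<sigma> * contraction scl V \<Lambda> es vs ds ws g"
    using len d by (simp add: contraction_apply sum_distrib_left)
  finally show ?thesis .
qed

lemma contraction_permute_right:
  assumes h: "homs ds ws" and s: "\<tau> permutes {..<length ws}" and d: "length es = length vs"
  shows "contraction scl V \<Lambda> es vs (permute_list \<tau> ds) (permute_list \<tau> ws) g =
         koszul ds \<tau> * contraction scl V \<Lambda> es vs ds ws g"
proof -
  let ?n = "length ws"
  have len: "length ds = ?n" using h by (rule list_all2_lengthD)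
  let ?T = "\<lambda>k l. tprod scl (sym_prod scl V (omit k vs)) (sym_prod scl V (omit l ws)) g"
  let ?G = "\<lambda>k l. koszul ds \<tau> * (rsign es k * lsign ds l * (\<Lambda> (vs ! k) (ws ! l) * ?T k l))"
  have "contraction scl V \<Lambda> es vs (permute_list \<tau> ds) (permute_list \<tau> ws) g =
    (\<Sum>k<length vs. \<Sum>l<?n. rsign es k * lsign (permute_list \<tau> ds) l * (\<Lambda> (vs ! k) (permute_list \<tau> ws ! l) *
        tprod scl (sym_prod scl V (omit k vs)) (sym_prod scl V (omit l (permute_list \<tau> ws))) g))"
    using len d by (simp add: contraction_apply)
  also have "\<dots> = (\<Sum>k<length vs. \<Sum>l<?n. ?G k (\<tau> l))"
  proof (intro sum.cong refl, goal_cases)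
    case (1 k l)
    then have l: "l < ?n" by simp
    let ?p = "omit_perm ?n l \<tau>"
    have sl: "\<tau> l < ?n" using permutes_in_image[OF s, of l] l by simp
    have "sym_prod scl V (omit l (permute_list \<tau> ws)) f =
        koszul (omit (\<tau> l) ds) ?p * sym_prod scl V (omit (\<tau> l) ws) f" for f
      using sym_prod_permute[OF homs_omit[OF h sl], of ?p f] omit_perm(1)[OF s l] sl
      by (simp add: omit_permute_list[OF s l] length_omit)
    then have "tprod scl (sym_prod scl V (omit k vs)) (sym_prod scl V (omit l (permute_list \<tau> ws))) g =
        koszul (omit (\<tau> l) ds) ?p * ?T k (\<tau> l)"
      by (rule tprod_sym_scale_right)
    moreover have "koszul ds \<tau> * lsign ds (\<tau> l) =
        lsign (permute_list \<tau> ds) l * (koszul (omit (\<tau> l) ds) ?p :: 'k)"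
      using koszul_omit(2)[of \<tau> ds l, where 'k='k] s l len lsign_sq[of ds "\<tau> l"]
      by (simp add: mult.assoc mult.left_commute[of "lsign ds (\<tau> l)"])
    ultimately show ?case using l s
      by (simp add: permute_list_nth mult.assoc mult.left_commute mult.commute)
  qed
  also have "\<dots> = (\<Sum>k<length vs. \<Sum>l<?n. ?G k l)"
    by (intro sum.cong refl sum.permute[OF s, symmetric, unfolded o_def])
  also have "\<dots> = koszul ds \<tau> * contraction scl V \<Lambda> es vs ds ws g"
    using len d by (simp add: contraction_apply sum_distrib_left)
  finally show ?thesis .
qed

definition P_form :: "('v list \<Rightarrow> 'v list \<Rightarrow> 'k) \<Rightarrow> 'v list \<Rightarrow> 'v list \<Rightarrow> 'k" where
  "P_form g xs ys = hom_ext V (\<lambda>es vs. hom_ext V (\<lambda>ds ws. contraction scl V \<Lambda> es vs ds ws g) ys) xs"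

lemma mlin_P_form_inner: 
  "length es = n \<Longrightarrow> mlin n (\<lambda>vs. hom_ext V (\<lambda>ds ws. contraction scl V \<Lambda> es vs ds ws g) ys)"
  unfolding hom_ext_def by (intro mlin_sum mlin_contraction_left) auto

lemma multilin2_P_form: "multilin2 scl (P_form g)"
proof -
  have "mlin n (\<lambda>xs. P_form g xs ys)" for n ys
    unfolding P_form_def by (rule mlin_hom_ext[unfolded eta_contract_eq]) (rule mlin_P_form_inner)
  moreover have "mlin n (\<lambda>ys. P_form g xs ys)" for n xs
    unfolding P_form_def hom_ext_def[of V _ xs]
    by (intro mlin_sum mlin_hom_ext mlin_contraction_right) auto
  ultimately show ?thesis by (simp add: multilin2_def multilin_iff)
qed

lemma P_form_homs:
  assumes "homs es vs" "homs ds ws"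
  shows "P_form g vs ws = contraction scl V \<Lambda> es vs ds ws g"
proof -
  have "P_form g vs ws = hom_ext V (\<lambda>ds ws. contraction scl V \<Lambda> es vs ds ws g) ws"
    unfolding P_form_def by (rule hom_ext_homs[OF assms(1)]) (rule mlin_P_form_inner)
  also have "\<dots> = contraction scl V \<Lambda> es vs ds ws g"
    by (rule hom_ext_homs[OF assms(2)])
      (rule mlin_contraction_right[OF list_all2_lengthD[OF assms(1)]])
  finally show ?thesis .
qed

lemma sq_cancel:
  assumes "a * a = 1" "b * b = 1" shows "a * (b * (a * (b * c))) = (c :: 'k)"
proof -
  have "a * (b * (a * (b * c))) = (a * a) * (b * b) * c" by (simp only: ac_simps)
  then show ?thesis using assms by simp
qed

text \<open>The defining formula of \<open>P\<^sub>\<Lambda>\<close> on products of homogeneous vectors.\<close>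

theorem P_op_sym_prod:
  assumes hv: "list_all2 (\<lambda>e v. v \<in> V e) es vs" and hw: "list_all2 (\<lambda>d w. w \<in> V d) ds ws"
  shows "P_op scl V \<Lambda> (tprod scl (sym_prod scl V vs) (sym_prod scl V ws)) =
         contraction scl V \<Lambda> es vs ds ws"
proof
  fix g
  let ?C = "contraction scl V \<Lambda> es vs ds ws g"
  have lv: "length es = length vs" and lw: "length ds = length ws"
    using hv hw by (auto dest: list_all2_lengthD)
  have m: "multilin scl (P_form g xs)" for xs
    using multilin2_P_form by (simp add: multilin2_def)
  have "P_op scl V \<Lambda> (tprod scl (sym_prod scl V vs) (sym_prod scl V ws)) g =
        tprod scl (sym_prod scl V vs) (sym_prod scl V ws) (P_form g)"
    by (simp add: P_op_def tlift2_def hom_ext_apply P_form_def[abs_def])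
  also have "\<dots> = sym_eval es vs (\<lambda>xs. sym_eval ds ws (P_form g xs))"
    using sym_prod_homs[OF hv multilin_sym_prod_param[OF multilin2_P_form, of ws g]]
    by (simp add: tprod_sym_prod multilin2_P_form sym_prod_homs[OF hw m])
  also have "\<dots> = 1 / fact (length vs) * (\<Sum>\<sigma> | \<sigma> permutes {..<length vs}.
       1 / fact (length ws) * (\<Sum>\<tau> | \<tau> permutes {..<length ws}. ?C))"
    unfolding sym_eval_def
  proof (rule arg_cong[where f = "(*) _"], rule sum.cong[OF refl], clarify)
    fix \<sigma> assume s: "\<sigma> permutes {..<length vs}"
    let ?S = "\<Sum>\<tau> | \<tau> permutes {..<length ws}.
       koszul ds \<tau> * P_form g (permute_list \<sigma> vs) (permute_list \<tau> ws)"
    have "koszul es \<sigma> * ?S = (\<Sum>\<tau> | \<tau> permutes {..<length ws}. ?C)"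
      unfolding sum_distrib_left
    proof (rule sum.cong[OF refl], clarify)
      fix \<tau> assume t: "\<tau> permutes {..<length ws}"
      have "P_form g (permute_list \<sigma> vs) (permute_list \<tau> ws) =
          koszul es \<sigma> * (koszul ds \<tau> * ?C)"
        using P_form_homs[OF homs_permute[OF hv s] homs_permute[OF hw t]]
          contraction_permute_left[OF hv s] contraction_permute_right[OF hw t] lv lw by simp
      then show "koszul es \<sigma> * (koszul ds \<tau> *
           P_form g (permute_list \<sigma> vs) (permute_list \<tau> ws)) = ?C"
        using koszul_sq[of es \<sigma>, where 'k='k] koszul_sq[of ds \<tau>, where 'k='k]
        by (simp add: sq_cancel)
    qed
    then show "koszul es \<sigma> * (1 / fact (length ws) * ?S) =
        1 / fact (length ws) * (\<Sum>\<tau> | \<tau> permutes {..<length ws}. ?C)"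
      by (simp only: mult.left_commute[of "koszul es \<sigma>"])
  qed
  also have "\<dots> = ?C"
    by (simp add: card_permutations)
  finally show "P_op scl V \<Lambda> (tprod scl (sym_prod scl V vs) (sym_prod scl V ws)) g = ?C" .
qed

end

end

end

theory Submission
  imports Defs
begin

text \<open>
  On factors of degrees \<open>n\<close> and \<open>m\<close>, the \<open>k\<close>-fold contraction has
  \<open>n!/(n-k)! \<cdot> m!/(m-k)!\<close> terms of degree \<open>n + m - 2k\<close>. For a seminorm \<open>p\<close> that is additive along the
  grading and satisfies \<open>|\<Lambda>(v, w)| \<le> p(v) p(w)\<close>, each of them is bounded by the product of the
  projective seminorms. If \<open>r \<ge> 1/2\<close> and \<open>\<zeta> \<ge> 1\<close>, the factorials combine to
  \<open>\<zeta>\<^sup>k/k! \<cdot> n!/(n-k)! \<cdot> m!/(m-k)! \<cdot> (n+m-2k)!\<^sup>r \<le> K\<^sup>n n!\<^sup>r \<cdot> K\<^sup>m m!\<^sup>r\<close> with \<open>K\<close> depending only on \<open>\<zeta>\<close> and \<open>r\<close>,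
  and \<open>K\<close> is absorbed by passing from \<open>p\<close> to \<open>K p\<close>. Choosing \<open>\<zeta> > |z|\<close> makes the terms of the
  exponential series decay geometrically, uniformly on the symmetric algebra, and the estimates pass
  to the completion by density.
\<close>

section \<open>Seminorms and limits\<close>

text \<open>The threshold 1/2 is dictated by \<open>1/k!\<close>. Beyond what \<open>n!^r\<close>
  and \<open>m!^r\<close> absorb, each of the two falling factorials leaves at most
  \<open>k!^(1-r)\<close> up to exponential factors, and \<open>1/k!\<close> pays for both when
  \<open>1 - r \<le> 1/2\<close>. The projective limit topology also has exponents below 1/2; they
  are dominated by larger ones that still lie below \<open>R\<close>.

  Signs are given on homogeneous vectors only, and a word of length \<open>n\<close> splits into
  \<open>2^n\<close> homogeneous words. For a seminorm additive along the grading their costs add up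
  to the cost of the word, so the splitting loses nothing.

  Continuity of each coefficient separately says nothing about the sum. The estimate therefore keeps
  the weight \<open>\<zeta>^k/k!\<close> and a single seminorm for all \<open>k\<close>, which is
  what a limit over approximating elements preserves. The completion is known only through
  \<open>\<iota>\<close>, and bilinear maps are not uniformly continuous, so they are extended by
  hand along traces of neighbourhood filters, where all the seminorms converge.\<close>

lemma convergent_if_differences_vanish:
  fixes f :: "'a \<Rightarrow> 'b::{uniform_topological_group_add,topological_ab_group_add,complete_uniform_space}"
  assumes lim: "((\<lambda>p. f (fst p) - f (snd p)) \<longlongrightarrow> 0) (F \<times>\<^sub>F F)"
  shows "\<exists>l. (f \<longlongrightarrow> l) F"
proof -
  \<comment> \<open>Completeness speaks of Cauchy filters in the uniformity, so a small difference
    \<open>d\<close> is first turned into the close pair \<open>(0, d)\<close>.\<close>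
  have "filterlim (\<lambda>d. (0::'b, d)) uniformity (nhds 0)"
    unfolding filterlim_iff
  proof (intro allI impI)
    fix P :: "'b \<times> 'b \<Rightarrow> bool" assume P: "eventually P uniformity"
    show "\<forall>\<^sub>F d in nhds 0. P (0, d)"
      unfolding eventually_nhds_uniformity using P by (rule eventually_mono) auto
  qed
  then have d: "filterlim (\<lambda>p. (0, f (fst p) - f (snd p))) uniformity (F \<times>\<^sub>F F)"
    using lim by (rule filterlim_compose)
  have "filterlim (\<lambda>p. (f (snd p), f (snd p))) uniformity (F \<times>\<^sub>F F)"
    unfolding filterlim_iff by (intro allI impI always_eventually) (rule uniformity_refl)
  \<comment> \<open>Uniform continuity of addition allows \<open>(0, f x - f y)\<close> to be
    translated by the diagonal pair \<open>(f y, f y)\<close>, which gives the close pair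
    \<open>(f y, f x)\<close>.\<close>
  from filterlim_compose[OF uniformly_continuous_add' filterlim_Pair[OF d this]]
  have "filterlim (\<lambda>p. (f (snd p), f (fst p))) uniformity (F \<times>\<^sub>F F)" by simp
  from filterlim_compose[OF this filterlim_Pair[OF filterlim_snd filterlim_fst]]
  have "filterlim (map_prod f f) uniformity (F \<times>\<^sub>F F)"
    by (simp add: map_prod_def case_prod_unfold)
  then have "cauchy_filter (filtermap f F)"
    by (simp add: cauchy_filter_def filterlim_def filtermap_prod_filter)
  then have "convergent_filter (filtermap f F)"
    by (rule cauchy_filter_convergent)
  then show ?thesis by (simp add: convergent_filter_iff filterlim_def)
qed

lemma
  fixes scl :: "'k::real_normed_field \<Rightarrow> 'v::ab_group_add \<Rightarrow> 'v"
  assumes vs: "vector_space scl" and p: "seminorm scl p"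
  shows seminorm_zero: "p 0 = 0"
    and seminorm_nonneg: "0 \<le> p x"
    and seminorm_minus_commute: "p (x - y) = p (y - x)"
proof -
  interpret vector_space scl by (rule vs)
  have add: "p (x + y) \<le> p x + p y" and scale: "p (scl c x) = norm c * p x" for x y c
    using p by (auto simp: seminorm_def)
  show z: "p 0 = 0" using scale[of 0 0] by simp
  have m: "p (- x) = p x" for x using scale[of "-1" x] by simp
  show "0 \<le> p x" using add[of x "- x"] z m[of x] by simp
  show "p (x - y) = p (y - x)" using m[of "x - y"] by simp
qed

context hausdorff_lcs
begin

text \<open>Balls of continuous seminorms form a neighbourhood base at 0, and translations carry it
  to \<open>l\<close>. The criterion turns limits in the completion into real estimates.\<close>

lemma tendsto_iff_seminorms:
  "(f \<longlongrightarrow> l) F \<longleftrightarrow> (\<forall>u. continuous_seminorm scl u \<longrightarrow> ((\<lambda>p. u (f p - l)) \<longlongrightarrow> 0) F)"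
proof (intro iffI allI impI)
  fix u assume l: "(f \<longlongrightarrow> l) F" and u: "continuous_seminorm scl u"
  then have s: "seminorm scl u" and c: "continuous_on UNIV u"
    by (auto simp: continuous_seminorm_def)
  have "((\<lambda>p. f p - l) \<longlongrightarrow> l - l) F" by (intro tendsto_intros l)
  then have "((\<lambda>p. u (f p - l)) \<longlongrightarrow> u (l - l)) F"
    using c by (intro continuous_on_tendsto_compose[of UNIV u]) auto
  then show "((\<lambda>p. u (f p - l)) \<longlongrightarrow> 0) F"
    by (simp add: seminorm_zero[OF vector_space_axioms s])
next
  assume r: "\<forall>u. continuous_seminorm scl u \<longrightarrow> ((\<lambda>p. u (f p - l)) \<longlongrightarrow> 0) F"
  show "(f \<longlongrightarrow> l) F"
  proof (rule topological_tendstoI)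
    fix N assume N: "open N" "l \<in> N"
    have "open ((\<lambda>x. x + l) -` N)"
      by (intro open_vimage N continuous_intros)
    then obtain u where u: "continuous_seminorm scl u" "{x. u x < 1} \<subseteq> (\<lambda>x. x + l) -` N"
      using locally_convex[of "(\<lambda>x. x + l) -` N"] N by auto
    then have "\<forall>\<^sub>F p in F. u (f p - l) < 1"
      using r by (intro order_tendstoD(2)[of _ 0]) auto
    then show "\<forall>\<^sub>F p in F. f p \<in> N"
    proof (rule eventually_mono)
      fix p assume "u (f p - l) < 1"
      then have "f p - l \<in> (\<lambda>x. x + l) -` N" using u(2) by blast
      then show "f p \<in> N" by simp
    qed
  qed
qed

end

section \<open>Extension of bounded bilinear maps to a completion\<close>

text \<open>Isolates what the extension argument uses, for any directed family \<open>Q\<close>, so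
  that the topologies for \<open>R\<close> and \<open>R^-\<close> are both instances. Subadditivity
  and homogeneity are demanded only on \<open>S\<close>, since an infimum over representations is
  meaningful only for elements that have one.\<close>

locale seminormed_completion = vector_space scl
  for scl :: "'k::real_normed_field \<Rightarrow> 't::ab_group_add \<Rightarrow> 't" +
  fixes S :: "'t set" and Q :: "('t \<Rightarrow> real) set"
    and scl' :: "'k \<Rightarrow> 'w::{uniform_topological_group_add,topological_ab_group_add,t2_space,complete_uniform_space} \<Rightarrow> 'w"
    and \<iota> :: "'t \<Rightarrow> 'w"
  assumes completion: "is_completion scl S Q scl' \<iota>"
    and S_subspace: "subspace S"
    and Q_nonempty: "Q \<noteq> {}"
    and Q_directed: "q1 \<in> Q \<Longrightarrow> q2 \<in> Q \<Longrightarrow> \<exists>q\<in>Q. \<forall>x\<in>S. q1 x \<le> q x \<and> q2 x \<le> q x"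
    and Q_add: "q \<in> Q \<Longrightarrow> x \<in> S \<Longrightarrow> y \<in> S \<Longrightarrow> q (x + y) \<le> q x + q y"
    and Q_scale: "q \<in> Q \<Longrightarrow> x \<in> S \<Longrightarrow> q (scl c x) = norm c * q x"
begin

sublocale W: hausdorff_lcs scl'
  using completion by (simp add: is_completion_def)

lemma S_closed:
  "0 \<in> S" "x \<in> S \<Longrightarrow> y \<in> S \<Longrightarrow> x + y \<in> S" "x \<in> S \<Longrightarrow> y \<in> S \<Longrightarrow> x - y \<in> S"
  "x \<in> S \<Longrightarrow> scl c x \<in> S"
  using S_subspace by (auto intro: subspace_0 subspace_add subspace_diff subspace_scale)

lemma
  shows iota_add: "x \<in> S \<Longrightarrow> y \<in> S \<Longrightarrow> \<iota> (x + y) = \<iota> x + \<iota> y"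
    and iota_scale: "x \<in> S \<Longrightarrow> \<iota> (scl c x) = scl' c (\<iota> x)"
    and iota_embedding: "embedding_map (seminorm_topology S Q) euclidean \<iota>"
    and iota_dense: "closure (\<iota> ` S) = UNIV"
  using completion by (auto simp: is_completion_def)

lemma iota_zero: "\<iota> 0 = 0"
  using iota_scale[of 0 0] S_closed(1) by simp

lemma iota_diff: "x \<in> S \<Longrightarrow> y \<in> S \<Longrightarrow> \<iota> (x - y) = \<iota> x - \<iota> y"
  using iota_add[of "x - y" y] S_closed(3)[of x y] by simp

lemma iota_sum: "(\<And>i. i \<in> I \<Longrightarrow> f i \<in> S) \<Longrightarrow> \<iota> (\<Sum>i\<in>I. f i) = (\<Sum>i\<in>I. \<iota> (f i))"
proof (induction I rule: infinite_finite_induct)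
  case (insert i I)
  then show ?case by (simp add: iota_add subspace_sum[OF S_subspace])
qed (simp_all add: iota_zero)

lemma
  assumes q: "q \<in> Q"
  shows Q_zero: "q 0 = 0"
    and Q_nonneg: "x \<in> S \<Longrightarrow> 0 \<le> q x"
    and Q_minus_commute: "x \<in> S \<Longrightarrow> y \<in> S \<Longrightarrow> q (x - y) = q (y - x)"
proof -
  have minus: "q (- x) = q x" if "x \<in> S" for x
    using Q_scale[OF q that, of "-1"] by simp
  show z: "q 0 = 0" using Q_scale[OF q S_closed(1), of 0] by simp
  show "0 \<le> q x" if "x \<in> S"
    using Q_add[OF q that, of "- x"] minus[OF that] z S_closed(4)[OF that, of "-1"] by simp
  show "q (x - y) = q (y - x)" if "x \<in> S" "y \<in> S"
    using minus[of "x - y"] S_closed(3)[OF that] by simp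
qed

lemma Q_diff_abs_le: "q \<in> Q \<Longrightarrow> x \<in> S \<Longrightarrow> y \<in> S \<Longrightarrow> \<bar>q x - q y\<bar> \<le> q (x - y)"
  using Q_add[of q "x - y" y] Q_add[of q "y - x" x] Q_minus_commute[of q x y]
    S_closed(3)[of x y] S_closed(3)[of y x] by simp

section \<open>The topology generated by a directed family of seminorms\<close>

lemma topspace_seminorm_topology: "topspace (seminorm_topology S Q) = S"
proof -
  obtain q where q: "q \<in> Q" using Q_nonempty by blast
  have "x \<in> \<Union> {{y \<in> S. q (y - x) < r} |q x r. q \<in> Q \<and> x \<in> S \<and> 0 < r}" if "x \<in> S" for x
  proof (rule UnionI)
    show "{y \<in> S. q (y - x) < 1} \<in> {{y \<in> S. q (y - x) < r} |q x r. q \<in> Q \<and> x \<in> S \<and> 0 < r}"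
      by (rule CollectI, rule exI[of _ q], rule exI[of _ x], rule exI[of _ 1]) (use that q in simp)
  qed (use that Q_zero[OF q] in simp)
  then show ?thesis
    unfolding seminorm_topology_def topology_generated_by_topspace by auto
qed

lemma openin_ball: 
  assumes "q \<in> Q" "r > 0" shows "openin (seminorm_topology S Q) {y \<in> S. q y < r}"
  unfolding seminorm_topology_def
proof (rule topology_generated_by_Basis)
  show "{y \<in> S. q y < r} \<in> {{y \<in> S. q (y - x) < r} |q x r. q \<in> Q \<and> x \<in> S \<and> 0 < r}"
    by (rule CollectI, rule exI[of _ q], rule exI[of _ 0], rule exI[of _ r])
      (use assms S_closed(1) in simp)
qed

text \<open>The balls are given only as a subbase. Directedness puts one ball inside the
  intersection of two, and the triangle inequality recentres a ball at any of its points.\<close>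

lemma openin_contains_ball:
  assumes "openin (seminorm_topology S Q) U" "x \<in> U"
  shows "\<exists>q\<in>Q. \<exists>r>0. {y \<in> S. q (y - x) < r} \<subseteq> U"
proof -
  have "generate_topology_on {{y \<in> S. q (y - x) < r} |q x r. q \<in> Q \<and> x \<in> S \<and> 0 < r} U"
    using assms(1) by (simp add: seminorm_topology_def openin_topology_generated_by_iff)
  then have "U \<subseteq> S \<and> (\<forall>x\<in>U. \<exists>q\<in>Q. \<exists>r>0. {y \<in> S. q (y - x) < r} \<subseteq> U)"
  proof induction
    case (Int U1 U2)
    show ?case
    proof (intro conjI ballI)
      fix x assume x: "x \<in> U1 \<inter> U2"
      then have xS: "x \<in> S" using Int.IH by blast
      obtain q1 r1 where 1: "q1 \<in> Q" "r1 > 0" "{y \<in> S. q1 (y - x) < r1} \<subseteq> U1"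
        using Int.IH(1) x by blast
      obtain q2 r2 where 2: "q2 \<in> Q" "r2 > 0" "{y \<in> S. q2 (y - x) < r2} \<subseteq> U2"
        using Int.IH(2) x by blast
      obtain q where q: "q \<in> Q" "\<And>x. x \<in> S \<Longrightarrow> q1 x \<le> q x \<and> q2 x \<le> q x"
        using Q_directed[OF 1(1) 2(1)] by blast
      have "{y \<in> S. q (y - x) < min r1 r2} \<subseteq> U1 \<inter> U2"
      proof
        fix y assume "y \<in> {y \<in> S. q (y - x) < min r1 r2}"
        then have y: "y \<in> S" "q (y - x) < r1" "q (y - x) < r2" by auto
        then show "y \<in> U1 \<inter> U2"
          using q(2)[OF S_closed(3)[OF y(1) xS]] 1(3) 2(3) by (auto simp: subset_iff)
      qed
      then show "\<exists>q\<in>Q. \<exists>r>0. {y \<in> S. q (y - x) < r} \<subseteq> U1 \<inter> U2"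
        using q(1) 1(2) 2(2) by (intro bexI[of _ q] exI[of _ "min r1 r2"]) auto
    qed (use Int.IH in blast)
  next
    case (Basis U)
    then obtain q x r where U: "U = {y \<in> S. q (y - x) < r}" "q \<in> Q" "x \<in> S" "r > 0" by blast
    have "{y \<in> S. q (y - z) < r - q (z - x)} \<subseteq> U" if "z \<in> U" for z
    proof
      fix y assume y: "y \<in> {y \<in> S. q (y - z) < r - q (z - x)}"
      then have "q ((y - z) + (z - x)) \<le> q (y - z) + q (z - x)"
        using that U by (intro Q_add S_closed) auto
      then show "y \<in> U" using y U(1) by simp
    qed
    moreover have "0 < r - q (z - x)" if "z \<in> U" for z using that U(1) by simp
    ultimately have "\<exists>q\<in>Q. \<exists>r>0. {y \<in> S. q (y - z) < r} \<subseteq> U" if "z \<in> U" for z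
      using U(2) that by blast
    moreover have "U \<subseteq> S" using U(1) by blast
    ultimately show ?case by blast
  next
    case (UN K)
    show ?case
    proof (intro conjI ballI)
      show "\<Union> K \<subseteq> S" using UN.IH by blast
      fix x assume "x \<in> \<Union> K"
      then obtain k where k: "k \<in> K" "x \<in> k" by blast
      then obtain q r where "q \<in> Q" "r > 0" "{y \<in> S. q (y - x) < r} \<subseteq> k"
        using UN.IH[OF k(1)] by blast
      then show "\<exists>q\<in>Q. \<exists>r>0. {y \<in> S. q (y - x) < r} \<subseteq> \<Union> K"
        using k(1) by blast
    qed
  qed simp
  then show ?thesis using assms(2) by blast
qed

text \<open>The trace on \<open>S\<close> of the neighbourhood filter of \<open>a\<close>; limits
  along it replace approximating nets. The restriction to \<open>S\<close> is essential because
  nothing is known about \<open>\<iota>\<close> elsewhere.\<close>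

definition nhds_trace :: "'w \<Rightarrow> 't filter" where
  "nhds_trace a = inf (filtercomap \<iota> (nhds a)) (principal S)"

lemma eventually_nhds_trace: "eventually P (nhds_trace a) \<longleftrightarrow> (\<exists>N. open N \<and> a \<in> N \<and> (\<forall>x\<in>S. \<iota> x \<in> N \<longrightarrow> P x))"
  unfolding nhds_trace_def eventually_inf_principal eventually_filtercomap eventually_nhds
  by (auto 4 4)

lemma filterlim_nhds_trace: "filterlim f (nhds_trace a) G \<longleftrightarrow> ((\<lambda>p. \<iota> (f p)) \<longlongrightarrow> a) G \<and> (\<forall>\<^sub>F p in G. f p \<in> S)"
  by (simp add: nhds_trace_def filterlim_inf filterlim_filtercomap_iff o_def filterlim_principal)

text \<open>Density of the image, in the form that makes limits along trace filters unique.\<close>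

lemma nhds_trace_neq_bot: "nhds_trace a \<noteq> bot"
proof -
  have "\<exists>x\<in>S. \<iota> x \<in> N" if "open N" "a \<in> N" for N
  proof -
    have "a \<in> closure (\<iota> ` S)" by (simp add: iota_dense)
    then show ?thesis using that by (auto simp: closure_iff_nhds_not_empty)
  qed
  then show ?thesis unfolding trivial_limit_def eventually_nhds_trace by blast
qed

lemma eventually_nhds_trace_in: "\<forall>\<^sub>F x in nhds_trace a. x \<in> S"
  by (auto simp: eventually_nhds_trace)

lemma filterlim_nhds_trace_iota: "x \<in> S \<Longrightarrow> filterlim (\<lambda>_. x) (nhds_trace (\<iota> x)) G"
  by (simp add: filterlim_nhds_trace)

lemma filterlim_nhds_trace_add:
  assumes "filterlim f (nhds_trace a) G" "filterlim g (nhds_trace b) G"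
  shows "filterlim (\<lambda>p. f p + g p) (nhds_trace (a + b)) G"
proof -
  from assms have S: "\<forall>\<^sub>F p in G. f p \<in> S \<and> g p \<in> S" by (auto simp: filterlim_nhds_trace eventually_conj_iff)
  have "((\<lambda>p. \<iota> (f p) + \<iota> (g p)) \<longlongrightarrow> a + b) G"
    using assms by (intro tendsto_add) (auto simp: filterlim_nhds_trace)
  then have "((\<lambda>p. \<iota> (f p + g p)) \<longlongrightarrow> a + b) G"
    by (rule Lim_transform_eventually) (use S in eventually_elim, auto simp: iota_add)
  moreover have "\<forall>\<^sub>F p in G. f p + g p \<in> S"
    using S by eventually_elim (auto intro: S_closed)
  ultimately show ?thesis by (simp add: filterlim_nhds_trace)
qed

text \<open>Continuity of a fixed dilation comes from homogeneity of the seminorms that test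
  limits.\<close>

lemma tendsto_scale: "(f \<longlongrightarrow> a) G \<Longrightarrow> ((\<lambda>p. scl' c (f p)) \<longlongrightarrow> scl' c a) G"
proof -
  assume f: "(f \<longlongrightarrow> a) G"
  have "((\<lambda>p. u (scl' c (f p) - scl' c a)) \<longlongrightarrow> 0) G" if u: "continuous_seminorm scl' u" for u
  proof -
    have "u (scl' c (f p) - scl' c a) = norm c * u (f p - a)" for p
      using u by (simp add: continuous_seminorm_def seminorm_def flip: W.scale_right_diff_distrib)
    then show ?thesis
      using f u tendsto_mult_right_zero[of "\<lambda>p. u (f p - a)" G "norm c"]
      by (simp add: W.tendsto_iff_seminorms)
  qed
  then show ?thesis by (subst W.tendsto_iff_seminorms) blast
qed

lemma filterlim_nhds_trace_scale:
  assumes "filterlim f (nhds_trace a) G" shows "filterlim (\<lambda>p. scl c (f p)) (nhds_trace (scl' c a)) G"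
proof -
  have S: "\<forall>\<^sub>F p in G. f p \<in> S" and l: "((\<lambda>p. \<iota> (f p)) \<longlongrightarrow> a) G"
    using assms by (auto simp: filterlim_nhds_trace)
  have "((\<lambda>p. \<iota> (scl c (f p))) \<longlongrightarrow> scl' c a) G"
    using tendsto_scale[OF l] by (rule Lim_transform_eventually)
      (use S in eventually_elim, auto simp: iota_scale)
  moreover have "\<forall>\<^sub>F p in G. scl c (f p) \<in> S"
    using S by eventually_elim (auto intro: S_closed)
  ultimately show ?thesis by (simp add: filterlim_nhds_trace)
qed

lemma filterlim_nhds_trace_diff:
  assumes "filterlim f (nhds_trace a) G" "filterlim g (nhds_trace b) G"
  shows "filterlim (\<lambda>p. f p - g p) (nhds_trace (a - b)) G"
  using filterlim_nhds_trace_add[OF assms(1) filterlim_nhds_trace_scale[OF assms(2), of "-1"]] by simp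

text \<open>Here \<open>\<iota>\<close> being open onto its image enters: the image of a ball is cut
  out by an open set \<open>N\<close> of the completion, so closeness to 0 there forces
  \<open>q\<close> to be small.\<close>

lemma Q_tendsto_0: assumes q: "q \<in> Q" shows "(q \<longlongrightarrow> 0) (nhds_trace 0)"
proof (rule tendstoI)
  fix e :: real assume e: "e > 0"
  let ?B = "{y \<in> S. q y < e}"
  have hm: "homeomorphic_map (seminorm_topology S Q) (subtopology euclidean (\<iota> ` S)) \<iota>"
    using iota_embedding by (simp add: embedding_map_def topspace_seminorm_topology)
  then have "openin (subtopology euclidean (\<iota> ` S)) (\<iota> ` ?B)"
    using openin_ball[OF q e] homeomorphic_map_openness[OF hm, of ?B]
    by (auto simp: topspace_seminorm_topology)
  then obtain N where N: "open N" "\<iota> ` ?B = N \<inter> \<iota> ` S"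
    by (auto simp: openin_subtopology)
  \<comment> \<open>Injectivity identifies a point of \<open>S\<close> whose image lies in
    \<open>N\<close> with a point of the ball.\<close>
  have inj: "inj_on \<iota> S"
    using homeomorphic_imp_injective_map[OF hm] by (simp add: topspace_seminorm_topology)
  have "q x < e" if "x \<in> S" "\<iota> x \<in> N" for x
  proof -
    have "\<iota> x \<in> \<iota> ` ?B" using that N(2) by blast
    then obtain y where y: "y \<in> ?B" "\<iota> x = \<iota> y" by blast
    then have "x = y" using inj_onD[OF inj y(2)] that(1) by simp
    then show ?thesis using y(1) by simp
  qed
  moreover have "0 \<in> N"
  proof -
    have "0 \<in> ?B" using S_closed(1) e Q_zero[OF q] by simp
    then have "\<iota> 0 \<in> \<iota> ` ?B" by (rule imageI)
    then show ?thesis unfolding N(2) iota_zero by (rule IntD1)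
  qed
  ultimately have "\<forall>\<^sub>F x in nhds_trace 0. x \<in> S \<and> q x < e"
    using N(1) by (auto simp: eventually_nhds_trace)
  then show "\<forall>\<^sub>F x in nhds_trace 0. dist (q x) 0 < e"
    by eventually_elim (use Q_nonneg[OF q] in auto)
qed

section \<open>Extension of the seminorms to the completion\<close>

definition ext_seminorm :: "('t \<Rightarrow> real) \<Rightarrow> 'w \<Rightarrow> real" where
  "ext_seminorm q a = Lim (nhds_trace a) q"

text \<open>By the reverse triangle inequality the values of \<open>q\<close> vary by at most
  \<open>q (x - y)\<close>, and the difference of two points near \<open>a\<close> is near 0; so the
  values are Cauchy.\<close>

lemma Q_tendsto_ext: assumes q: "q \<in> Q" shows "(q \<longlongrightarrow> ext_seminorm q a) (nhds_trace a)"
proof -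
  have "filterlim (\<lambda>p. fst p - snd p) (nhds_trace (a - a)) (nhds_trace a \<times>\<^sub>F nhds_trace a)"
    by (intro filterlim_nhds_trace_diff filterlim_fst filterlim_snd)
  then have "((\<lambda>p. q (fst p - snd p)) \<longlongrightarrow> 0) (nhds_trace a \<times>\<^sub>F nhds_trace a)"
    using filterlim_compose[OF Q_tendsto_0[OF q]] by simp
  moreover have "\<forall>\<^sub>F p in nhds_trace a \<times>\<^sub>F nhds_trace a. norm (q (fst p) - q (snd p)) \<le> q (fst p - snd p)"
    using eventually_nhds_trace_in eventually_nhds_trace_in unfolding eventually_prod_filter
    by (intro exI[of _ "\<lambda>x. x \<in> S"]) (auto simp: Q_diff_abs_le[OF q] eventually_nhds_trace_in)
  ultimately have "((\<lambda>p. q (fst p) - q (snd p)) \<longlongrightarrow> 0) (nhds_trace a \<times>\<^sub>F nhds_trace a)"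
    by (rule Lim_null_comparison[rotated])
  from convergent_if_differences_vanish[where f = q, OF this]
  obtain l where l: "(q \<longlongrightarrow> l) (nhds_trace a)" by blast
  show ?thesis unfolding ext_seminorm_def tendsto_Lim[OF nhds_trace_neq_bot l] by (rule l)
qed

lemma ext_seminorm_tendsto:
  assumes "q \<in> Q" "filterlim f (nhds_trace a) G" shows "((\<lambda>p. q (f p)) \<longlongrightarrow> ext_seminorm q a) G"
  by (rule filterlim_compose[OF Q_tendsto_ext[OF assms(1)] assms(2)])

lemma ext_seminorm_0: "q \<in> Q \<Longrightarrow> ext_seminorm q 0 = 0"
  unfolding ext_seminorm_def by (rule tendsto_Lim[OF nhds_trace_neq_bot Q_tendsto_0])

lemma ext_seminorm_add:
  assumes q: "q \<in> Q" shows "ext_seminorm q (a + b) \<le> ext_seminorm q a + ext_seminorm q b"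
proof (rule tendsto_le)
  let ?G = "nhds_trace a \<times>\<^sub>F nhds_trace b"
  show "?G \<noteq> bot" by (simp add: prod_filter_eq_bot nhds_trace_neq_bot)
  show "((\<lambda>p. q (fst p) + q (snd p)) \<longlongrightarrow> ext_seminorm q a + ext_seminorm q b) ?G"
    by (intro tendsto_add ext_seminorm_tendsto[OF q] filterlim_fst filterlim_snd)
  show "((\<lambda>p. q (fst p + snd p)) \<longlongrightarrow> ext_seminorm q (a + b)) ?G"
    by (intro ext_seminorm_tendsto[OF q] filterlim_nhds_trace_add filterlim_fst filterlim_snd)
  show "\<forall>\<^sub>F p in ?G. q (fst p + snd p) \<le> q (fst p) + q (snd p)"
    unfolding eventually_prod_filter
    by (intro exI[of _ "\<lambda>x. x \<in> S"]) (auto simp: Q_add[OF q] eventually_nhds_trace_in)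
qed

lemma ext_seminorm_minus:
  assumes q: "q \<in> Q" shows "ext_seminorm q (- a) = ext_seminorm q a"
proof (rule tendsto_unique[OF nhds_trace_neq_bot])
  show "(q \<longlongrightarrow> ext_seminorm q a) (nhds_trace a)" by (rule Q_tendsto_ext[OF q])
  have "((\<lambda>x. q (scl (-1) x)) \<longlongrightarrow> ext_seminorm q (scl' (-1) a)) (nhds_trace a)"
    by (intro ext_seminorm_tendsto[OF q] filterlim_nhds_trace_scale filterlim_ident)
  then have "((\<lambda>x. q (scl (-1) x)) \<longlongrightarrow> ext_seminorm q (- a)) (nhds_trace a)" by simp
  then show "(q \<longlongrightarrow> ext_seminorm q (- a)) (nhds_trace a)"
    by (rule Lim_transform_eventually)
      (use eventually_nhds_trace_in[of a] in eventually_elim, simp only: Q_scale[OF q], simp)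
qed

lemma ext_seminorm_nonneg: "q \<in> Q \<Longrightarrow> 0 \<le> ext_seminorm q a"
  using ext_seminorm_add[of q a "- a"] ext_seminorm_minus[of q a] ext_seminorm_0[of q] by simp

lemma ext_seminorm_tendsto_0:
  assumes q: "q \<in> Q" and f: "(f \<longlongrightarrow> 0) G" shows "((\<lambda>p. ext_seminorm q (f p)) \<longlongrightarrow> 0) G"
proof (rule tendstoI)
  \<comment> \<open>Strict bounds become non-strict in the limit that defines
    \<open>ext_seminorm q\<close>, so only half of \<open>e\<close> is used on
    \<open>S\<close>.\<close>
  fix e :: real assume e: "e > 0"
  have "\<forall>\<^sub>F x in nhds_trace 0. q x < e / 2"
    using order_tendstoD(2)[OF Q_tendsto_0[OF q], of "e / 2"] e by simp
  then obtain N where N: "open N" "0 \<in> N" "\<And>x. x \<in> S \<Longrightarrow> \<iota> x \<in> N \<Longrightarrow> q x < e / 2"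
    by (auto simp: eventually_nhds_trace)
  have "ext_seminorm q w \<le> e / 2" if w: "w \<in> N" for w
  proof (rule tendsto_upperbound[OF Q_tendsto_ext[OF q] _ nhds_trace_neq_bot])
    show "\<forall>\<^sub>F x in nhds_trace w. q x \<le> e / 2"
      using N w by (auto simp: eventually_nhds_trace intro!: exI[of _ N] less_imp_le)
  qed
  moreover have "\<forall>\<^sub>F p in G. f p \<in> N" using N f by (auto simp: tendsto_def)
  ultimately show "\<forall>\<^sub>F p in G. dist (ext_seminorm q (f p)) 0 < e"
    by (elim eventually_mono) (use e ext_seminorm_nonneg[OF q] in fastforce)
qed

lemma ext_seminorm_continuous:
  assumes q: "q \<in> Q" and f: "(f \<longlongrightarrow> a) G"
  shows "((\<lambda>p. ext_seminorm q (f p)) \<longlongrightarrow> ext_seminorm q a) G"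
proof (rule Lim_transform2)
  show "((\<lambda>_. ext_seminorm q a) \<longlongrightarrow> ext_seminorm q a) G" by simp
  have "((\<lambda>p. f p - a) \<longlongrightarrow> a - a) G" by (intro tendsto_intros f)
  then have "((\<lambda>p. ext_seminorm q (f p - a)) \<longlongrightarrow> 0) G"
    by (intro ext_seminorm_tendsto_0 q) simp
  moreover have "norm (ext_seminorm q a - ext_seminorm q (f p)) \<le> ext_seminorm q (f p - a)" for p
    using ext_seminorm_add[OF q, of "f p - a" a] ext_seminorm_add[OF q, of "a - f p" "f p"]
      ext_seminorm_minus[OF q, of "f p - a"] by simp
  then have "\<forall>\<^sub>F p in G. norm (ext_seminorm q a - ext_seminorm q (f p)) \<le> ext_seminorm q (f p - a)" by simp
  ultimately show "((\<lambda>p. ext_seminorm q a - ext_seminorm q (f p)) \<longlongrightarrow> 0) G"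
    by (rule Lim_null_comparison[rotated])
qed

text \<open>Here continuity of \<open>\<iota>\<close> enters: \<open>u\<close> composed with
  \<open>\<iota>\<close> is below 1 on some ball of radius \<open>r\<close>, and homogeneity turns
  this into a bound by \<open>q / r\<close>. It carries estimates from \<open>Q\<close> to all
  continuous seminorms of the completion.\<close>

lemma continuous_seminorm_dominated:
  assumes u: "continuous_seminorm scl' u"
  obtains q C where "q \<in> Q" "C > 0" "\<And>x. x \<in> S \<Longrightarrow> u (\<iota> x) \<le> C * q x"
proof -
  have s: "seminorm scl' u" and c: "continuous_on UNIV u"
    using u by (auto simp: continuous_seminorm_def)
  have us: "u (scl' c x) = norm c * u x" for c x using s by (simp add: seminorm_def)
  have u0: "u 0 = 0" by (rule seminorm_zero[OF W.vector_space_axioms s])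
  have "continuous_map (seminorm_topology S Q) euclidean \<iota>"
    using homeomorphic_imp_continuous_map[OF iota_embedding[unfolded embedding_map_def]]
    by (simp add: continuous_map_in_subtopology)
  moreover have "continuous_map euclidean euclideanreal u" using c by simp
  ultimately have "continuous_map (seminorm_topology S Q) euclideanreal (u \<circ> \<iota>)"
    by (rule continuous_map_compose)
  from openin_continuous_map_preimage[OF this, of "{..<1}"]
  have "openin (seminorm_topology S Q) {x \<in> S. u (\<iota> x) < 1}"
    by (simp add: topspace_seminorm_topology)
  moreover have "0 \<in> {x \<in> S. u (\<iota> x) < 1}" using S_closed(1) by (simp add: iota_zero u0)
  ultimately obtain q r where q: "q \<in> Q" "r > 0" "{y \<in> S. q (y - 0) < r} \<subseteq> {x \<in> S. u (\<iota> x) < 1}"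
    using openin_contains_ball by blast
  have "u (\<iota> x) \<le> (1 / r) * q x" if x: "x \<in> S" for x
  proof (rule field_le_epsilon)
    fix e :: real assume e: "e > 0"
    \<comment> \<open>Just above \<open>q x / r\<close>, so that \<open>x / t\<close> lies in the
      ball; the margin \<open>e\<close> keeps \<open>t\<close> positive when
      \<open>q x = 0\<close>.\<close>
    define t where "t = q x / r + e"
    have t: "t > 0" unfolding t_def using e q(2) Q_nonneg[OF q(1) x] by (simp add: add_nonneg_pos)
    have "q x < t * r" unfolding t_def using q(2) e by (simp add: field_simps)
    then have "q (scl (of_real (1 / t)) x) < r"
      using t by (simp add: Q_scale[OF q(1) x] norm_inverse norm_divide field_simps)
    then have "u (\<iota> (scl (of_real (1 / t)) x)) < 1"
      using q(3) S_closed(4)[OF x] by (auto simp: subset_iff)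
    then have "u (\<iota> x) < t"
      using t by (simp add: iota_scale[OF x] us norm_divide field_simps)
    then show "u (\<iota> x) \<le> 1 / r * q x + e" by (simp add: t_def)
  qed
  then show ?thesis using that[of q "1 / r"] q(1,2) by simp
qed

section \<open>Bounded bilinear maps and their continuous extension\<close>

definition bilinear_on :: "('t \<Rightarrow> 't \<Rightarrow> 't) \<Rightarrow> bool" where
  "bilinear_on \<beta> \<longleftrightarrow> (\<forall>x\<in>S. \<forall>y\<in>S. \<beta> x y \<in> S \<and>
     (\<forall>x'\<in>S. \<beta> (x + x') y = \<beta> x y + \<beta> x' y) \<and> (\<forall>y'\<in>S. \<beta> x (y + y') = \<beta> x y + \<beta> x y') \<and>
     (\<forall>c. \<beta> (scl c x) y = scl c (\<beta> x y)) \<and> (\<forall>c. \<beta> x (scl c y) = scl c (\<beta> x y)))"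

definition bounded_on :: "('t \<Rightarrow> 't \<Rightarrow> 't) \<Rightarrow> bool" where
  "bounded_on \<beta> \<longleftrightarrow> (\<forall>q\<in>Q. \<exists>q'\<in>Q. \<exists>C\<ge>0. \<forall>x\<in>S. \<forall>y\<in>S. q (\<beta> x y) \<le> C * (q' x * q' y))"

lemma bounded_on_seminorm:
  assumes "bounded_on \<beta>" "continuous_seminorm scl' u" "bilinear_on \<beta>"
  obtains q C where "q \<in> Q" "C \<ge> 0" "\<And>x y. x \<in> S \<Longrightarrow> y \<in> S \<Longrightarrow> u (\<iota> (\<beta> x y)) \<le> C * (q x * q y)"
proof -
  obtain q C where q: "q \<in> Q" "C > 0" "\<And>x. x \<in> S \<Longrightarrow> u (\<iota> x) \<le> C * q x"
    using continuous_seminorm_dominated[OF assms(2)] by blast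
  obtain q' C' where q': "q' \<in> Q" "C' \<ge> 0" "\<And>x y. x \<in> S \<Longrightarrow> y \<in> S \<Longrightarrow> q (\<beta> x y) \<le> C' * (q' x * q' y)"
    using bspec[OF assms(1)[unfolded bounded_on_def] q(1)] by blast
  have "u (\<iota> (\<beta> x y)) \<le> (C * C') * (q' x * q' y)" if "x \<in> S" "y \<in> S" for x y
  proof -
    have "u (\<iota> (\<beta> x y)) \<le> C * q (\<beta> x y)" using assms(3) that by (intro q(3)) (auto simp: bilinear_on_def)
    also have "\<dots> \<le> C * (C' * (q' x * q' y))" using q'(3)[OF that] q(2) by simp
    finally show ?thesis by (simp add: mult.assoc)
  qed
  then show ?thesis using that[of q' "C * C'"] q' q(2) by simp
qed

lemma bilinear_on_diff:
  assumes b: "bilinear_on \<beta>" and S: "x \<in> S" "y \<in> S" "x' \<in> S" "y' \<in> S"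
  shows "\<beta> x y - \<beta> x' y' = \<beta> (x - x') y + \<beta> x' (y - y')"
proof -
  have "\<beta> ((x - x') + x') y = \<beta> (x - x') y + \<beta> x' y" "\<beta> x' ((y - y') + y') = \<beta> x' (y - y') + \<beta> x' y'"
    using b S S_closed(3) unfolding bilinear_on_def by blast+
  then show ?thesis by simp
qed

text \<open>A bilinear map need not be uniformly continuous, but along trace filters
  \<open>q (g p)\<close> and \<open>q (f' p)\<close> converge. In the telescoped difference every
  summand is therefore bounded by a null factor times a convergent one.\<close>

lemma bilinear_difference_tendsto_0:
  assumes b: "bilinear_on \<beta>" "bounded_on \<beta>"
    and f: "filterlim f (nhds_trace a) G" "filterlim f' (nhds_trace a) G"
    and g: "filterlim g (nhds_trace b) G" "filterlim g' (nhds_trace b) G"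
  shows "((\<lambda>p. \<iota> (\<beta> (f p) (g p)) - \<iota> (\<beta> (f' p) (g' p))) \<longlongrightarrow> 0) G"
  unfolding W.tendsto_iff_seminorms
proof (intro allI impI)
  fix u assume u: "continuous_seminorm scl' u"
  then have s: "seminorm scl' u" by (simp add: continuous_seminorm_def)
  obtain q C where q: "q \<in> Q" "C \<ge> 0" "\<And>x y. x \<in> S \<Longrightarrow> y \<in> S \<Longrightarrow> u (\<iota> (\<beta> x y)) \<le> C * (q x * q y)"
    using bounded_on_seminorm[OF b(2) u b(1)] by blast
  have S: "\<forall>\<^sub>F p in G. f p \<in> S \<and> f' p \<in> S \<and> g p \<in> S \<and> g' p \<in> S"
    using f g by (auto simp: filterlim_nhds_trace eventually_conj_iff)
  have "((\<lambda>p. C * (q (f p - f' p) * q (g p)) + C * (q (f' p) * q (g p - g' p))) \<longlongrightarrow>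
         C * (ext_seminorm q (a - a) * ext_seminorm q b) + C * (ext_seminorm q a * ext_seminorm q (b - b))) G"
    by (intro tendsto_intros ext_seminorm_tendsto[OF q(1)] filterlim_nhds_trace_diff f g)
  then have "((\<lambda>p. C * (q (f p - f' p) * q (g p)) + C * (q (f' p) * q (g p - g' p))) \<longlongrightarrow> 0) G"
    by (simp add: ext_seminorm_0[OF q(1)])
  moreover have "\<forall>\<^sub>F p in G. norm (u (\<iota> (\<beta> (f p) (g p)) - \<iota> (\<beta> (f' p) (g' p)) - 0)) \<le>
      C * (q (f p - f' p) * q (g p)) + C * (q (f' p) * q (g p - g' p))"
    using S
  proof eventually_elim
    case (elim p)
    then have d: "f p - f' p \<in> S" "g p - g' p \<in> S" by (auto intro: S_closed)
    have "\<iota> (\<beta> (f p) (g p)) - \<iota> (\<beta> (f' p) (g' p)) = \<iota> (\<beta> (f p) (g p) - \<beta> (f' p) (g' p))"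
      using b(1) elim by (subst iota_diff) (auto simp: bilinear_on_def)
    also have "\<dots> = \<iota> (\<beta> (f p - f' p) (g p) + \<beta> (f' p) (g p - g' p))"
      using bilinear_on_diff[OF b(1), of "f p" "g p" "f' p" "g' p"] elim by simp
    also have "\<dots> = \<iota> (\<beta> (f p - f' p) (g p)) + \<iota> (\<beta> (f' p) (g p - g' p))"
      using b(1) elim d by (subst iota_add) (auto simp: bilinear_on_def)
    finally have "u (\<iota> (\<beta> (f p) (g p)) - \<iota> (\<beta> (f' p) (g' p))) \<le>
        u (\<iota> (\<beta> (f p - f' p) (g p))) + u (\<iota> (\<beta> (f' p) (g p - g' p)))"
      using s by (simp add: seminorm_def)
    also have "\<dots> \<le> C * (q (f p - f' p) * q (g p)) + C * (q (f' p) * q (g p - g' p))"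
      using elim d by (intro add_mono q(3)) auto
    finally show ?case
      using seminorm_nonneg[OF W.vector_space_axioms s, of "\<iota> (\<beta> (f p) (g p)) - \<iota> (\<beta> (f' p) (g' p))"] by simp
  qed
  ultimately show "((\<lambda>p. u (\<iota> (\<beta> (f p) (g p)) - \<iota> (\<beta> (f' p) (g' p)) - 0)) \<longlongrightarrow> 0) G"
    by (rule Lim_null_comparison[rotated])
qed

text \<open>One limit serves all approximations: it exists along the product of the two trace
  filters, and every pair of approximating families factors through that product.\<close>

lemma bilinear_tendsto_ex:
  assumes b: "bilinear_on \<beta>" "bounded_on \<beta>"
  shows "\<exists>l. \<forall>f g (G :: ('t \<times> 't) filter). filterlim f (nhds_trace a) G \<longrightarrow> filterlim g (nhds_trace b) G \<longrightarrow>
     ((\<lambda>p. \<iota> (\<beta> (f p) (g p))) \<longlongrightarrow> l) G"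
proof -
  let ?G = "nhds_trace a \<times>\<^sub>F nhds_trace b"
  have "((\<lambda>p. \<iota> (\<beta> (fst (fst p)) (snd (fst p))) - \<iota> (\<beta> (fst (snd p)) (snd (snd p)))) \<longlongrightarrow> 0) (?G \<times>\<^sub>F ?G)"
    by (rule bilinear_difference_tendsto_0[OF b, of _ a _ _ _ b])
      (rule filterlim_compose[OF filterlim_fst] filterlim_compose[OF filterlim_snd]
        filterlim_fst filterlim_snd)+
  from convergent_if_differences_vanish[where f = "\<lambda>p. \<iota> (\<beta> (fst p) (snd p))", OF this]
  obtain l where l: "((\<lambda>p. \<iota> (\<beta> (fst p) (snd p))) \<longlongrightarrow> l) ?G" by blast
  have "((\<lambda>p. \<iota> (\<beta> (f p) (g p))) \<longlongrightarrow> l) G"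
    if "filterlim f (nhds_trace a) G" "filterlim g (nhds_trace b) G" for f g and G :: "('t \<times> 't) filter"
    using filterlim_compose[OF l filterlim_Pair[OF that]] by simp
  then show ?thesis by blast
qed

definition bilinear_ext :: "('t \<Rightarrow> 't \<Rightarrow> 't) \<Rightarrow> 'w \<Rightarrow> 'w \<Rightarrow> 'w" where
  "bilinear_ext \<beta> a b = Lim (nhds_trace a \<times>\<^sub>F nhds_trace b) (\<lambda>p. \<iota> (\<beta> (fst p) (snd p)))"

context
  fixes \<beta> assumes b: "bilinear_on \<beta>" "bounded_on \<beta>"
begin

lemma bilinear_ext_tendsto:
  assumes "filterlim f (nhds_trace a) G" "filterlim g (nhds_trace b) G"
  shows "((\<lambda>p. \<iota> (\<beta> (f p) (g p))) \<longlongrightarrow> bilinear_ext \<beta> a b) G"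
proof -
  let ?G = "nhds_trace a \<times>\<^sub>F nhds_trace b"
  obtain l where "((\<lambda>p. \<iota> (\<beta> (fst p) (snd p))) \<longlongrightarrow> l) ?G"
    using bilinear_tendsto_ex[OF b, of a b] filterlim_fst filterlim_snd by blast
  then have "((\<lambda>p. \<iota> (\<beta> (fst p) (snd p))) \<longlongrightarrow> bilinear_ext \<beta> a b) ?G"
    using tendsto_Lim[of ?G _ l] by (simp add: prod_filter_eq_bot nhds_trace_neq_bot bilinear_ext_def)
  from filterlim_compose[OF this filterlim_Pair[OF assms]] show ?thesis by simp
qed

lemma bilinear_ext_add_left: "bilinear_ext \<beta> (a + a') c = bilinear_ext \<beta> a c + bilinear_ext \<beta> a' c"
proof (rule tendsto_unique)
  let ?G = "(nhds_trace a \<times>\<^sub>F nhds_trace a') \<times>\<^sub>F nhds_trace c"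
  show "?G \<noteq> bot" by (simp add: prod_filter_eq_bot nhds_trace_neq_bot)
  have l: "filterlim (\<lambda>p. fst (fst p)) (nhds_trace a) ?G" "filterlim (\<lambda>p. snd (fst p)) (nhds_trace a') ?G" "filterlim snd (nhds_trace c) ?G"
    by (rule filterlim_compose[OF filterlim_fst] filterlim_compose[OF filterlim_snd] filterlim_fst filterlim_snd)+
  show "((\<lambda>p. \<iota> (\<beta> (fst (fst p) + snd (fst p)) (snd p))) \<longlongrightarrow> bilinear_ext \<beta> (a + a') c) ?G"
    by (intro bilinear_ext_tendsto filterlim_nhds_trace_add l)
  have "((\<lambda>p. \<iota> (\<beta> (fst (fst p)) (snd p)) + \<iota> (\<beta> (snd (fst p)) (snd p))) \<longlongrightarrow>
      bilinear_ext \<beta> a c + bilinear_ext \<beta> a' c) ?G"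
    by (intro tendsto_add bilinear_ext_tendsto l)
  moreover have "\<forall>\<^sub>F p in ?G. fst (fst p) \<in> S \<and> snd (fst p) \<in> S \<and> snd p \<in> S"
    using l by (auto simp: filterlim_nhds_trace eventually_conj_iff)
  then have "\<forall>\<^sub>F p in ?G. \<iota> (\<beta> (fst (fst p)) (snd p)) + \<iota> (\<beta> (snd (fst p)) (snd p)) =
      \<iota> (\<beta> (fst (fst p) + snd (fst p)) (snd p))"
    by eventually_elim (use b(1) in \<open>simp add: bilinear_on_def iota_add\<close>)
  ultimately show "((\<lambda>p. \<iota> (\<beta> (fst (fst p) + snd (fst p)) (snd p))) \<longlongrightarrow>
      bilinear_ext \<beta> a c + bilinear_ext \<beta> a' c) ?G"
    by (rule Lim_transform_eventually)
qed

lemma bilinear_ext_scale_left: "bilinear_ext \<beta> (scl' c a) d = scl' c (bilinear_ext \<beta> a d)"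
proof (rule tendsto_unique)
  let ?G = "nhds_trace a \<times>\<^sub>F nhds_trace d"
  show "?G \<noteq> bot" by (simp add: prod_filter_eq_bot nhds_trace_neq_bot)
  show "((\<lambda>p. \<iota> (\<beta> (scl c (fst p)) (snd p))) \<longlongrightarrow> bilinear_ext \<beta> (scl' c a) d) ?G"
    by (intro bilinear_ext_tendsto filterlim_nhds_trace_scale filterlim_fst filterlim_snd)
  have "((\<lambda>p. scl' c (\<iota> (\<beta> (fst p) (snd p)))) \<longlongrightarrow> scl' c (bilinear_ext \<beta> a d)) ?G"
    by (intro tendsto_scale bilinear_ext_tendsto filterlim_fst filterlim_snd)
  moreover have "\<forall>\<^sub>F p in ?G. fst p \<in> S \<and> snd p \<in> S"
    using filterlim_fst[of "nhds_trace a" "nhds_trace d"] filterlim_snd[of "nhds_trace d" "nhds_trace a"]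
    by (auto simp: filterlim_nhds_trace eventually_conj_iff)
  then have "\<forall>\<^sub>F p in ?G. scl' c (\<iota> (\<beta> (fst p) (snd p))) = \<iota> (\<beta> (scl c (fst p)) (snd p))"
    by eventually_elim (use b(1) in \<open>simp add: bilinear_on_def iota_scale\<close>)
  ultimately show "((\<lambda>p. \<iota> (\<beta> (scl c (fst p)) (snd p))) \<longlongrightarrow> scl' c (bilinear_ext \<beta> a d)) ?G"
    by (rule Lim_transform_eventually)
qed

lemma bilinear_ext_iota: "x \<in> S \<Longrightarrow> y \<in> S \<Longrightarrow> bilinear_ext \<beta> (\<iota> x) (\<iota> y) = \<iota> (\<beta> x y)"
  using bilinear_ext_tendsto[of "\<lambda>_. x" "\<iota> x" "nhds_trace 0" "\<lambda>_. y" "\<iota> y"]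
  by (simp add: filterlim_nhds_trace_iota tendsto_const_iff nhds_trace_neq_bot)

lemma bilinear_ext_bound:
  assumes u: "continuous_seminorm scl' u" and q: "q \<in> Q"
    and bd: "\<And>x y. x \<in> S \<Longrightarrow> y \<in> S \<Longrightarrow> u (\<iota> (\<beta> x y)) \<le> C * (q x * q y)"
  shows "u (bilinear_ext \<beta> a c) \<le> C * (ext_seminorm q a * ext_seminorm q c)"
proof (rule tendsto_le)
  let ?G = "nhds_trace a \<times>\<^sub>F nhds_trace c"
  show "?G \<noteq> bot" by (simp add: prod_filter_eq_bot nhds_trace_neq_bot)
  show "((\<lambda>p. C * (q (fst p) * q (snd p))) \<longlongrightarrow> C * (ext_seminorm q a * ext_seminorm q c)) ?G"
    by (intro tendsto_intros ext_seminorm_tendsto[OF q] filterlim_fst filterlim_snd)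
  have "((\<lambda>p. \<iota> (\<beta> (fst p) (snd p))) \<longlongrightarrow> bilinear_ext \<beta> a c) ?G"
    by (intro bilinear_ext_tendsto filterlim_fst filterlim_snd)
  then show "((\<lambda>p. u (\<iota> (\<beta> (fst p) (snd p)))) \<longlongrightarrow> u (bilinear_ext \<beta> a c)) ?G"
    using u by (intro continuous_on_tendsto_compose[of UNIV u]) (auto simp: continuous_seminorm_def)
  show "\<forall>\<^sub>F p in ?G. u (\<iota> (\<beta> (fst p) (snd p))) \<le> C * (q (fst p) * q (snd p))"
    unfolding eventually_prod_filter
    by (intro exI[of _ "\<lambda>x. x \<in> S"]) (auto simp: bd eventually_nhds_trace_in)
qed

end

lemma bilinear_on_flip: "bilinear_on \<beta> \<Longrightarrow> bilinear_on (\<lambda>x y. \<beta> y x)"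
  by (auto simp: bilinear_on_def)

lemma bounded_on_flip:
  assumes "bounded_on \<beta>" shows "bounded_on (\<lambda>x y. \<beta> y x)"
  unfolding bounded_on_def
proof
  fix q assume "q \<in> Q"
  then obtain q' C where q': "q' \<in> Q" "C \<ge> 0" "\<forall>x\<in>S. \<forall>y\<in>S. q (\<beta> x y) \<le> C * (q' x * q' y)"
    using bspec[OF assms[unfolded bounded_on_def]] by blast
  have "q (\<beta> y x) \<le> C * (q' x * q' y)" if "x \<in> S" "y \<in> S" for x y
    using q'(3) that by (subst mult.commute[of "q' x"]) blast
  then show "\<exists>q'\<in>Q. \<exists>C\<ge>0. \<forall>x\<in>S. \<forall>y\<in>S. q (\<beta> y x) \<le> C * (q' x * q' y)"
    using q'(1,2) by blast
qed

text \<open>Exchanging the arguments makes each fact about the first argument available for the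
  second.\<close>

lemma bilinear_ext_flip:
  assumes b: "bilinear_on \<beta>" "bounded_on \<beta>"
  shows "bilinear_ext \<beta> a c = bilinear_ext (\<lambda>x y. \<beta> y x) c a"
proof (rule tendsto_unique)
  let ?G = "nhds_trace a \<times>\<^sub>F nhds_trace c"
  show "?G \<noteq> bot" by (simp add: prod_filter_eq_bot nhds_trace_neq_bot)
  show "((\<lambda>p. \<iota> (\<beta> (fst p) (snd p))) \<longlongrightarrow> bilinear_ext \<beta> a c) ?G"
    by (intro bilinear_ext_tendsto b filterlim_fst filterlim_snd)
  show "((\<lambda>p. \<iota> (\<beta> (fst p) (snd p))) \<longlongrightarrow> bilinear_ext (\<lambda>x y. \<beta> y x) c a) ?G"
    by (rule bilinear_ext_tendsto[OF bilinear_on_flip[OF b(1)] bounded_on_flip[OF b(2)]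
          filterlim_snd filterlim_fst])
qed

text \<open>The same telescoping as on \<open>S\<close>, now with the extended seminorms around an
  arbitrary point of the completion.\<close>

lemma bilinear_ext_continuous:
  assumes b: "bilinear_on \<beta>" "bounded_on \<beta>"
  shows "continuous_on UNIV (\<lambda>(a, c). bilinear_ext \<beta> a c)"
proof -
  note fb = bilinear_on_flip[OF b(1)] bounded_on_flip[OF b(2)]
  let ?B = "bilinear_ext \<beta>"
  have add_l: "?B (a + a') c = ?B a c + ?B a' c" for a a' c by (rule bilinear_ext_add_left[OF b])
  have add_r: "?B a (c + c') = ?B a c + ?B a c'" for a c c'
    unfolding bilinear_ext_flip[OF b] by (rule bilinear_ext_add_left[OF fb])
  have "((\<lambda>p. ?B (fst p) (snd p)) \<longlongrightarrow> ?B a c) (nhds a \<times>\<^sub>F nhds c)" for a c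
    unfolding W.tendsto_iff_seminorms
  proof (intro allI impI)
    fix u assume u: "continuous_seminorm scl' u"
    then have s: "seminorm scl' u" by (simp add: continuous_seminorm_def)
    obtain q C where q: "q \<in> Q" "C \<ge> 0" "\<And>x y. x \<in> S \<Longrightarrow> y \<in> S \<Longrightarrow> u (\<iota> (\<beta> x y)) \<le> C * (q x * q y)"
      using bounded_on_seminorm[OF b(2) u b(1)] by blast
    note bd = bilinear_ext_bound[OF b u q(1) q(3)]
    let ?q = "ext_seminorm q" and ?G = "nhds a \<times>\<^sub>F nhds c"
    have l: "(fst \<longlongrightarrow> a) ?G" "(snd \<longlongrightarrow> c) ?G" by (rule filterlim_fst filterlim_snd)+
    have "((\<lambda>p. C * (?q (fst p - a) * ?q (snd p)) + C * (?q a * ?q (snd p - c))) \<longlongrightarrow>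
        C * (?q (a - a) * ?q c) + C * (?q a * ?q (c - c))) ?G"
      by (intro tendsto_intros ext_seminorm_continuous[OF q(1)] l)
    then have "((\<lambda>p. C * (?q (fst p - a) * ?q (snd p)) + C * (?q a * ?q (snd p - c))) \<longlongrightarrow> 0) ?G"
      by (simp add: ext_seminorm_0[OF q(1)])
    moreover have "norm (u (?B (fst p) (snd p) - ?B a c)) \<le>
        C * (?q (fst p - a) * ?q (snd p)) + C * (?q a * ?q (snd p - c))" for p
    proof -
      have "?B (fst p) (snd p) - ?B a c = ?B (fst p - a) (snd p) + ?B a (snd p - c)"
        using add_l[of "fst p - a" a "snd p"] add_r[of a "snd p - c" c] by simp
      then have "u (?B (fst p) (snd p) - ?B a c) \<le> u (?B (fst p - a) (snd p)) + u (?B a (snd p - c))"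
        using s by (simp add: seminorm_def)
      also have "\<dots> \<le> C * (?q (fst p - a) * ?q (snd p)) + C * (?q a * ?q (snd p - c))"
        by (intro add_mono bd)
      finally show ?thesis using seminorm_nonneg[OF W.vector_space_axioms s] by simp
    qed
    then have "\<forall>\<^sub>F p in ?G. norm (u (?B (fst p) (snd p) - ?B a c)) \<le>
        C * (?q (fst p - a) * ?q (snd p)) + C * (?q a * ?q (snd p - c))" by simp
    ultimately show "((\<lambda>p. u (?B (fst p) (snd p) - ?B a c)) \<longlongrightarrow> 0) ?G"
      by (rule Lim_null_comparison[rotated])
  qed
  then have lim: "((\<lambda>p. ?B (fst p) (snd p)) \<longlongrightarrow> ?B a c) (nhds (a, c))" for a c
    by (simp only: nhds_prod)
  have "isCont (\<lambda>p. ?B (fst p) (snd p)) p" for p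
    using tendsto_mono[OF at_within_le_nhds lim[of "fst p" "snd p"]]
    by (simp only: isCont_def prod.collapse)
  then show ?thesis by (simp only: continuous_on_eq_continuous_at open_UNIV case_prod_unfold ball_UNIV simp_thms)
qed

text \<open>\<open>cont_ext\<close> is a definite description, so existence and uniqueness are both
  due. A continuous competitor agrees with \<open>bilinear_ext\<close> because both are limits of
  the same values on \<open>S\<close>.\<close>

lemma cont_ext_eq:
  assumes b: "bilinear_on \<beta>" "bounded_on \<beta>"
  shows "cont_ext scl' S \<iota> \<beta> = bilinear_ext \<beta>"
  unfolding cont_ext_def
proof (rule the_equality)
  note fb = bilinear_on_flip[OF b(1)] bounded_on_flip[OF b(2)]
  show "(\<forall>a. Vector_Spaces.linear scl' scl' (bilinear_ext \<beta> a)) \<and>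
        (\<forall>c. Vector_Spaces.linear scl' scl' (\<lambda>a. bilinear_ext \<beta> a c)) \<and>
        continuous_on UNIV (\<lambda>(a, c). bilinear_ext \<beta> a c) \<and>
        (\<forall>x\<in>S. \<forall>y\<in>S. bilinear_ext \<beta> (\<iota> x) (\<iota> y) = \<iota> (\<beta> x y))"
  proof (intro conjI allI ballI)
    show "Vector_Spaces.linear scl' scl' (bilinear_ext \<beta> a)" for a
      unfolding Vector_Spaces.linear_iff bilinear_ext_flip[OF b]
      by (simp add: W.vector_space_axioms bilinear_ext_add_left[OF fb] bilinear_ext_scale_left[OF fb])
    show "Vector_Spaces.linear scl' scl' (\<lambda>a. bilinear_ext \<beta> a c)" for c
      unfolding Vector_Spaces.linear_iff
      by (simp add: W.vector_space_axioms bilinear_ext_add_left[OF b] bilinear_ext_scale_left[OF b])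
  qed (use bilinear_ext_continuous[OF b] bilinear_ext_iota[OF b] in auto)
next
  fix B assume B: "(\<forall>a. Vector_Spaces.linear scl' scl' (B a)) \<and>
        (\<forall>c. Vector_Spaces.linear scl' scl' (\<lambda>a. B a c)) \<and>
        continuous_on UNIV (\<lambda>(a, c). B a c) \<and>
        (\<forall>x\<in>S. \<forall>y\<in>S. B (\<iota> x) (\<iota> y) = \<iota> (\<beta> x y))"
  then have cont: "continuous_on UNIV (\<lambda>(a, c). B a c)"
    and eq: "\<And>x y. x \<in> S \<Longrightarrow> y \<in> S \<Longrightarrow> B (\<iota> x) (\<iota> y) = \<iota> (\<beta> x y)"
    by blast+
  show "B = bilinear_ext \<beta>"
  proof (intro ext tendsto_unique)
    fix a c
    let ?G = "nhds_trace a \<times>\<^sub>F nhds_trace c"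
    show "?G \<noteq> bot" by (simp add: prod_filter_eq_bot nhds_trace_neq_bot)
    show "((\<lambda>p. \<iota> (\<beta> (fst p) (snd p))) \<longlongrightarrow> bilinear_ext \<beta> a c) ?G"
      by (intro bilinear_ext_tendsto b filterlim_fst filterlim_snd)
    have l: "((\<lambda>p. \<iota> (fst p)) \<longlongrightarrow> a) ?G" "((\<lambda>p. \<iota> (snd p)) \<longlongrightarrow> c) ?G"
      "\<forall>\<^sub>F p in ?G. fst p \<in> S \<and> snd p \<in> S"
      using filterlim_fst[of "nhds_trace a" "nhds_trace c"] filterlim_snd[of "nhds_trace c" "nhds_trace a"]
      by (auto simp: filterlim_nhds_trace eventually_conj_iff)
    have "((\<lambda>p. (\<lambda>(a, c). B a c) (\<iota> (fst p), \<iota> (snd p))) \<longlongrightarrow> (\<lambda>(a, c). B a c) (a, c)) ?G"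
      by (rule continuous_on_tendsto_compose[OF cont tendsto_Pair[OF l(1,2)]]) simp_all
    then have "((\<lambda>p. B (\<iota> (fst p)) (\<iota> (snd p))) \<longlongrightarrow> B a c) ?G" by (simp only: prod.case)
    moreover have "\<forall>\<^sub>F p in ?G. B (\<iota> (fst p)) (\<iota> (snd p)) = \<iota> (\<beta> (fst p) (snd p))"
      using l(3) by eventually_elim (simp add: eq)
    ultimately show "((\<lambda>p. \<iota> (\<beta> (fst p) (snd p))) \<longlongrightarrow> B a c) ?G"
      by (rule Lim_transform_eventually)
  qed
qed

text \<open>Since \<open>q'\<close> is chosen before \<open>k\<close>, all terms and all tails are
  bounded on \<open>S\<close> by a number times the same product \<open>q' x * q' y\<close>, and
  such a bound survives passage to the limit. The sum \<open>st\<close> is finite at each pair, but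
  its length may depend on the pair, so its continuity rests on this uniform bound too.\<close>

lemma converges_absolutely_bilinear_series:
  assumes bilin: "\<And>k. bilinear_on (\<beta> k)"
    and D: "\<And>k. D k > 0" and summable: "summable (\<lambda>k. norm (c k) / D k)"
    and bound: "\<And>q. q \<in> Q \<Longrightarrow> \<exists>q'\<in>Q. \<forall>k. \<forall>x\<in>S. \<forall>y\<in>S. D k * q (\<beta> k x y) \<le> q' x * q' y"
    and st: "\<And>x y. x \<in> S \<Longrightarrow> y \<in> S \<Longrightarrow>
      \<forall>\<^sub>F N in sequentially. st x y = (\<Sum>k<N. scl (c k) (\<beta> k x y))"
  shows "converges_absolutely_to scl' (\<lambda>k. scl' (c k) (cont_ext scl' S \<iota> (\<beta> k) a b))
     (cont_ext scl' S \<iota> st a b)"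
proof -
  define f where "f k = norm (c k) / D k" for k
  have f_nonneg: "0 \<le> f k" for k using D[of k] by (simp add: f_def)
  have sf: "summable f" using summable by (simp add: f_def[abs_def])
  \<comment> \<open>Dominates every finite block of \<open>f\<close> that starts at
    \<open>K\<close>, whatever its length.\<close>
  define T where "T K = suminf f - sum f {..<K}" for K
  have T: "T \<longlonglongrightarrow> 0"
    using tendsto_diff[OF tendsto_const[of "suminf f"] summable_LIMSEQ[OF sf]]
    by (simp add: T_def[abs_def])
  have sum_T: "sum f {K..<N} \<le> T K" if "K \<le> N" for K N
    using sum_le_suminf[OF sf, of "{..<N}"] f_nonneg sum.atLeastLessThan_concat[of 0 K N f] that
    by (simp add: T_def lessThan_atLeast0)
  have \<beta>_S: "\<beta> k x y \<in> S" if "x \<in> S" "y \<in> S" for k x y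
    using bilin[of k] that by (simp add: bilinear_on_def)
  have term_S: "scl (c k) (\<beta> k x y) \<in> S" if "x \<in> S" "y \<in> S" for k x y
    using \<beta>_S[OF that] by (rule S_closed)
  have st_S: "st x y \<in> S" if S: "x \<in> S" "y \<in> S" for x y
  proof -
    obtain N where "st x y = (\<Sum>k<N. scl (c k) (\<beta> k x y))"
      using eventually_happens'[OF sequentially_bot st[OF S]] by blast
    then show ?thesis using term_S[OF S] by (simp add: subspace_sum[OF S_subspace])
  qed
  have \<beta>_bound: "q (\<beta> k x y) \<le> 1 / D k * (q' x * q' y)"
    if "\<forall>k. \<forall>x\<in>S. \<forall>y\<in>S. D k * q (\<beta> k x y) \<le> q' x * q' y" "x \<in> S" "y \<in> S" for q q' k x y
    using that D[of k] by (simp add: field_simps)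
  have bdd: "bounded_on (\<beta> k)" for k
    unfolding bounded_on_def
  proof
    fix q assume "q \<in> Q"
    then obtain q' where q': "q' \<in> Q" "\<forall>k. \<forall>x\<in>S. \<forall>y\<in>S. D k * q (\<beta> k x y) \<le> q' x * q' y"
      using bound by blast
    show "\<exists>q'\<in>Q. \<exists>C\<ge>0. \<forall>x\<in>S. \<forall>y\<in>S. q (\<beta> k x y) \<le> C * (q' x * q' y)"
      using D[of k] \<beta>_bound[OF q'(2)] by (intro bexI[OF _ q'(1)] exI[of _ "1 / D k"] conjI ballI) auto
  qed
  \<comment> \<open>The block from \<open>K\<close> to \<open>N\<close> is estimated independently
    of \<open>N\<close>, so the pair enters only through \<open>q' x * q' y\<close>.\<close>
  have tail: "q (st x y - (\<Sum>k<K. scl (c k) (\<beta> k x y))) \<le> T K * (q' x * q' y)"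
    if q: "q \<in> Q" "q' \<in> Q" "\<forall>k. \<forall>x\<in>S. \<forall>y\<in>S. D k * q (\<beta> k x y) \<le> q' x * q' y"
      and S: "x \<in> S" "y \<in> S" for q q' K x y
  proof -
    obtain N where N: "N \<ge> K" "st x y = (\<Sum>k<N. scl (c k) (\<beta> k x y))"
      using eventually_happens'[OF sequentially_bot eventually_conj[OF st[OF S] eventually_ge_at_top[of K]]]
      by blast
    have sub: "q (sum g I) \<le> (\<Sum>i\<in>I. q (g i))" if "\<And>i. i \<in> I \<Longrightarrow> g i \<in> S" for g and I :: "nat set"
      using that
    proof (induction I rule: infinite_finite_induct)
      case (insert i I)
      then have "q (g i + sum g I) \<le> q (g i) + q (sum g I)"
        by (intro Q_add q subspace_sum[OF S_subspace]) auto
      then show ?case using insert by fastforce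
    qed (simp_all add: Q_zero[OF q(1)])
    have "st x y - (\<Sum>k<K. scl (c k) (\<beta> k x y)) = (\<Sum>k\<in>{K..<N}. scl (c k) (\<beta> k x y))"
      using N sum.atLeastLessThan_concat[of 0 K N "\<lambda>k. scl (c k) (\<beta> k x y)"]
      by (simp add: lessThan_atLeast0 algebra_simps)
    then have "q (st x y - (\<Sum>k<K. scl (c k) (\<beta> k x y))) \<le> (\<Sum>k\<in>{K..<N}. q (scl (c k) (\<beta> k x y)))"
      using sub[of "{K..<N}" "\<lambda>k. scl (c k) (\<beta> k x y)"] term_S[OF S] by simp
    also have "\<dots> \<le> (\<Sum>k\<in>{K..<N}. f k * (q' x * q' y))"
    proof (rule sum_mono)
      fix k
      have "norm (c k) * q (\<beta> k x y) \<le> norm (c k) * (1 / D k * (q' x * q' y))"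
        by (intro mult_left_mono \<beta>_bound q(3) S) simp
      then show "q (scl (c k) (\<beta> k x y)) \<le> f k * (q' x * q' y)"
        by (simp add: Q_scale[OF q(1) \<beta>_S[OF S]] f_def)
    qed
    also have "\<dots> = sum f {K..<N} * (q' x * q' y)" by (simp add: sum_distrib_right)
    also have "\<dots> \<le> T K * (q' x * q' y)"
      using Q_nonneg[OF q(2)] S by (intro mult_right_mono sum_T N) auto
    finally show ?thesis .
  qed
  \<comment> \<open>This is \<open>tail\<close> with \<open>K = 0\<close>.\<close>
  have st_bdd: "bounded_on st"
    unfolding bounded_on_def
  proof
    fix q assume q: "q \<in> Q"
    then obtain q' where q': "q' \<in> Q" "\<forall>k. \<forall>x\<in>S. \<forall>y\<in>S. D k * q (\<beta> k x y) \<le> q' x * q' y"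
      using bound by blast
    have "T 0 \<ge> 0" using suminf_nonneg[OF sf f_nonneg] by (simp add: T_def)
    then show "\<exists>q'\<in>Q. \<exists>C\<ge>0. \<forall>x\<in>S. \<forall>y\<in>S. q (st x y) \<le> C * (q' x * q' y)"
      using tail[OF q q', of _ _ 0] by (intro bexI[OF _ q'(1)] exI[of _ "T 0"] conjI ballI) auto
  qed
  \<comment> \<open>Inherited from the partial sums: from some \<open>N\<close> on, all values of
    \<open>st\<close> involved are sums of the same length, and the resulting equation no longer
    contains \<open>N\<close>.\<close>
  have st_bilin: "bilinear_on st"
    unfolding bilinear_on_def
  proof (intro ballI conjI allI)
    fix x y assume S: "x \<in> S" "y \<in> S"
    show "st x y \<in> S" by (rule st_S[OF S])
    show "st (x + x') y = st x y + st x' y" if x': "x' \<in> S" for x'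
    proof -
      have "\<forall>\<^sub>F N in sequentially. st (x + x') y = st x y + st x' y"
        using st[OF S] st[OF x' S(2)] st[OF S_closed(2)[OF S(1) x'] S(2)]
      proof eventually_elim
        case (elim N)
        have "\<beta> k (x + x') y = \<beta> k x y + \<beta> k x' y" for k
          using bilin[of k] S x' by (simp add: bilinear_on_def)
        then show ?case using elim by (simp add: scale_right_distrib sum.distrib)
      qed
      then show ?thesis by simp
    qed
    show "st x (y + y') = st x y + st x y'" if y': "y' \<in> S" for y'
    proof -
      have "\<forall>\<^sub>F N in sequentially. st x (y + y') = st x y + st x y'"
        using st[OF S] st[OF S(1) y'] st[OF S(1) S_closed(2)[OF S(2) y']]
      proof eventually_elim
        case (elim N)
        have "\<beta> k x (y + y') = \<beta> k x y + \<beta> k x y'" for k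
          using bilin[of k] S y' by (simp add: bilinear_on_def)
        then show ?case using elim by (simp add: scale_right_distrib sum.distrib)
      qed
      then show ?thesis by simp
    qed
    show "st (scl d x) y = scl d (st x y)" for d
    proof -
      have "\<forall>\<^sub>F N in sequentially. st (scl d x) y = scl d (st x y)"
        using st[OF S] st[OF S_closed(4)[OF S(1)] S(2), of d]
      proof eventually_elim
        case (elim N)
        have "\<beta> k (scl d x) y = scl d (\<beta> k x y)" for k
          using bilin[of k] S by (simp add: bilinear_on_def)
        then show ?case using elim by (simp add: scale_sum_right mult.commute)
      qed
      then show ?thesis by simp
    qed
    show "st x (scl d y) = scl d (st x y)" for d
    proof -
      have "\<forall>\<^sub>F N in sequentially. st x (scl d y) = scl d (st x y)"
        using st[OF S] st[OF S(1) S_closed(4)[OF S(2)], of d]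
      proof eventually_elim
        case (elim N)
        have "\<beta> k x (scl d y) = scl d (\<beta> k x y)" for k
          using bilin[of k] S by (simp add: bilinear_on_def)
        then show ?case using elim by (simp add: scale_sum_right mult.commute)
      qed
      then show ?thesis by simp
    qed
  qed
  let ?B = "\<lambda>k. bilinear_ext (\<beta> k) a b" and ?G = "nhds_trace a \<times>\<^sub>F nhds_trace b"
  \<comment> \<open>One constant \<open>M\<close> controls the terms by \<open>f k\<close> and the
    remainders by \<open>T K\<close>. The first bound gives absolute convergence, the second
    identifies the sum.\<close>
  have est: "\<exists>M\<ge>0. (\<forall>k. u (scl' (c k) (?B k)) \<le> M * f k) \<and>
      (\<forall>K. u (bilinear_ext st a b - (\<Sum>k<K. scl' (c k) (?B k))) \<le> M * T K)"
    if u: "continuous_seminorm scl' u" for u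
  proof -
    have us: "u (scl' c x) = norm c * u x" for c x
      using u by (simp add: continuous_seminorm_def seminorm_def)
    obtain q C where q: "q \<in> Q" "C > 0" "\<And>x. x \<in> S \<Longrightarrow> u (\<iota> x) \<le> C * q x"
      using continuous_seminorm_dominated[OF u] by blast
    obtain q' where q': "q' \<in> Q" "\<forall>k. \<forall>x\<in>S. \<forall>y\<in>S. D k * q (\<beta> k x y) \<le> q' x * q' y"
      using bound q(1) by blast
    define M where "M = C * (ext_seminorm q' a * ext_seminorm q' b)"
    have "M \<ge> 0" using q(2) ext_seminorm_nonneg[OF q'(1)] by (simp add: M_def)
    moreover have "u (scl' (c k) (?B k)) \<le> M * f k" for k
    proof -
      have "u (?B k) \<le> C / D k * (ext_seminorm q' a * ext_seminorm q' b)"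
      proof (rule bilinear_ext_bound[OF bilin bdd u q'(1)])
        fix x y assume S: "x \<in> S" "y \<in> S"
        have "u (\<iota> (\<beta> k x y)) \<le> C * q (\<beta> k x y)" by (rule q(3)[OF \<beta>_S[OF S]])
        also have "\<dots> \<le> C * (1 / D k * (q' x * q' y))"
          using q(2) by (intro mult_left_mono \<beta>_bound q'(2) S) simp
        finally show "u (\<iota> (\<beta> k x y)) \<le> C / D k * (q' x * q' y)" by simp
      qed
      then have "norm (c k) * u (?B k) \<le> norm (c k) * (C / D k * (ext_seminorm q' a * ext_seminorm q' b))"
        by (rule mult_left_mono) simp
      then show ?thesis by (simp add: us M_def f_def mult_ac)
    qed
    moreover have "u (bilinear_ext st a b - (\<Sum>k<K. scl' (c k) (?B k))) \<le> M * T K" for K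
    proof (rule tendsto_le)
      show "?G \<noteq> bot" by (simp add: prod_filter_eq_bot nhds_trace_neq_bot)
      have "((\<lambda>p. C * (T K * (q' (fst p) * q' (snd p)))) \<longlongrightarrow>
          C * (T K * (ext_seminorm q' a * ext_seminorm q' b))) ?G"
        by (intro tendsto_mult_left tendsto_mult[OF ext_seminorm_tendsto[OF q'(1) filterlim_fst]
              ext_seminorm_tendsto[OF q'(1) filterlim_snd]])
      then show "((\<lambda>p. C * (T K * (q' (fst p) * q' (snd p)))) \<longlongrightarrow> M * T K) ?G"
        by (simp add: M_def mult_ac)
      have lims: "((\<lambda>p. \<iota> (st (fst p) (snd p))) \<longlongrightarrow> bilinear_ext st a b) ?G"
        "((\<lambda>p. \<iota> (\<beta> k (fst p) (snd p))) \<longlongrightarrow> ?B k) ?G" for k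
        by (rule bilinear_ext_tendsto[OF st_bilin st_bdd filterlim_fst filterlim_snd]
            bilinear_ext_tendsto[OF bilin bdd filterlim_fst filterlim_snd])+
      have "((\<lambda>p. \<iota> (st (fst p) (snd p)) - (\<Sum>k<K. scl' (c k) (\<iota> (\<beta> k (fst p) (snd p))))) \<longlongrightarrow>
          bilinear_ext st a b - (\<Sum>k<K. scl' (c k) (?B k))) ?G"
        by (intro tendsto_diff tendsto_sum tendsto_scale lims)
      then show "((\<lambda>p. u (\<iota> (st (fst p) (snd p)) - (\<Sum>k<K. scl' (c k) (\<iota> (\<beta> k (fst p) (snd p)))))) \<longlongrightarrow>
          u (bilinear_ext st a b - (\<Sum>k<K. scl' (c k) (?B k)))) ?G"
        by (rule continuous_on_tendsto_compose[of UNIV u, rotated])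
          (use u in \<open>simp_all add: continuous_seminorm_def\<close>)
      have "u (\<iota> (st x y) - (\<Sum>k<K. scl' (c k) (\<iota> (\<beta> k x y)))) \<le> C * (T K * (q' x * q' y))"
        if S: "x \<in> S" "y \<in> S" for x y
      proof -
        let ?d = "st x y - (\<Sum>k<K. scl (c k) (\<beta> k x y))"
        have sumS: "(\<Sum>k<K. scl (c k) (\<beta> k x y)) \<in> S"
          by (rule subspace_sum[OF S_subspace]) (rule term_S[OF S])
        have "\<iota> ?d = \<iota> (st x y) - (\<Sum>k<K. scl' (c k) (\<iota> (\<beta> k x y)))"
          using iota_diff[OF st_S[OF S] sumS] iota_sum[of "{..<K}" "\<lambda>k. scl (c k) (\<beta> k x y)"]
          by (simp add: term_S[OF S] iota_scale[OF \<beta>_S[OF S]])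
        moreover have "u (\<iota> ?d) \<le> C * q ?d"
          by (rule q(3)[OF S_closed(3)[OF st_S[OF S] sumS]])
        moreover have "C * q ?d \<le> C * (T K * (q' x * q' y))"
          using q(2) by (intro mult_left_mono tail q(1) q' S) simp
        ultimately show ?thesis by simp
      qed
      then show "\<forall>\<^sub>F p in ?G. u (\<iota> (st (fst p) (snd p)) - (\<Sum>k<K. scl' (c k) (\<iota> (\<beta> k (fst p) (snd p)))))
          \<le> C * (T K * (q' (fst p) * q' (snd p)))"
        unfolding eventually_prod_filter
        by (intro exI[of _ "\<lambda>x. x \<in> S"]) (auto simp: eventually_nhds_trace_in)
    qed
    ultimately show ?thesis by blast
  qed
  have "(\<lambda>k. scl' (c k) (?B k)) sums bilinear_ext st a b"
    unfolding sums_def W.tendsto_iff_seminorms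
  proof (intro allI impI)
    fix u assume u: "continuous_seminorm scl' u"
    then have s: "seminorm scl' u" by (simp add: continuous_seminorm_def)
    obtain M where M: "\<And>K. u (bilinear_ext st a b - (\<Sum>k<K. scl' (c k) (?B k))) \<le> M * T K"
      using est[OF u] by blast
    have "(\<lambda>K. M * T K) \<longlonglongrightarrow> 0" using tendsto_mult_right_zero[OF T] by simp
    moreover have "\<forall>\<^sub>F K in sequentially. norm (u ((\<Sum>k<K. scl' (c k) (?B k)) - bilinear_ext st a b)) \<le> M * T K"
      using M by (simp add: seminorm_nonneg[OF W.vector_space_axioms s]
          seminorm_minus_commute[OF W.vector_space_axioms s, of _ "bilinear_ext st a b"])
    ultimately show "(\<lambda>K. u ((\<Sum>k<K. scl' (c k) (?B k)) - bilinear_ext st a b)) \<longlonglongrightarrow> 0"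
      by (rule Lim_null_comparison[rotated])
  qed
  moreover have "summable (\<lambda>k. u (scl' (c k) (?B k)))" if u: "continuous_seminorm scl' u" for u
  proof -
    have s: "seminorm scl' u" using u by (simp add: continuous_seminorm_def)
    obtain M where M: "\<And>k. u (scl' (c k) (?B k)) \<le> M * f k"
      using est[OF u] by blast
    have "summable (\<lambda>k. M * f k)" using sf by (rule summable_mult)
    then show ?thesis
      by (rule summable_comparison_test') (simp add: M seminorm_nonneg[OF W.vector_space_axioms s])
  qed
  ultimately show ?thesis
    by (simp add: converges_absolutely_to_def cont_ext_eq[OF bilin bdd] cont_ext_eq[OF st_bilin st_bdd])
qed

end

section \<open>A factorial estimate\<close>

text \<open>The falling factorial when \<open>k \<le> n\<close>. For \<open>k > n\<close> truncated
  subtraction gives \<open>n!\<close> instead of 0, which keeps \<open>ffact_ge_1\<close> and the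
  recursion \<open>ffact_Suc\<close> free of conditions on \<open>k\<close>; contractions of such
  order vanish.\<close>

definition ffact :: "nat \<Rightarrow> nat \<Rightarrow> real" where
  "ffact n k = fact n / fact (n - k)"

lemma ffact_nonneg: "0 \<le> ffact n k"
  by (simp add: ffact_def)

lemma ffact_Suc: "n \<noteq> 0 \<Longrightarrow> ffact n (Suc k) = real n * ffact (n - 1) k"
  by (cases n) (simp_all add: ffact_def)

lemma fact_add_le: "(fact (m + n) :: real) \<le> 2 ^ (m + n) * (fact m * fact n)"
proof -
  have "(fact (m + n) :: real) = real (m + n choose m) * (fact m * fact n)"
    by (simp add: binomial_fact)
  also have "\<dots> \<le> 2 ^ (m + n) * (fact m * fact n)"
  proof (rule mult_right_mono)
    show "real (m + n choose m) \<le> 2 ^ (m + n)"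
      using of_nat_mono[OF binomial_le_pow2[of "m + n" m], where 'a = real] by simp
  qed simp
  finally show ?thesis .
qed

lemma ffact_le: "k \<le> n \<Longrightarrow> ffact n k \<le> 2 ^ n * fact k"
  using fact_add_le[of k "n - k"] by (simp add: ffact_def field_simps)

lemma ffact_ge_1: "1 \<le> ffact n k"
  by (simp add: ffact_def fact_mono)

text \<open>Split \<open>ffact n k\<close> into its powers with exponents \<open>r\<close> and
  \<open>1 - r\<close>. The first combines with \<open>(n-k)!^r\<close> to \<open>n!^r\<close>. The
  second is at most the square root of \<open>ffact n k\<close>, as \<open>1 - r \<le> 1/2\<close>,
  hence at most \<open>2^(n/2) k!^(1/2)\<close>. The degrees \<open>n\<close> and \<open>m\<close>
  together leave one \<open>k!\<close>, which \<open>1/k!\<close> cancels. In \<open>K\<close>, the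
  factor \<open>2 powr (1/2)\<close> comes from this split, \<open>2 powr r\<close> from breaking up
  \<open>(n+m-2k)!\<close>, and \<open>\<zeta>\<close> from
  \<open>\<zeta>^k \<le> \<zeta>^n \<zeta>^m\<close>.\<close>

lemma star_weight_estimate:
  fixes \<zeta> r :: real
  assumes z: "\<zeta> \<ge> 1" and r: "r \<ge> 1/2" and k: "k \<le> n" "k \<le> m"
  defines "K \<equiv> \<zeta> * 2 powr (r + 1/2)"
  shows "\<zeta> ^ k / fact k * (ffact n k * ffact m k * fact (n + m - 2 * k) powr r) \<le>
    (K ^ n * fact n powr r) * (K ^ m * fact m powr r)"
proof -
  have split: "ffact i k \<le> ffact i k powr r * (2 powr (i / 2) * fact k powr (1/2))" if "k \<le> i" for i
  proof -
    have "ffact i k = ffact i k powr r * ffact i k powr (1 - r)"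
      using ffact_ge_1[of i k] by (simp flip: powr_add)
    also have "ffact i k powr (1 - r) \<le> ffact i k powr (1/2)"
      using ffact_ge_1[of i k] r by (intro powr_mono) auto
    also have "ffact i k powr (1/2) \<le> (2 ^ i * fact k) powr (1/2)"
      using ffact_ge_1[of i k] by (intro powr_mono2 ffact_le that) auto
    also have "(2 ^ i * fact k) powr (1/2) = 2 powr (i / 2) * fact k powr (1/2)"
      by (simp add: powr_mult powr_powr flip: powr_realpow)
    finally show ?thesis by (simp add: mult_left_mono)
  qed
  have fk: "fact k powr (1/2) * fact k powr (1/2) = (fact k :: real)"
    by (simp flip: powr_add)
  have fr: "ffact i k powr r * fact (i - k) powr r = fact i powr r" if "k \<le> i" for i
    using ffact_ge_1[of i k] by (simp add: ffact_def flip: powr_mult)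
  have e: "n - k + (m - k) = n + m - 2 * k" using k by simp
  have w: "fact (n + m - 2 * k) powr r \<le>
      2 powr (r * n) * 2 powr (r * m) * (fact (n - k) powr r * fact (m - k) powr r)"
  proof -
    have "(fact (n + m - 2 * k) :: real) \<le> 2 ^ (n - k + (m - k)) * (fact (n - k) * fact (m - k))"
      using fact_add_le[of "n - k" "m - k"] k by (simp only: e)
    also have "\<dots> \<le> 2 ^ (n + m) * (fact (n - k) * fact (m - k))"
      by (intro mult_right_mono power_increasing) auto
    finally have "fact (n + m - 2 * k) powr r \<le> (2 ^ (n + m) * (fact (n - k) * fact (m - k))) powr r"
      using r by (intro powr_mono2) auto
    also have "\<dots> = 2 powr (r * n) * 2 powr (r * m) * (fact (n - k) powr r * fact (m - k) powr r)"
      by (simp add: powr_mult powr_powr powr_add algebra_simps flip: powr_realpow)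
    finally show ?thesis .
  qed
  have K: "K ^ i = \<zeta> ^ i * (2 powr (r * i) * 2 powr (i / 2))" for i
    by (simp add: K_def power_mult_distrib powr_power algebra_simps powr_add)
  have "\<zeta> ^ k / fact k * (ffact n k * ffact m k * fact (n + m - 2 * k) powr r) \<le>
     \<zeta> ^ k / fact k * ((ffact n k powr r * (2 powr (n / 2) * fact k powr (1/2))) *
       (ffact m k powr r * (2 powr (m / 2) * fact k powr (1/2))) *
       (2 powr (r * n) * 2 powr (r * m) * (fact (n - k) powr r * fact (m - k) powr r)))"
    using z by (intro mult_left_mono mult_mono split w k) (auto simp: ffact_nonneg)
  also have "\<dots> = \<zeta> ^ k * ((fact k powr (1/2) * fact k powr (1/2)) / fact k) *
      (2 powr (r * n) * 2 powr (n / 2)) * (2 powr (r * m) * 2 powr (m / 2)) *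
      ((ffact n k powr r * fact (n - k) powr r) * (ffact m k powr r * fact (m - k) powr r))"
    by simp
  also have "\<dots> = \<zeta> ^ k * ((2 powr (r * n) * 2 powr (n / 2)) * fact n powr r *
      ((2 powr (r * m) * 2 powr (m / 2)) * fact m powr r))"
    unfolding fk fr[OF k(1)] fr[OF k(2)] by simp
  also have "\<dots> \<le> (\<zeta> ^ n * \<zeta> ^ m) * ((2 powr (r * n) * 2 powr (n / 2)) * fact n powr r *
      ((2 powr (r * m) * 2 powr (m / 2)) * fact m powr r))"
  proof (rule mult_right_mono)
    have "\<zeta> ^ k * 1 \<le> \<zeta> ^ n * \<zeta> ^ m"
      using z k by (intro mult_mono power_increasing one_le_power) auto
    then show "\<zeta> ^ k \<le> \<zeta> ^ n * \<zeta> ^ m" by simp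
  qed simp
  also have "\<dots> = (K ^ n * fact n powr r) * (K ^ m * fact m powr r)"
    unfolding K by simp
  finally show ?thesis .
qed

section \<open>Tensor powers and their projective seminorms\<close>

interpretation tensors: vector_space "tscale :: 'k::field \<Rightarrow> ('f \<Rightarrow> 'k) \<Rightarrow> 'f \<Rightarrow> 'k"
  by unfold_locales (auto simp: tscale_def fun_eq_iff algebra_simps)

lemma linear_tscale_iff:
  fixes G :: "('f \<Rightarrow> 'k::field) \<Rightarrow> 'g \<Rightarrow> 'k"
  shows "Vector_Spaces.linear tscale tscale G \<longleftrightarrow>
    (\<forall>s t. G (s + t) = G s + G t) \<and> (\<forall>c s. G (tscale c s) = tscale c (G s))"
  by (simp add: Vector_Spaces.linear_iff tensors.vector_space_axioms)

lemma linear_tscale_compose: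
  fixes G :: "('f \<Rightarrow> 'k::field) \<Rightarrow> 'g \<Rightarrow> 'k" and H :: "('g \<Rightarrow> 'k) \<Rightarrow> 'h \<Rightarrow> 'k"
  shows "Vector_Spaces.linear tscale tscale G \<Longrightarrow> Vector_Spaces.linear tscale tscale H \<Longrightarrow>
    Vector_Spaces.linear tscale tscale (\<lambda>s. H (G s))"
  by (simp add: linear_tscale_iff)

lemma linear_tscale_funpow:
  fixes G :: "('f \<Rightarrow> 'k::field) \<Rightarrow> 'f \<Rightarrow> 'k"
  shows "Vector_Spaces.linear tscale tscale G \<Longrightarrow> Vector_Spaces.linear tscale tscale (G ^^ k)"
  by (induction k) (simp_all add: linear_tscale_iff)

lemma linear_tscale_sum:
  fixes G :: "('f \<Rightarrow> 'k::field) \<Rightarrow> 'g \<Rightarrow> 'k"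
  assumes "Vector_Spaces.linear tscale tscale G"
  shows "G (\<Sum>i\<in>I. tscale (c i) (t i)) = (\<Sum>i\<in>I. tscale (c i) (G (t i)))"
proof -
  interpret Vector_Spaces.linear tscale tscale G by (rule assms)
  show ?thesis by (simp add: sum scale)
qed

lemma linear_tscale_sum':
  fixes G :: "('f \<Rightarrow> 'k::field) \<Rightarrow> 'g \<Rightarrow> 'k"
  shows "Vector_Spaces.linear tscale tscale G \<Longrightarrow> G (\<Sum>i\<in>I. t i) = (\<Sum>i\<in>I. G (t i))"
  using linear_tscale_sum[of G "\<lambda>_. 1" t I] by simp

text \<open>\<open>tlift \<phi>\<close> only changes the form at which its argument is evaluated,
  and the vector operations on functionals are pointwise.\<close>

lemma linear_tlift: "Vector_Spaces.linear tscale tscale (tlift (\<phi> :: _ \<Rightarrow> _ \<Rightarrow> 'k::field))"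
  by (auto simp: linear_tscale_iff tlift_def tscale_def)

lemma linear_tlift2: "Vector_Spaces.linear tscale tscale (tlift2 (\<phi> :: _ \<Rightarrow> _ \<Rightarrow> _ \<Rightarrow> 'k::field))"
  by (auto simp: linear_tscale_iff tlift2_def tscale_def)

lemma linear_symmetrize: "Vector_Spaces.linear tscale tscale (symmetrize scl V)"
  unfolding symmetrize_def by (rule linear_tlift)

lemma linear_sym_mult: "Vector_Spaces.linear tscale tscale (sym_mult scl V)"
  unfolding sym_mult_def by (rule linear_tlift2)

lemma linear_P_op: "Vector_Spaces.linear tscale tscale (P_op scl V \<Lambda>)"
  unfolding P_op_def by (rule linear_tlift2)

lemma linear_tcomp: "Vector_Spaces.linear tscale tscale (tcomp scl n)"
  unfolding tcomp_def by (rule linear_tlift)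

definition tensor_power :: "('k::field \<Rightarrow> 'v::ab_group_add \<Rightarrow> 'v) \<Rightarrow> nat \<Rightarrow> ('k, 'v) tensor set" where
  "tensor_power scl n = module.span tscale (tens scl ` {xs. length xs = n})"

lemma subspace_tensor_power: "tensors.subspace (tensor_power scl n)"
  unfolding tensor_power_def by (rule tensors.subspace_span)

lemma subspace_tensor_algebra: "tensors.subspace (tensor_algebra scl)"
  unfolding tensor_algebra_def by (rule tensors.subspace_span)

lemma tensor_power_subset: "tensor_power scl n \<subseteq> tensor_algebra scl"
  unfolding tensor_power_def tensor_algebra_def by (rule tensors.span_mono) auto

lemma tens_in_tensor_power: "length xs = n \<Longrightarrow> tens scl xs \<in> tensor_power scl n"
  unfolding tensor_power_def by (rule tensors.span_base) auto

lemma tensor_powerE: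
  assumes "t \<in> tensor_power scl n"
  obtains X c where "finite X" "\<forall>xs\<in>X. length xs = n" "t = (\<Sum>xs\<in>X. tscale (c xs) (tens scl xs))"
proof -
  obtain B r where B: "finite B" "B \<subseteq> tens scl ` {xs. length xs = n}" "t = (\<Sum>b\<in>B. tscale (r b) b)"
    using assms unfolding tensor_power_def tensors.span_explicit by blast
  then obtain X where X: "X \<subseteq> {xs. length xs = n}" "inj_on (tens scl) X" "B = tens scl ` X"
    by (auto simp: subset_image_inj)
  have "t = (\<Sum>xs\<in>X. tscale (r (tens scl xs)) (tens scl xs))"
    unfolding B(3) X(3) by (simp add: sum.reindex[OF X(2)])
  moreover have "finite X" using B(1) X(2,3) finite_image_iff by blast
  ultimately show ?thesis using that[of X "\<lambda>xs. r (tens scl xs)"] X(1) by blast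
qed

section \<open>Calculus of the projective seminorm\<close>

lemma tensor_seminorm_le:
  assumes "\<And>v. 0 \<le> p v" and "finite X" "\<forall>xs\<in>X. length xs = n"
  shows "tensor_seminorm scl n p (\<Sum>xs\<in>X. tscale (c xs) (tens scl xs)) \<le> (\<Sum>xs\<in>X. norm (c xs) * prod_list (map p xs))"
  unfolding tensor_seminorm_def
proof (rule cInf_lower)
  show "bdd_below {(\<Sum>xs\<in>Y. norm (d xs) * prod_list (map p xs)) | Y d. finite Y \<and> (\<forall>xs\<in>Y. length xs = n) \<and>
      (\<Sum>xs\<in>X. tscale (c xs) (tens scl xs)) = (\<Sum>xs\<in>Y. tscale (d xs) (tens scl xs))}"
    by (rule bdd_belowI[of _ 0]) (auto intro!: sum_nonneg mult_nonneg_nonneg prod_list_nonneg assms(1))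
qed (use assms(2,3) in blast)

text \<open>Membership in the tensor power makes the set of representations nonempty; otherwise its
  infimum would carry no information.\<close>

lemma tensor_seminorm_greatest:
  assumes "t \<in> tensor_power scl n"
    and "\<And>X c. finite X \<Longrightarrow> \<forall>xs\<in>X. length xs = n \<Longrightarrow> t = (\<Sum>xs\<in>X. tscale (c xs) (tens scl xs)) \<Longrightarrow>
      L \<le> (\<Sum>xs\<in>X. norm (c xs) * prod_list (map p xs))"
  shows "L \<le> tensor_seminorm scl n p t"
  unfolding tensor_seminorm_def
proof (rule cInf_greatest)
  show "{(\<Sum>xs\<in>X. norm (c xs) * prod_list (map p xs)) | X c. finite X \<and> (\<forall>xs\<in>X. length xs = n) \<and>
      t = (\<Sum>xs\<in>X. tscale (c xs) (tens scl xs))} \<noteq> {}"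
    by (rule tensor_powerE[OF assms(1)]) blast
qed (use assms(2) in blast)

lemma tensor_seminorm_approx:
  assumes "t \<in> tensor_power scl n" "e > 0"
  obtains X c where "finite X" "\<forall>xs\<in>X. length xs = n" "t = (\<Sum>xs\<in>X. tscale (c xs) (tens scl xs))"
    "(\<Sum>xs\<in>X. norm (c xs) * prod_list (map p xs)) < tensor_seminorm scl n p t + e"
proof -
  have "\<not> tensor_seminorm scl n p t + e \<le> tensor_seminorm scl n p t" using assms(2) by simp
  then show ?thesis
    using tensor_seminorm_greatest[OF assms(1), of "tensor_seminorm scl n p t + e" p] that
    by (meson not_le)
qed

context
  fixes scl :: "'k::real_normed_field \<Rightarrow> 'v::ab_group_add \<Rightarrow> 'v" and p :: "'v \<Rightarrow> real"
  assumes p_nonneg: "0 \<le> p v"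
begin

lemma tensor_seminorm_nonneg: "t \<in> tensor_power scl n \<Longrightarrow> 0 \<le> tensor_seminorm scl n p t"
  by (rule tensor_seminorm_greatest) (auto intro!: sum_nonneg mult_nonneg_nonneg prod_list_nonneg p_nonneg)

lemma tensor_seminorm_zero: "tensor_seminorm scl n p 0 = 0"
  using tensor_seminorm_le[of p "{}" n scl, OF p_nonneg] 
    tensor_seminorm_nonneg[OF tensors.subspace_0[OF subspace_tensor_power]]
  by (intro antisym) auto

lemma tensor_seminorm_tens: "length xs = n \<Longrightarrow> tensor_seminorm scl n p (tens scl xs) \<le> prod_list (map p xs)"
  using tensor_seminorm_le[of p "{xs}" n scl "\<lambda>_. 1", OF p_nonneg] by simp

lemma tensor_seminorm_add:
  assumes "s \<in> tensor_power scl n" "t \<in> tensor_power scl n"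
  shows "tensor_seminorm scl n p (s + t) \<le> tensor_seminorm scl n p s + tensor_seminorm scl n p t"
proof (rule field_le_epsilon)
  fix e :: real assume "e > 0"
  then have e: "e / 2 > 0" by simp
  obtain X c where X: "finite X" "\<forall>xs\<in>X. length xs = n" "s = (\<Sum>xs\<in>X. tscale (c xs) (tens scl xs))"
    "(\<Sum>xs\<in>X. norm (c xs) * prod_list (map p xs)) < tensor_seminorm scl n p s + e / 2"
    using tensor_seminorm_approx[OF assms(1) e] by blast
  obtain Y d where Y: "finite Y" "\<forall>xs\<in>Y. length xs = n" "t = (\<Sum>xs\<in>Y. tscale (d xs) (tens scl xs))"
    "(\<Sum>xs\<in>Y. norm (d xs) * prod_list (map p xs)) < tensor_seminorm scl n p t + e / 2"
    using tensor_seminorm_approx[OF assms(2) e] by blast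
  \<comment> \<open>Representations are indexed by sets of words that may overlap, so they are
    merged over \<open>X \<union> Y\<close> with coefficients extended by zero and added.\<close>
  let ?c = "\<lambda>xs. if xs \<in> X then c xs else 0" and ?d = "\<lambda>xs. if xs \<in> Y then d xs else 0"
  have pn: "0 \<le> prod_list (map p xs)" for xs by (auto intro!: prod_list_nonneg p_nonneg)
  have "s = (\<Sum>xs\<in>X \<union> Y. tscale (?c xs) (tens scl xs))"
    unfolding X(3) using X(1) Y(1) by (intro sum.mono_neutral_cong_left) auto
  moreover have "t = (\<Sum>xs\<in>X \<union> Y. tscale (?d xs) (tens scl xs))"
    unfolding Y(3) using X(1) Y(1) by (intro sum.mono_neutral_cong_left) auto
  ultimately have "s + t = (\<Sum>xs\<in>X \<union> Y. tscale (?c xs + ?d xs) (tens scl xs))"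
    by (simp only: tensors.scale_left_distrib sum.distrib)
  then have "tensor_seminorm scl n p (s + t) \<le> (\<Sum>xs\<in>X \<union> Y. norm (?c xs + ?d xs) * prod_list (map p xs))"
    using X Y by (simp only:) (rule tensor_seminorm_le, auto simp: p_nonneg)
  also have "\<dots> \<le> (\<Sum>xs\<in>X \<union> Y. norm (?c xs) * prod_list (map p xs) + norm (?d xs) * prod_list (map p xs))"
    unfolding distrib_right[symmetric] by (intro sum_mono mult_right_mono norm_triangle_ineq pn)
  also have "\<dots> = (\<Sum>xs\<in>X. norm (c xs) * prod_list (map p xs)) + (\<Sum>xs\<in>Y. norm (d xs) * prod_list (map p xs))"
    unfolding sum.distrib using X(1) Y(1)
    by (intro arg_cong2[where f = "(+)"] sum.mono_neutral_cong_right) auto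
  also have "\<dots> \<le> tensor_seminorm scl n p s + tensor_seminorm scl n p t + e"
    using X(4) Y(4) by simp
  finally show "tensor_seminorm scl n p (s + t) \<le> tensor_seminorm scl n p s + tensor_seminorm scl n p t + e" .
qed

lemma tensor_seminorm_scale_le:
  assumes "t \<in> tensor_power scl n"
  shows "tensor_seminorm scl n p (tscale c t) \<le> norm c * tensor_seminorm scl n p t"
proof (cases "c = 0")
  case True then show ?thesis by (simp add: tensor_seminorm_zero)
next
  case False
  have "tensor_seminorm scl n p (tscale c t) / norm c \<le> tensor_seminorm scl n p t"
  proof (rule tensor_seminorm_greatest[OF assms])
    fix X d assume X: "finite X" "\<forall>xs\<in>X. length xs = n" "t = (\<Sum>xs\<in>X. tscale (d xs) (tens scl xs))"
    have "tscale c t = (\<Sum>xs\<in>X. tscale (c * d xs) (tens scl xs))"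
      unfolding X(3) by (simp add: tensors.scale_sum_right)
    then have "tensor_seminorm scl n p (tscale c t) \<le> (\<Sum>xs\<in>X. norm (c * d xs) * prod_list (map p xs))"
      using X by (simp only:) (rule tensor_seminorm_le, auto simp: p_nonneg)
    then show "tensor_seminorm scl n p (tscale c t) / norm c \<le> (\<Sum>xs\<in>X. norm (d xs) * prod_list (map p xs))"
      using False by (simp add: norm_mult mult.assoc divide_le_eq mult.commute[of _ "norm c"] flip: sum_distrib_left)
  qed
  then show ?thesis using False by (simp add: field_simps)
qed

lemma tensor_seminorm_scale:
  assumes "t \<in> tensor_power scl n"
  shows "tensor_seminorm scl n p (tscale c t) = norm c * tensor_seminorm scl n p t"
proof (cases "c = 0")
  case True then show ?thesis by (simp add: tensor_seminorm_zero)
next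
  case False
  have "tensor_seminorm scl n p (tscale (inverse c) (tscale c t)) \<le> norm (inverse c) * tensor_seminorm scl n p (tscale c t)"
    by (intro tensor_seminorm_scale_le tensors.subspace_scale[OF subspace_tensor_power] assms)
  then have "norm c * tensor_seminorm scl n p t \<le> tensor_seminorm scl n p (tscale c t)"
    using False by (simp add: norm_inverse norm_divide field_simps)
  then show ?thesis using tensor_seminorm_scale_le[OF assms] by (simp add: antisym)
qed

lemma tensor_seminorm_sum:
  assumes "\<And>i. i \<in> I \<Longrightarrow> g i \<in> tensor_power scl n" "\<And>i. i \<in> I \<Longrightarrow> tensor_seminorm scl n p (g i) \<le> h i"
  shows "tensor_seminorm scl n p (sum g I) \<le> sum h I"
  using assms
proof (induction I rule: infinite_finite_induct)
  case (insert i I)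
  have "tensor_seminorm scl n p (g i + sum g I) \<le> tensor_seminorm scl n p (g i) + tensor_seminorm scl n p (sum g I)"
    by (intro tensor_seminorm_add tensors.subspace_sum[OF subspace_tensor_power] insert.prems) auto
  also have "\<dots> \<le> h i + sum h I"
    by (intro add_mono insert.IH insert.prems) auto
  finally show ?case by (simp only: sum.insert[OF insert.hyps])
qed (simp_all add: tensor_seminorm_zero)

text \<open>Every representation by words of length \<open>n\<close> has its cost multiplied by
  \<open>K ^ n\<close>, and the infimum follows.\<close>

lemma tensor_seminorm_dilate:
  assumes "t \<in> tensor_power scl n" "K > 0"
  shows "K ^ n * tensor_seminorm scl n p t \<le> tensor_seminorm scl n (\<lambda>v. K * p v) t"
proof (rule tensor_seminorm_greatest[OF assms(1)])
  fix X c assume X: "finite X" "\<forall>xs\<in>X. length xs = n" "t = (\<Sum>xs\<in>X. tscale (c xs) (tens scl xs))"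
  have "prod_list (map (\<lambda>v. K * p v) xs) = K ^ length xs * prod_list (map p xs)" for xs
    by (induction xs) auto
  then have "(\<Sum>xs\<in>X. norm (c xs) * prod_list (map (\<lambda>v. K * p v) xs)) =
      K ^ n * (\<Sum>xs\<in>X. norm (c xs) * prod_list (map p xs))"
    using X(2) by (simp add: sum_distrib_left mult_ac)
  moreover have "tensor_seminorm scl n p t \<le> (\<Sum>xs\<in>X. norm (c xs) * prod_list (map p xs))"
    unfolding X(3) by (rule tensor_seminorm_le[OF p_nonneg X(1,2)])
  ultimately show "K ^ n * tensor_seminorm scl n p t \<le> (\<Sum>xs\<in>X. norm (c xs) * prod_list (map (\<lambda>v. K * p v) xs))"
    using assms(2) by simp
qed

lemma tensor_seminorm_mono:
  assumes "t \<in> tensor_power scl n" "\<And>v. p v \<le> q v"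
  shows "tensor_seminorm scl n p t \<le> tensor_seminorm scl n q t"
proof (rule tensor_seminorm_greatest[OF assms(1)])
  fix X c assume X: "finite X" "\<forall>xs\<in>X. length xs = n" "t = (\<Sum>xs\<in>X. tscale (c xs) (tens scl xs))"
  have "prod_list (map p xs) \<le> prod_list (map q xs) \<and> 0 \<le> prod_list (map p xs)" for xs
  proof (induction xs)
    case (Cons x xs)
    then show ?case
      using p_nonneg[of x] assms(2)[of x] by (auto intro!: mult_mono mult_nonneg_nonneg)
  qed simp
  then have "(\<Sum>xs\<in>X. norm (c xs) * prod_list (map p xs)) \<le> (\<Sum>xs\<in>X. norm (c xs) * prod_list (map q xs))"
    by (intro sum_mono mult_left_mono) auto
  moreover have "tensor_seminorm scl n p t \<le> (\<Sum>xs\<in>X. norm (c xs) * prod_list (map p xs))"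
    unfolding X(3) by (rule tensor_seminorm_le[OF p_nonneg X(1,2)])
  ultimately show "tensor_seminorm scl n p t \<le> (\<Sum>xs\<in>X. norm (c xs) * prod_list (map q xs))" by simp
qed

end

section \<open>The seminorms of the Weyl algebra\<close>

text \<open>Elements of the tensor algebra have finitely many nonzero components, so no convergence
  question arises; \<open>N\<close> is left free to allow a common bound for several
  elements.\<close>

lemma weyl_seminorm_finite:
  assumes p: "\<And>v. 0 \<le> p v" and "\<And>n. n \<ge> N \<Longrightarrow> tcomp scl n t = 0"
  shows "weyl_seminorm scl r p t = (\<Sum>n<N. tensor_seminorm scl n p (tcomp scl n t) * fact n powr r)"
  unfolding weyl_seminorm_def
  by (rule suminf_finite) (auto simp: assms(2) tensor_seminorm_zero[OF p])

context graded_lcs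
begin

lemma tensor_algebra_induct [consumes 1, case_names zero step]:
  assumes "t \<in> tensor_algebra scl" "P 0"
    and "\<And>c xs t. t \<in> tensor_algebra scl \<Longrightarrow> P t \<Longrightarrow> P (tscale c (tens scl xs) + t)"
  shows "P t"
proof -
  have "t \<in> tensor_algebra scl \<and> P t"
    using assms(1) unfolding tensor_algebra_def
  proof (induction t rule: tensors.span_induct_alt)
    case (step c x y)
    then obtain xs where x: "x = tens scl xs" by blast
    have "tscale c x + y \<in> tensors.span (range (tens scl))"
      using step by (intro tensors.span_add[OF tensors.span_scale[OF tensors.span_base]]) auto
    moreover have "P (tscale c x + y)"
      unfolding x using step by (intro assms(3)) (auto simp: tensor_algebra_def)
    ultimately show ?case by blast
  qed (intro conjI assms(2) tensors.span_zero)
  then show ?thesis by blast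
qed

lemma tcomp_tensor_power:
  assumes "t \<in> tensor_power scl m" shows "tcomp scl n t = (if n = m then t else 0)"
proof (rule tensor_powerE[OF assms])
  fix X c assume X: "finite X" "\<forall>xs\<in>X. length xs = m" "t = (\<Sum>xs\<in>X. tscale (c xs) (tens scl xs))"
  have "tcomp scl n t = (\<Sum>xs\<in>X. tscale (c xs) (tcomp scl n (tens scl xs)))"
    unfolding X(3) by (rule linear_tscale_sum[OF linear_tcomp])
  also have "\<dots> = (\<Sum>xs\<in>X. if n = m then tscale (c xs) (tens scl xs) else 0)"
    using X(2) by (intro sum.cong) (auto simp: tcomp_tens)
  also have "\<dots> = (if n = m then t else 0)" by (simp add: X(3))
  finally show ?thesis .
qed

lemma tcomp_zero: "tcomp scl n 0 = 0"
  using tcomp_tensor_power[OF tensors.subspace_0[OF subspace_tensor_power], of n n] by (simp only: if_cancel)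

lemma tcomp_in_tensor_power: "t \<in> tensor_algebra scl \<Longrightarrow> tcomp scl n t \<in> tensor_power scl n"
proof (induction t rule: tensor_algebra_induct)
  case zero
  show ?case unfolding tcomp_zero by (rule tensors.subspace_0[OF subspace_tensor_power])
next
  case (step c xs t)
  have "tcomp scl n (tens scl xs) \<in> tensor_power scl n"
    by (simp add: tcomp_tens tens_in_tensor_power tensors.subspace_0[OF subspace_tensor_power])
  then show ?case
    using step linear_tcomp[of scl n] unfolding linear_tscale_iff
    by (simp only:) (intro tensors.subspace_add tensors.subspace_scale subspace_tensor_power)
qed

lemma tensor_algebra_decompose:
  assumes "t \<in> tensor_algebra scl"
  obtains N where "\<And>n. n \<ge> N \<Longrightarrow> tcomp scl n t = 0" "t = (\<Sum>n<N. tcomp scl n t)"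
proof -
  \<comment> \<open>The claim is made for all large \<open>N\<close>, since in the induction a new
    word and the rest must share one bound.\<close>
  have "\<exists>N0. \<forall>N\<ge>N0. tcomp scl N t = 0 \<and> t = (\<Sum>n<N. tcomp scl n t)"
    using assms
  proof (induction t rule: tensor_algebra_induct)
    case zero
    show ?case by (rule exI[of _ 0]) (simp only: tcomp_zero sum.neutral_const simp_thms)
  next
    case (step c xs t)
    obtain N0 where N0: "\<And>N. N \<ge> N0 \<Longrightarrow> tcomp scl N t = 0 \<and> t = (\<Sum>n<N. tcomp scl n t)"
      using step.IH by blast
    have tc: "tcomp scl n (tscale c (tens scl xs) + t) =
        tscale c (if length xs = n then tens scl xs else 0) + tcomp scl n t" for n
      using linear_tcomp[of scl n] by (simp only: linear_tscale_iff tcomp_tens)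
    have "tcomp scl N (tscale c (tens scl xs) + t) = 0 \<and>
        tscale c (tens scl xs) + t = (\<Sum>n<N. tcomp scl n (tscale c (tens scl xs) + t))"
      if N: "N \<ge> max N0 (Suc (length xs))" for N
    proof
      show "tcomp scl N (tscale c (tens scl xs) + t) = 0"
        unfolding tc using N0[of N] N by simp
      have "(\<Sum>n<N. tscale c (if length xs = n then tens scl xs else 0)) = tscale c (tens scl xs)"
        using N by (subst tensors.scale_sum_right[symmetric]) simp
      moreover have "(\<Sum>n<N. tcomp scl n t) = t" using N0[of N] N by simp
      ultimately show "tscale c (tens scl xs) + t = (\<Sum>n<N. tcomp scl n (tscale c (tens scl xs) + t))"
        unfolding tc sum.distrib by (simp only:)
    qed
    then show ?case by blast
  qed
  then show ?thesis using that by blast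
qed

context
  fixes p :: "'v \<Rightarrow> real"
  assumes p_nonneg: "0 \<le> p v"
begin

lemma weyl_seminorm_tensor_power:
  assumes "t \<in> tensor_power scl n" shows "weyl_seminorm scl r p t = tensor_seminorm scl n p t * fact n powr r"
proof -
  have "weyl_seminorm scl r p t = (\<Sum>i<Suc n. tensor_seminorm scl i p (tcomp scl i t) * fact i powr r)"
    by (rule weyl_seminorm_finite[OF p_nonneg]) (simp add: tcomp_tensor_power[OF assms])
  also have "\<dots> = (\<Sum>i<Suc n. if i = n then tensor_seminorm scl n p t * fact n powr r else 0)"
    by (intro sum.cong) (auto simp: tcomp_tensor_power[OF assms] tensor_seminorm_zero[OF p_nonneg])
  finally show ?thesis by simp
qed

lemma weyl_seminorm_zero: "weyl_seminorm scl r p 0 = 0"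
  using weyl_seminorm_tensor_power[OF tensors.subspace_0[OF subspace_tensor_power], of r 0]
  by (simp add: tensor_seminorm_zero[OF p_nonneg])

lemma weyl_seminorm_add:
  assumes s: "s \<in> tensor_algebra scl" and t: "t \<in> tensor_algebra scl"
  shows "weyl_seminorm scl r p (s + t) \<le> weyl_seminorm scl r p s + weyl_seminorm scl r p t"
proof -
  obtain N where N: "\<And>n. n \<ge> N \<Longrightarrow> tcomp scl n s = 0"
    using tensor_algebra_decompose[OF s] by metis
  obtain M where M: "\<And>n. n \<ge> M \<Longrightarrow> tcomp scl n t = 0"
    using tensor_algebra_decompose[OF t] by metis
  let ?L = "max N M"
  have add: "tcomp scl n (s + t) = tcomp scl n s + tcomp scl n t" for n
    using linear_tcomp[of scl n] by (simp only: linear_tscale_iff)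
  have "weyl_seminorm scl r p (s + t) =
      (\<Sum>n<?L. tensor_seminorm scl n p (tcomp scl n s + tcomp scl n t) * fact n powr r)"
    unfolding add[symmetric] by (rule weyl_seminorm_finite[OF p_nonneg]) (simp add: add N M)
  also have "\<dots> \<le> (\<Sum>n<?L. (tensor_seminorm scl n p (tcomp scl n s) + tensor_seminorm scl n p (tcomp scl n t)) * fact n powr r)"
    by (intro sum_mono mult_right_mono tensor_seminorm_add tcomp_in_tensor_power s t p_nonneg) simp
  also have "\<dots> = weyl_seminorm scl r p s + weyl_seminorm scl r p t"
    using weyl_seminorm_finite[OF p_nonneg, of ?L scl s r] weyl_seminorm_finite[OF p_nonneg, of ?L scl t r]
    by (simp add: N M distrib_right sum.distrib)
  finally show ?thesis .
qed

lemma weyl_seminorm_sum: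
  assumes "\<And>i. i \<in> I \<Longrightarrow> g i \<in> tensor_algebra scl" "\<And>i. i \<in> I \<Longrightarrow> weyl_seminorm scl r p (g i) \<le> h i"
  shows "weyl_seminorm scl r p (sum g I) \<le> sum h I"
  using assms
proof (induction I rule: infinite_finite_induct)
  case (insert i I)
  have "weyl_seminorm scl r p (g i + sum g I) \<le> weyl_seminorm scl r p (g i) + weyl_seminorm scl r p (sum g I)"
    by (intro weyl_seminorm_add tensors.subspace_sum[OF subspace_tensor_algebra] insert.prems) auto
  also have "\<dots> \<le> h i + sum h I"
    by (intro add_mono insert.IH insert.prems) auto
  finally show ?case by (simp only: sum.insert[OF insert.hyps])
qed (simp_all add: weyl_seminorm_zero)

lemma weyl_seminorm_scale:
  assumes t: "t \<in> tensor_algebra scl"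
  shows "weyl_seminorm scl r p (tscale c t) = norm c * weyl_seminorm scl r p t"
proof -
  obtain N where N: "\<And>n. n \<ge> N \<Longrightarrow> tcomp scl n t = 0"
    using tensor_algebra_decompose[OF t] by metis
  have sc: "tcomp scl n (tscale c t) = tscale c (tcomp scl n t)" for n
    using linear_tcomp[of scl n] by (simp only: linear_tscale_iff)
  have "weyl_seminorm scl r p (tscale c t) =
      (\<Sum>n<N. tensor_seminorm scl n p (tscale c (tcomp scl n t)) * fact n powr r)"
    unfolding sc[symmetric] by (rule weyl_seminorm_finite[OF p_nonneg]) (simp add: sc N)
  also have "\<dots> = (\<Sum>n<N. norm c * tensor_seminorm scl n p (tcomp scl n t) * fact n powr r)"
    by (simp add: tensor_seminorm_scale[OF p_nonneg tcomp_in_tensor_power[OF t]])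
  also have "\<dots> = norm c * weyl_seminorm scl r p t"
    using weyl_seminorm_finite[OF p_nonneg, of N scl t r] N by (simp add: sum_distrib_left mult.assoc)
  finally show ?thesis .
qed

lemma weyl_seminorm_mono:
  assumes t: "t \<in> tensor_algebra scl" and q: "\<And>v. p v \<le> q v" and "r \<le> r'"
  shows "weyl_seminorm scl r p t \<le> weyl_seminorm scl r' q t"
proof -
  obtain N where N: "\<And>n. n \<ge> N \<Longrightarrow> tcomp scl n t = 0"
    using tensor_algebra_decompose[OF t] by metis
  have q_nonneg: "0 \<le> q v" for v using p_nonneg[of v] q[of v] by simp
  have "(fact n :: real) powr r \<le> fact n powr r'" for n
    using assms(3) by (intro powr_mono) auto
  then have "(\<Sum>n<N. tensor_seminorm scl n p (tcomp scl n t) * fact n powr r) \<le>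
      (\<Sum>n<N. tensor_seminorm scl n q (tcomp scl n t) * fact n powr r')"
    by (intro sum_mono mult_mono tensor_seminorm_mono p_nonneg q tcomp_in_tensor_power t
        tensor_seminorm_nonneg q_nonneg) auto
  then show ?thesis
    by (simp only: weyl_seminorm_finite[OF p_nonneg N] weyl_seminorm_finite[OF q_nonneg N])
qed

end

section \<open>Bilinear maps on the tensor algebra\<close>

text \<open>Restricted to the tensor algebra because \<open>tprod\<close> need not be additive in
  its second factor when the first is an arbitrary functional.\<close>

definition tbilinear :: "(('k, 'v) tensor \<Rightarrow> ('k, 'v) tensor \<Rightarrow> 'f \<Rightarrow> 'k) \<Rightarrow> bool" where
  "tbilinear G \<longleftrightarrow> (\<forall>s\<in>tensor_algebra scl. \<forall>t\<in>tensor_algebra scl.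
     (\<forall>s'\<in>tensor_algebra scl. G (s + s') t = G s t + G s' t) \<and>
     (\<forall>t'\<in>tensor_algebra scl. G s (t + t') = G s t + G s t') \<and>
     (\<forall>c. G (tscale c s) t = tscale c (G s t)) \<and> (\<forall>c. G s (tscale c t) = tscale c (G s t)))"

lemma tbilinear_sum:
  assumes G: "tbilinear G"
    and a: "\<And>i. i \<in> I \<Longrightarrow> a i \<in> tensor_algebra scl" and b: "\<And>j. j \<in> J \<Longrightarrow> b j \<in> tensor_algebra scl"
  shows "G (\<Sum>i\<in>I. tscale (c i) (a i)) (\<Sum>j\<in>J. tscale (d j) (b j)) =
    (\<Sum>i\<in>I. \<Sum>j\<in>J. tscale (c i * d j) (G (a i) (b j)))"
proof -
  note sub = subspace_tensor_algebra[of scl]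
  have zl: "G 0 t = 0" if "t \<in> tensor_algebra scl" for t
  proof -
    have "G (tscale 0 0) t = tscale 0 (G 0 t)"
      using G that tensors.subspace_0[OF sub] unfolding tbilinear_def by blast
    then show ?thesis by (simp only: tensors.scale_zero_left)
  qed
  have zr: "G t 0 = 0" if "t \<in> tensor_algebra scl" for t
  proof -
    have "G t (tscale 0 0) = tscale 0 (G t 0)"
      using G that tensors.subspace_0[OF sub] unfolding tbilinear_def by blast
    then show ?thesis by (simp only: tensors.scale_zero_left)
  qed
  have l: "G (\<Sum>i\<in>I. tscale (c i) (a i)) t = (\<Sum>i\<in>I. tscale (c i) (G (a i) t))"
    if t: "t \<in> tensor_algebra scl" for t
    using a
  proof (induction I rule: infinite_finite_induct)
    case (insert i I)
    have "(\<Sum>i\<in>I. tscale (c i) (a i)) \<in> tensor_algebra scl" "tscale (c i) (a i) \<in> tensor_algebra scl" "a i \<in> tensor_algebra scl"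
      using insert.prems by (auto intro!: tensors.subspace_sum[OF sub] tensors.subspace_scale[OF sub])
    then have "G (tscale (c i) (a i) + (\<Sum>i\<in>I. tscale (c i) (a i))) t =
        tscale (c i) (G (a i) t) + G (\<Sum>i\<in>I. tscale (c i) (a i)) t"
      using G t by (simp add: tbilinear_def)
    moreover have "G (\<Sum>i\<in>I. tscale (c i) (a i)) t = (\<Sum>i\<in>I. tscale (c i) (G (a i) t))"
      using insert.prems by (intro insert.IH) auto
    ultimately show ?case by (simp only: sum.insert[OF insert.hyps])
  qed (simp_all add: zl t)
  have r: "G s (\<Sum>j\<in>J. tscale (d j) (b j)) = (\<Sum>j\<in>J. tscale (d j) (G s (b j)))"
    if s: "s \<in> tensor_algebra scl" for s
    using b
  proof (induction J rule: infinite_finite_induct)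
    case (insert j J)
    have "(\<Sum>j\<in>J. tscale (d j) (b j)) \<in> tensor_algebra scl" "tscale (d j) (b j) \<in> tensor_algebra scl" "b j \<in> tensor_algebra scl"
      using insert.prems by (auto intro!: tensors.subspace_sum[OF sub] tensors.subspace_scale[OF sub])
    then have "G s (tscale (d j) (b j) + (\<Sum>j\<in>J. tscale (d j) (b j))) =
        tscale (d j) (G s (b j)) + G s (\<Sum>j\<in>J. tscale (d j) (b j))"
      using G s by (simp add: tbilinear_def)
    moreover have "G s (\<Sum>j\<in>J. tscale (d j) (b j)) = (\<Sum>j\<in>J. tscale (d j) (G s (b j)))"
      using insert.prems by (intro insert.IH) auto
    ultimately show ?case by (simp only: sum.insert[OF insert.hyps])
  qed (simp_all add: zr s)
  have "(\<Sum>j\<in>J. tscale (d j) (b j)) \<in> tensor_algebra scl"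
    using b by (intro tensors.subspace_sum[OF sub] tensors.subspace_scale[OF sub])
  then have "G (\<Sum>i\<in>I. tscale (c i) (a i)) (\<Sum>j\<in>J. tscale (d j) (b j)) =
      (\<Sum>i\<in>I. tscale (c i) (G (a i) (\<Sum>j\<in>J. tscale (d j) (b j))))"
    by (rule l)
  also have "\<dots> = (\<Sum>i\<in>I. \<Sum>j\<in>J. tscale (c i * d j) (G (a i) (b j)))"
    by (intro sum.cong refl) (simp only: r a tensors.scale_sum_right tensors.scale_scale)
  finally show ?thesis .
qed

lemma tbilinear_sum':
  assumes "tbilinear G"
    and "\<And>i. i \<in> I \<Longrightarrow> a i \<in> tensor_algebra scl" and "\<And>j. j \<in> J \<Longrightarrow> b j \<in> tensor_algebra scl"
  shows "G (sum a I) (sum b J) = (\<Sum>i\<in>I. \<Sum>j\<in>J. G (a i) (b j))"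
  using tbilinear_sum[OF assms, where c = "\<lambda>_. 1" and d = "\<lambda>_. 1"] by simp

lemma tbilinear_compose:
  "tbilinear G \<Longrightarrow> Vector_Spaces.linear tscale tscale L \<Longrightarrow> tbilinear (\<lambda>s t. L (G s t))"
  by (simp add: tbilinear_def linear_tscale_iff)

lemma tbilinear_precompose:
  assumes "tbilinear G" "Vector_Spaces.linear tscale tscale A" "\<And>t. t \<in> tensor_algebra scl \<Longrightarrow> A t \<in> tensor_algebra scl"
  shows "tbilinear (\<lambda>s t. G (A s) (A t))"
  using assms by (simp add: tbilinear_def linear_tscale_iff)

text \<open>The projective seminorm is an infimum over combinations of pure tensors, so a bilinear
  bound on pure tensors extends with the same constant. The subspace \<open>U\<close> is carried
  along so that the location of the values is read off pure tensors too.\<close>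

lemma tbilinear_bound:
  assumes G: "tbilinear G" and p: "\<And>v. 0 \<le> p v" and K: "K \<ge> 0"
    and U: "tensors.subspace U" "U \<subseteq> tensor_power scl N"
    and pure: "\<And>xs ys. length xs = n \<Longrightarrow> length ys = m \<Longrightarrow> G (tens scl xs) (tens scl ys) \<in> U \<and>
      tensor_seminorm scl N p (G (tens scl xs) (tens scl ys)) \<le> K * (prod_list (map p xs) * prod_list (map p ys))"
    and s: "s \<in> tensor_power scl n" and t: "t \<in> tensor_power scl m"
  shows "G s t \<in> U"
    and "tensor_seminorm scl N p (G s t) \<le> K * (tensor_seminorm scl n p s * tensor_seminorm scl m p t)"
proof -
  have T: "tens scl xs \<in> tensor_algebra scl" for xs
    using tens_in_tensor_power[OF refl] tensor_power_subset by blast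
  have *: "G s t \<in> U \<and> tensor_seminorm scl N p (G s t) \<le> K *
      ((\<Sum>xs\<in>X. norm (c xs) * prod_list (map p xs)) * (\<Sum>ys\<in>Y. norm (d ys) * prod_list (map p ys)))"
    if X: "finite X" "\<forall>xs\<in>X. length xs = n" "s = (\<Sum>xs\<in>X. tscale (c xs) (tens scl xs))"
      and Y: "finite Y" "\<forall>ys\<in>Y. length ys = m" "t = (\<Sum>ys\<in>Y. tscale (d ys) (tens scl ys))" for X c Y d
  proof
    let ?g = "\<lambda>xs ys. tscale (c xs * d ys) (G (tens scl xs) (tens scl ys))"
    have st: "G s t = (\<Sum>xs\<in>X. \<Sum>ys\<in>Y. ?g xs ys)"
      unfolding X(3) Y(3) by (rule tbilinear_sum[OF G T T])
    have gU: "?g xs ys \<in> U" if "xs \<in> X" "ys \<in> Y" for xs ys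
      using pure[of xs ys] X(2) Y(2) that by (simp add: tensors.subspace_scale[OF U(1)])
    show "G s t \<in> U"
      unfolding st by (intro tensors.subspace_sum[OF U(1)] gU)
    have g_le: "tensor_seminorm scl N p (?g xs ys) \<le>
        K * ((norm (c xs) * prod_list (map p xs)) * (norm (d ys) * prod_list (map p ys)))"
      if "xs \<in> X" "ys \<in> Y" for xs ys
    proof -
      have G: "G (tens scl xs) (tens scl ys) \<in> tensor_power scl N"
        "tensor_seminorm scl N p (G (tens scl xs) (tens scl ys)) \<le> K * (prod_list (map p xs) * prod_list (map p ys))"
        using pure[of xs ys] X(2) Y(2) U(2) that by auto
      have "tensor_seminorm scl N p (?g xs ys) = norm (c xs * d ys) * tensor_seminorm scl N p (G (tens scl xs) (tens scl ys))"
        by (rule tensor_seminorm_scale[OF p G(1)])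
      also have "\<dots> \<le> norm (c xs * d ys) * (K * (prod_list (map p xs) * prod_list (map p ys)))"
        by (rule mult_left_mono[OF G(2)]) simp
      finally show ?thesis by (simp add: norm_mult mult_ac)
    qed
    have "tensor_seminorm scl N p (G s t) \<le> (\<Sum>xs\<in>X. \<Sum>ys\<in>Y.
        K * ((norm (c xs) * prod_list (map p xs)) * (norm (d ys) * prod_list (map p ys))))"
      unfolding st using gU U(2)
      by (intro tensor_seminorm_sum[OF p] g_le tensors.subspace_sum[OF subspace_tensor_power]) auto
    also have "\<dots> = K * ((\<Sum>xs\<in>X. norm (c xs) * prod_list (map p xs)) * (\<Sum>ys\<in>Y. norm (d ys) * prod_list (map p ys)))"
      unfolding sum_product by (simp only: sum_distrib_left)
    finally show "tensor_seminorm scl N p (G s t) \<le> \<dots>" .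
  qed
  obtain X c where X: "finite X" "\<forall>xs\<in>X. length xs = n" "s = (\<Sum>xs\<in>X. tscale (c xs) (tens scl xs))"
    using tensor_powerE[OF s] by blast
  obtain Y d where Y: "finite Y" "\<forall>ys\<in>Y. length ys = m" "t = (\<Sum>ys\<in>Y. tscale (d ys) (tens scl ys))"
    using tensor_powerE[OF t] by blast
  show "G s t \<in> U" using *[OF X Y] by blast
  let ?s = "tensor_seminorm scl n p s" and ?t = "tensor_seminorm scl m p t"
  \<comment> \<open>The infima need not be attained; representations within \<open>e\<close> of each
    are used, and \<open>e\<close> tends to 0 from the right.\<close>
  have "((\<lambda>e. K * ((?s + e) * (?t + e))) \<longlongrightarrow> K * ((?s + 0) * (?t + 0))) (at_right 0)"
    by (intro tendsto_intros)
  moreover have "tensor_seminorm scl N p (G s t) \<le> K * ((?s + e) * (?t + e))" if e: "e > 0" for e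
  proof -
    obtain X c where X: "finite X" "\<forall>xs\<in>X. length xs = n" "s = (\<Sum>xs\<in>X. tscale (c xs) (tens scl xs))"
      "(\<Sum>xs\<in>X. norm (c xs) * prod_list (map p xs)) < ?s + e"
      using tensor_seminorm_approx[OF s e] by blast
    obtain Y d where Y: "finite Y" "\<forall>ys\<in>Y. length ys = m" "t = (\<Sum>ys\<in>Y. tscale (d ys) (tens scl ys))"
      "(\<Sum>ys\<in>Y. norm (d ys) * prod_list (map p ys)) < ?t + e"
      using tensor_seminorm_approx[OF t e] by blast
    have "tensor_seminorm scl N p (G s t) \<le> K *
      ((\<Sum>xs\<in>X. norm (c xs) * prod_list (map p xs)) * (\<Sum>ys\<in>Y. norm (d ys) * prod_list (map p ys)))"
      using *[OF X(1-3) Y(1-3)] by blast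
    also have "\<dots> \<le> K * ((?s + e) * (?t + e))"
    proof (intro mult_left_mono mult_mono K)
      show "0 \<le> ?s + e" using tensor_seminorm_nonneg[OF p s] e by simp
      show "0 \<le> (\<Sum>ys\<in>Y. norm (d ys) * prod_list (map p ys))"
        by (intro sum_nonneg mult_nonneg_nonneg prod_list_nonneg) (auto simp: p)
    qed (use X(4) Y(4) in auto)
    finally show ?thesis .
  qed
  then have "\<forall>\<^sub>F e in at_right 0. tensor_seminorm scl N p (G s t) \<le> K * ((?s + e) * (?t + e))"
    by (intro eventually_at_right_less[THEN eventually_mono])
  ultimately have "tensor_seminorm scl N p (G s t) \<le> K * ((?s + 0) * (?t + 0))"
    by (intro tendsto_lowerbound[of _ _ "at_right 0"]) auto
  then show "tensor_seminorm scl N p (G s t) \<le> K * (?s * ?t)" by simp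
qed

section \<open>Linearity of tensors in the forms that they evaluate\<close>

lemma multilin_add: "multilin scl f \<Longrightarrow> multilin scl g \<Longrightarrow> multilin scl (\<lambda>xs. f xs + g xs)"
proof -
  have "lin f \<Longrightarrow> lin g \<Longrightarrow> lin (\<lambda>v. f v + g v)" for f g
    by (simp add: lin_iff algebra_simps)
  then show "multilin scl f \<Longrightarrow> multilin scl g \<Longrightarrow> multilin scl (\<lambda>xs. f xs + g xs)"
    unfolding multilin_def by blast
qed

lemma multilin_cmult: "multilin scl f \<Longrightarrow> multilin scl (\<lambda>xs. c * f xs)"
  by (simp add: multilin_def lin_cmult)

text \<open>An arbitrary functional need not be additive. Combinations of evaluations are, but only
  on multilinear forms, because \<open>tens\<close> sends all other forms to 0.\<close>

lemma tensor_algebra_add_forms: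
  assumes "s \<in> tensor_algebra scl"
  shows "multilin scl f \<Longrightarrow> multilin scl g \<Longrightarrow> s (\<lambda>xs. f xs + g xs) = s f + s g"
    and "multilin scl f \<Longrightarrow> s (\<lambda>xs. c * f xs) = c * s f"
proof -
  have ev: "(tscale d (tens scl ys) + t) h = d * h ys + t h" if "multilin scl h" for d ys t h
    using that by (simp add: tens_def tscale_def)
  show "s (\<lambda>xs. f xs + g xs) = s f + s g" if m: "multilin scl f" "multilin scl g"
    using assms
  proof (induction s rule: tensor_algebra_induct)
    case (step d ys t)
    show ?case
      unfolding ev[OF m(1)] ev[OF m(2)] ev[OF multilin_add[OF m]] step.IH by (simp add: distrib_left)
  qed simp
  show "s (\<lambda>xs. c * f xs) = c * s f" if m: "multilin scl f"
    using assms
  proof (induction s rule: tensor_algebra_induct)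
    case (step d ys t)
    show ?case
      unfolding ev[OF m] ev[OF multilin_cmult[OF m]] step.IH by (simp add: distrib_left)
  qed simp
qed

text \<open>In \<open>tprod\<close> the left factor is evaluated at
  \<open>xs \<mapsto> t (g xs)\<close>; linearity in \<open>t\<close> relies on that form being
  multilinear.\<close>

lemma multilin_tensor_param:
  assumes "t \<in> tensor_algebra scl" "multilin2 scl g" shows "multilin scl (\<lambda>xs. t (g xs))"
  using assms(1)
proof (induction t rule: tensor_algebra_induct)
  case zero
  show ?case using multilin_0 by simp
next
  case (step c ys t)
  have "multilin scl (g xs)" "multilin scl (\<lambda>xs. g xs ys)" for xs
    using assms(2) by (auto simp: multilin2_def)
  then have "multilin scl (\<lambda>xs. c * g xs ys + t (g xs))"
    using step.IH by (intro multilin_add multilin_cmult)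
  then show ?case
    using \<open>\<And>xs. multilin scl (g xs)\<close> by (simp add: tens_def tscale_def)
qed

lemma tbilinear_tprod: "tbilinear (tprod scl)"
  unfolding tbilinear_def
proof (intro ballI conjI allI)
  fix s t assume s: "s \<in> tensor_algebra scl" and t: "t \<in> tensor_algebra scl"
  show "tprod scl (s + s') t = tprod scl s t + tprod scl s' t" for s'
    by (auto simp: tprod_def fun_eq_iff)
  show "tprod scl (tscale c s) t = tscale c (tprod scl s t)" for c
    by (auto simp: tprod_def fun_eq_iff tscale_def)
  show "tprod scl s (t + t') = tprod scl s t + tprod scl s t'" if t': "t' \<in> tensor_algebra scl" for t'
  proof
    fix g
    show "tprod scl s (t + t') g = (tprod scl s t + tprod scl s t') g"
      using tensor_algebra_add_forms(1)[OF s multilin_tensor_param[OF t, of g] multilin_tensor_param[OF t', of g]]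
      by (simp add: tprod_def)
  qed
  show "tprod scl s (tscale c t) = tscale c (tprod scl s t)" for c
  proof
    fix g
    show "tprod scl s (tscale c t) g = tscale c (tprod scl s t) g"
      using tensor_algebra_add_forms(2)[OF s multilin_tensor_param[OF t, of g]]
      by (simp add: tprod_def tscale_def)
  qed
qed


section \<open>Symmetrization\<close>

lemma homs_hparts: "length es = length xs \<Longrightarrow> homs es (map2 (hpart V) es xs)"
  by (simp add: list_all2_conv_all_nth hpart_props(1))

lemma hpart_sum: "hpart V False v + hpart V True v = v"
proof -
  have "hpart V True v = v - hpart V False v"
    by (rule hpart_eqI) (use hpart_props[where e = False and v = v] in simp_all)
  then show ?thesis by simp
qed

lemma sym_prod_homs_eq:
  assumes "homs es vs"
  shows "sym_prod scl V vs = (\<Sum>\<sigma> | \<sigma> permutes {..<length vs}.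
     tscale (1 / fact (length vs) * koszul es \<sigma>) (tens scl (permute_list \<sigma> vs)))"
proof
  fix f
  show "sym_prod scl V vs f = (\<Sum>\<sigma> | \<sigma> permutes {..<length vs}.
     tscale (1 / fact (length vs) * koszul es \<sigma>) (tens scl (permute_list \<sigma> vs))) f"
  proof (cases "multilin scl f")
    case True
    then show ?thesis
      by (simp add: sym_prod_homs[OF assms] sym_eval_def sum_fun_apply tscale_apply tens_eval
          sum_distrib_left mult.assoc)
  next
    case False
    then show ?thesis
      by (simp add: symmetrize_tens sum_fun_apply tscale_apply tens_def)
  qed
qed

text \<open>Koszul signs live on homogeneous words, so statements are proved there and then summed
  over the parity patterns of a word.\<close>

lemma sym_prod_eq_sum:
  "sym_prod scl V xs = (\<Sum>es | length es = length xs. sym_prod scl V (map2 (hpart V) es xs))"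
proof
  fix f
  show "sym_prod scl V xs f = (\<Sum>es | length es = length xs. sym_prod scl V (map2 (hpart V) es xs)) f"
  proof (cases "multilin scl f")
    case True
    then show ?thesis
      by (simp add: sum_fun_apply symmetrize_tens[of xs] hom_ext_def sym_prod_homs[OF homs_hparts])
  next
    case False
    then show ?thesis by (simp add: sum_fun_apply symmetrize_tens)
  qed
qed

lemma sym_prod_in_tensor_power: "sym_prod scl V xs \<in> tensor_power scl (length xs)"
proof -
  have "sym_prod scl V (map2 (hpart V) es xs) \<in> tensor_power scl (length xs)"
    if "length es = length xs" for es
    unfolding sym_prod_homs_eq[OF homs_hparts[OF that]]
    using that
    by (intro tensors.subspace_sum[OF subspace_tensor_power] tensors.subspace_scale[OF subspace_tensor_power]
        tens_in_tensor_power) simp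
  then show ?thesis
    by (subst sym_prod_eq_sum) (intro tensors.subspace_sum[OF subspace_tensor_power], simp)
qed

lemma tens_in_algebra: "tens scl xs \<in> tensor_algebra scl"
  using tens_in_tensor_power[OF refl] tensor_power_subset by blast

lemma sym_prod_in_algebra: "sym_prod scl V xs \<in> tensor_algebra scl"
  using sym_prod_in_tensor_power tensor_power_subset by blast

lemma symmetrize_scale_add:
  "symmetrize scl V (tscale c (tens scl xs) + t) = tscale c (sym_prod scl V xs) + symmetrize scl V t"
  using linear_symmetrize[of scl V] by (simp only: linear_tscale_iff sym_prod_def)

lemma symmetrize_zero: "symmetrize scl V 0 = 0"
  using linear_tscale_sum'[OF linear_symmetrize, where I = "{}"] by (simp only: sum.empty)

lemma symmetrize_in_algebra: "t \<in> tensor_algebra scl \<Longrightarrow> symmetrize scl V t \<in> tensor_algebra scl"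
proof (induction t rule: tensor_algebra_induct)
  case (step c xs t)
  then show ?case
    unfolding symmetrize_scale_add
    by (intro tensors.subspace_add tensors.subspace_scale subspace_tensor_algebra sym_prod_in_algebra)
qed (simp only: symmetrize_zero tensors.subspace_0[OF subspace_tensor_algebra])

text \<open>Permuting a homogeneous word multiplies its symmetric product by the Koszul sign. This
  cancels the sign in the average, and \<open>n!\<close> equal terms remain.\<close>

lemma symmetrize_sym_prod: "symmetrize scl V (sym_prod scl V xs) = sym_prod scl V xs"
proof -
  have "symmetrize scl V (sym_prod scl V vs) = sym_prod scl V vs" if h: "homs es vs" for es vs
  proof -
    let ?P = "{\<sigma>. \<sigma> permutes {..<length vs}}"
    have "symmetrize scl V (sym_prod scl V vs) =
        (\<Sum>\<sigma>\<in>?P. tscale (1 / fact (length vs) * koszul es \<sigma>) (sym_prod scl V (permute_list \<sigma> vs)))"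
      by (subst sym_prod_homs_eq[OF h]) (simp only: linear_tscale_sum[OF linear_symmetrize] sym_prod_def)
    also have "\<dots> = (\<Sum>\<sigma>\<in>?P. tscale (1 / fact (length vs)) (sym_prod scl V vs))"
    proof (rule sum.cong[OF refl], clarify)
      fix \<sigma> assume s: "\<sigma> permutes {..<length vs}"
      have "sym_prod scl V (permute_list \<sigma> vs) = tscale (koszul es \<sigma>) (sym_prod scl V vs)"
        by (rule ext) (simp only: sym_prod_permute[OF h s] tscale_apply)
      then show "tscale (1 / fact (length vs) * koszul es \<sigma>) (sym_prod scl V (permute_list \<sigma> vs)) =
          tscale (1 / fact (length vs)) (sym_prod scl V vs)"
        by (simp only: tensors.scale_scale mult.assoc koszul_sq mult_1_right)
    qed
    also have "\<dots> = tscale (of_nat (card ?P) * (1 / fact (length vs))) (sym_prod scl V vs)"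
      by (simp only: tensors.sum_constant_scale tensors.scale_scale)
    also have "\<dots> = sym_prod scl V vs"
      by (simp add: card_permutations)
    finally show ?thesis .
  qed
  then have "symmetrize scl V (sym_prod scl V (map2 (hpart V) es xs)) = sym_prod scl V (map2 (hpart V) es xs)"
    if "length es = length xs" for es
    using homs_hparts[OF that] by blast
  then show ?thesis
    by (subst (1 2) sym_prod_eq_sum) (simp add: linear_tscale_sum'[OF linear_symmetrize])
qed

lemma symmetrize_idem: "t \<in> tensor_algebra scl \<Longrightarrow> symmetrize scl V (symmetrize scl V t) = symmetrize scl V t"
proof (induction t rule: tensor_algebra_induct)
  case (step c xs t)
  have "symmetrize scl V (tscale c s + s') = tscale c (symmetrize scl V s) + symmetrize scl V s'" for s s'
    using linear_symmetrize[of scl V] by (simp only: linear_tscale_iff)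
  then show ?case
    unfolding symmetrize_scale_add by (simp only: symmetrize_sym_prod step.IH)
qed (simp only: symmetrize_zero)

lemma sym_algebra_subset: "sym_algebra scl V \<subseteq> tensor_algebra scl"
  using symmetrize_in_algebra by (auto simp: sym_algebra_def)

lemma symmetrize_sym_algebra: "a \<in> sym_algebra scl V \<Longrightarrow> symmetrize scl V a = a"
  using symmetrize_idem by (auto simp: sym_algebra_def)

lemma sym_prod_in_sym_algebra: "sym_prod scl V xs \<in> sym_algebra scl V"
  unfolding sym_prod_def sym_algebra_def by (rule imageI[OF tens_in_algebra])

lemma subspace_sym_algebra: "tensors.subspace (sym_algebra scl V)"
  unfolding tensors.subspace_def sym_algebra_def
proof (intro conjI ballI allI)
  have lin: "symmetrize scl V (s + t) = symmetrize scl V s + symmetrize scl V t"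
    "symmetrize scl V (tscale c s) = tscale c (symmetrize scl V s)" for s t c
    using linear_symmetrize[of scl V] by (simp_all only: linear_tscale_iff)
  show "0 \<in> symmetrize scl V ` tensor_algebra scl"
    by (rule image_eqI[where x = 0], rule symmetrize_zero[symmetric],
        rule tensors.subspace_0[OF subspace_tensor_algebra])
  fix x assume "x \<in> symmetrize scl V ` tensor_algebra scl"
  then obtain s where s: "x = symmetrize scl V s" "s \<in> tensor_algebra scl" by blast
  show "tscale c x \<in> symmetrize scl V ` tensor_algebra scl" for c
    unfolding s(1) lin(2)[symmetric]
    by (intro imageI tensors.subspace_scale[OF subspace_tensor_algebra] s)
  fix y assume "y \<in> symmetrize scl V ` tensor_algebra scl"
  then obtain t where t: "y = symmetrize scl V t" "t \<in> tensor_algebra scl" by blast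
  show "x + y \<in> symmetrize scl V ` tensor_algebra scl"
    unfolding s(1) t(1) lin(1)[symmetric]
    by (intro imageI tensors.subspace_add[OF subspace_tensor_algebra] s t)
qed

section \<open>Symmetrization is a contraction for graded seminorms\<close>

context
  fixes p :: "'v \<Rightarrow> real"
  assumes p_nonneg: "0 \<le> p v" and p_graded: "p v = p (hpart V False v) + p (hpart V True v)"
begin

text \<open>Multiply out the product of \<open>p (hpart V False x) + p (hpart V True x)\<close> over
  the letters \<open>x\<close>. This is why graded seminorms are chosen: all parity patterns
  together cost no more than the word.\<close>

lemma sum_prod_hparts:
  "(\<Sum>es | length es = length xs. prod_list (map p (map2 (hpart V) es xs))) = prod_list (map p xs)"
proof (induction xs)
  case Nil
  then show ?case by simp
next
  case (Cons x xs)
  let ?L = "{es :: bool list. length es = length xs}"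
  have fin: "finite ?L" using finite_lists_length_eq[of "UNIV :: bool set" "length xs"] by simp
  have L: "{es :: bool list. length es = length (x # xs)} = Cons False ` ?L \<union> Cons True ` ?L"
    by (auto simp: length_Suc_conv image_iff)
  have "(\<Sum>es | length es = length (x # xs). prod_list (map p (map2 (hpart V) es (x # xs)))) =
      (\<Sum>es\<in>?L. p (hpart V False x) * prod_list (map p (map2 (hpart V) es xs))) +
      (\<Sum>es\<in>?L. p (hpart V True x) * prod_list (map p (map2 (hpart V) es xs)))"
    unfolding L using fin by (subst sum.union_disjoint) (auto simp: sum.reindex)
  also have "\<dots> = prod_list (map p (x # xs))"
    by (simp only: sum_distrib_left[symmetric] Cons.IH distrib_right[symmetric] p_graded[symmetric]
        list.map prod_list.Cons)
  finally show ?case .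
qed

lemma prod_list_permute: "\<sigma> permutes {..<length vs} \<Longrightarrow> prod_list (map p (permute_list \<sigma> vs)) = prod_list (map p vs)"
  by (simp add: prod_mset_prod_list[symmetric] mset_map[symmetric] del: mset_map)
    (simp add: permute_list_map[symmetric])

text \<open>For a homogeneous word this is an average, up to signs, of \<open>n!\<close> tensors of
  equal cost; the parity patterns are then collected by \<open>sum_prod_hparts\<close>.\<close>

lemma tensor_seminorm_sym_prod:
  "tensor_seminorm scl (length xs) p (sym_prod scl V xs) \<le> prod_list (map p xs)"
proof -
  have homs_le: "tensor_seminorm scl (length vs) p (sym_prod scl V vs) \<le> prod_list (map p vs)"
    if h: "homs es vs" for es vs
  proof -
    let ?P = "{\<sigma>. \<sigma> permutes {..<length vs}}"
    have "tensor_seminorm scl (length vs) p (sym_prod scl V vs) \<le> (\<Sum>\<sigma>\<in>?P. 1 / fact (length vs) * prod_list (map p vs))"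
      unfolding sym_prod_homs_eq[OF h]
    proof (rule tensor_seminorm_sum[OF p_nonneg])
      fix \<sigma> assume s: "\<sigma> \<in> ?P"
      have t: "tens scl (permute_list \<sigma> vs) \<in> tensor_power scl (length vs)"
        by (rule tens_in_tensor_power) simp
      then show "tscale (1 / fact (length vs) * koszul es \<sigma>) (tens scl (permute_list \<sigma> vs)) \<in> tensor_power scl (length vs)"
        by (rule tensors.subspace_scale[OF subspace_tensor_power])
      have n: "norm (1 / fact (length vs) * koszul es \<sigma> :: 'k) = 1 / fact (length vs)"
        by (simp add: koszul_def norm_mult norm_power norm_divide norm_fact)
      have "tensor_seminorm scl (length vs) p (tens scl (permute_list \<sigma> vs)) \<le> prod_list (map p (permute_list \<sigma> vs))"
        by (rule tensor_seminorm_tens[OF p_nonneg]) simp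
      then show "tensor_seminorm scl (length vs) p (tscale (1 / fact (length vs) * koszul es \<sigma>) (tens scl (permute_list \<sigma> vs)))
          \<le> 1 / fact (length vs) * prod_list (map p vs)"
        using s unfolding tensor_seminorm_scale[OF p_nonneg t] n
        by (intro mult_left_mono) (simp_all add: prod_list_permute)
    qed
    also have "\<dots> = prod_list (map p vs)" by (simp add: card_permutations)
    finally show ?thesis .
  qed
  have "tensor_seminorm scl (length xs) p (sym_prod scl V xs) \<le>
      (\<Sum>es | length es = length xs. prod_list (map p (map2 (hpart V) es xs)))"
  proof (subst sym_prod_eq_sum, rule tensor_seminorm_sum[OF p_nonneg])
    fix es :: "bool list" assume "es \<in> {es. length es = length xs}"
    then have l: "length es = length xs" by simp
    show "sym_prod scl V (map2 (hpart V) es xs) \<in> tensor_power scl (length xs)"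
      using sym_prod_in_tensor_power[of "map2 (hpart V) es xs"] l by simp
    show "tensor_seminorm scl (length xs) p (sym_prod scl V (map2 (hpart V) es xs)) \<le> prod_list (map p (map2 (hpart V) es xs))"
      using homs_le[OF homs_hparts[OF l]] l by simp
  qed
  then show ?thesis by (simp only: sum_prod_hparts)
qed

lemma prod_list_omit: "k < length vs \<Longrightarrow> p (vs ! k) * prod_list (map p (omit k vs)) = prod_list (map p vs)"
  by (subst (3) id_take_nth_drop[of k vs]) (simp_all add: omit_def mult_ac)

end


section \<open>Estimates for the star product\<close>

text \<open>The part of the symmetric algebra that contains \<open>\<mu> (P\<^sub>\<Lambda>\<^sup>k (a \<otimes> b))\<close> for \<open>a\<close> of degree \<open>n\<close>
  and \<open>b\<close> of degree \<open>m\<close>.\<close>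

definition star_range :: "nat \<Rightarrow> nat \<Rightarrow> nat \<Rightarrow> ('k, 'v) tensor set" where
  "star_range n m k = (if k \<le> n \<and> k \<le> m then tensor_power scl (n + m - 2 * k) \<inter> sym_algebra scl V else {0})"

lemma subspace_star_range: "tensors.subspace (star_range n m k)"
  by (simp only: star_range_def tensors.subspace_inter[OF subspace_tensor_power subspace_sym_algebra]
      tensors.subspace_single_0 split: if_split) simp

lemma star_range_subset:
  "star_range n m k \<subseteq> tensor_power scl (n + m - 2 * k)" "star_range n m k \<subseteq> sym_algebra scl V"
  using tensors.subspace_0[OF subspace_tensor_power, of scl "n + m - 2 * k"]
    tensors.subspace_0[OF subspace_sym_algebra]
  by (auto simp only: star_range_def split: if_splits)

lemma tbilinear_contraction_power: "tbilinear (\<lambda>s t. sym_mult scl V ((P_op scl V \<Lambda> ^^ k) (tprod scl s t)))"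
  by (intro tbilinear_compose[OF tbilinear_tprod] linear_tscale_compose[OF linear_tscale_funpow]
      linear_P_op linear_sym_mult)

lemma tbilinear_star_coeff: "tbilinear (star_coeff scl V \<Lambda> k)"
  unfolding star_coeff_def[abs_def] by (rule tbilinear_contraction_power)

context
  fixes \<Lambda> :: "'v \<Rightarrow> 'v \<Rightarrow> 'k" and p :: "'v \<Rightarrow> real"
  assumes \<Lambda>: "continuous_bilinear_form scl \<Lambda>" and \<Lambda>_le: "norm (\<Lambda> v w) \<le> p v * p w"
    and p_nonneg: "0 \<le> p v" and p_graded: "p v = p (hpart V False v) + p (hpart V True v)"
begin

text \<open>The formula for \<open>P_op\<close> has one summand per pair of omitted letters. The
  bound on \<open>\<Lambda>\<close> by \<open>p\<close> of these letters restores the omitted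
  factors, so each summand costs the full product, and the number of pairs times the constant for
  shorter words gives the next falling factorials. Membership in \<open>star_range\<close> records
  the degree, and the vanishing once a factor is exhausted.\<close>

lemma contraction_power_homs:
  assumes "homs es vs" "homs ds ws"
  shows "sym_mult scl V ((P_op scl V \<Lambda> ^^ k) (tprod scl (sym_prod scl V vs) (sym_prod scl V ws))) \<in>
      star_range (length vs) (length ws) k \<and>
    tensor_seminorm scl (length vs + length ws - 2 * k) p
      (sym_mult scl V ((P_op scl V \<Lambda> ^^ k) (tprod scl (sym_prod scl V vs) (sym_prod scl V ws)))) \<le>
    ffact (length vs) k * ffact (length ws) k * (prod_list (map p vs) * prod_list (map p ws))"
  using assms
proof (induction k arbitrary: es vs ds ws)
  case 0
  let ?G = "\<lambda>s t. sym_mult scl V (tprod scl s t)"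
  let ?U = "star_range (length vs) (length ws) 0" and ?N = "length vs + length ws"
  have U: "?U \<subseteq> tensor_power scl ?N" using star_range_subset(1)[of "length vs" "length ws" 0] by simp
  \<comment> \<open>The factors are symmetric products rather than pure tensors. Multiplication is
    bounded first on pure tensors, where it is symmetrized concatenation, and
    \<open>tbilinear_bound\<close> transfers the bound.\<close>
  have bil: "tbilinear ?G" by (intro tbilinear_compose[OF tbilinear_tprod] linear_sym_mult)
  have pure: "?G (tens scl xs) (tens scl ys) \<in> ?U \<and>
      tensor_seminorm scl ?N p (?G (tens scl xs) (tens scl ys)) \<le> 1 * (prod_list (map p xs) * prod_list (map p ys))"
    if l: "length xs = length vs" "length ys = length ws" for xs ys
    unfolding sym_mult_tens sym_prod_def[symmetric]
    using sym_prod_in_tensor_power[of "xs @ ys"] sym_prod_in_sym_algebra[of "xs @ ys"]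
      tensor_seminorm_sym_prod[OF p_nonneg p_graded, of "xs @ ys"] l
    by (simp add: star_range_def)
  note bound = tbilinear_bound[OF bil p_nonneg zero_le_one subspace_star_range U pure
      sym_prod_in_tensor_power sym_prod_in_tensor_power]
  have "tensor_seminorm scl ?N p (?G (sym_prod scl V vs) (sym_prod scl V ws)) \<le>
      tensor_seminorm scl (length vs) p (sym_prod scl V vs) * tensor_seminorm scl (length ws) p (sym_prod scl V ws)"
    using bound(2) by simp
  also have "\<dots> \<le> prod_list (map p vs) * prod_list (map p ws)"
    by (intro mult_mono tensor_seminorm_sym_prod[OF p_nonneg p_graded] prod_list_nonneg
        tensor_seminorm_nonneg[OF p_nonneg] sym_prod_in_tensor_power) (auto simp: p_nonneg)
  finally show ?case using bound(1) by (simp add: ffact_def)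
next
  case (Suc k)
  let ?n = "length vs" and ?m = "length ws"
  let ?L = "\<lambda>t. sym_mult scl V ((P_op scl V \<Lambda> ^^ k) t)"
  let ?t = "\<lambda>i j. tprod scl (sym_prod scl V (omit i vs)) (sym_prod scl V (omit j ws))"
  define c where "c i j = (- 1) ^ (of_bool (es ! i) * (\<Sum>k\<in>{i<..<?n}. of_bool (es ! k)) +
      of_bool (ds ! j) * (\<Sum>k<j. of_bool (ds ! k))) * \<Lambda> (vs ! i) (ws ! j)" for i j
  have c: "norm (c i j) \<le> p (vs ! i) * p (ws ! j)" for i j
    using \<Lambda>_le by (simp add: c_def norm_mult norm_power)
  have lin: "Vector_Spaces.linear tscale tscale ?L"
    by (intro linear_tscale_compose[OF linear_tscale_funpow] linear_P_op linear_sym_mult)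
  let ?F = "sym_mult scl V ((P_op scl V \<Lambda> ^^ Suc k) (tprod scl (sym_prod scl V vs) (sym_prod scl V ws)))"
  \<comment> \<open>The contraction applied first is split off, so that the remaining
    \<open>k\<close> act on shorter homogeneous words.\<close>
  have "?F = ?L (\<Sum>i<?n. \<Sum>j<?m. tscale (c i j) (?t i j))"
    unfolding funpow_Suc_right o_apply P_op_sym_prod[OF \<Lambda> Suc.prems] contraction_def c_def ..
  then have F: "?F = (\<Sum>i<?n. \<Sum>j<?m. tscale (c i j) (?L (?t i j)))"
    using lin[unfolded linear_tscale_iff] by (simp only: linear_tscale_sum'[OF lin])
  have IH: "?L (?t i j) \<in> star_range ?n ?m (Suc k)"
    "tensor_seminorm scl (?n + ?m - 2 * Suc k) p (?L (?t i j)) \<le>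
      ffact (?n - 1) k * ffact (?m - 1) k * (prod_list (map p (omit i vs)) * prod_list (map p (omit j ws)))"
    if ij: "i < ?n" "j < ?m" for i j
  proof -
    have "star_range (?n - 1) (?m - 1) k = star_range ?n ?m (Suc k)" "?n - 1 + (?m - 1) - 2 * k = ?n + ?m - 2 * Suc k"
      using ij by (auto simp: star_range_def)
    then show "?L (?t i j) \<in> star_range ?n ?m (Suc k)"
      "tensor_seminorm scl (?n + ?m - 2 * Suc k) p (?L (?t i j)) \<le>
      ffact (?n - 1) k * ffact (?m - 1) k * (prod_list (map p (omit i vs)) * prod_list (map p (omit j ws)))"
      using Suc.IH[OF homs_omit[OF Suc.prems(1) ij(1)] homs_omit[OF Suc.prems(2) ij(2)]] ij
      by (simp_all only: length_omit)
  qed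
  have mem: "tscale (c i j) (?L (?t i j)) \<in> star_range ?n ?m (Suc k)" if "i < ?n" "j < ?m" for i j
    by (rule tensors.subspace_scale[OF subspace_star_range IH(1)[OF that]])
  have "?F \<in> star_range ?n ?m (Suc k)"
    unfolding F by (intro tensors.subspace_sum[OF subspace_star_range] mem) simp_all
  moreover have "tensor_seminorm scl (?n + ?m - 2 * Suc k) p ?F \<le>
      (\<Sum>i<?n. \<Sum>j<?m. ffact (?n - 1) k * ffact (?m - 1) k * (prod_list (map p vs) * prod_list (map p ws)))"
    unfolding F
  proof (intro tensor_seminorm_sum[OF p_nonneg] tensors.subspace_sum[OF subspace_tensor_power])
    fix i j assume "i \<in> {..<?n}" "j \<in> {..<?m}"
    then have ij: "i < ?n" "j < ?m" by auto
    then show "tscale (c i j) (?L (?t i j)) \<in> tensor_power scl (?n + ?m - 2 * Suc k)"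
      using mem[OF ij] star_range_subset(1) by blast
    have "?L (?t i j) \<in> tensor_power scl (?n + ?m - 2 * Suc k)"
      using IH(1)[OF ij] star_range_subset(1) by blast
    then have "tensor_seminorm scl (?n + ?m - 2 * Suc k) p (tscale (c i j) (?L (?t i j))) =
        norm (c i j) * tensor_seminorm scl (?n + ?m - 2 * Suc k) p (?L (?t i j))"
      by (rule tensor_seminorm_scale[OF p_nonneg])
    also have "\<dots> \<le> (p (vs ! i) * p (ws ! j)) * (ffact (?n - 1) k * ffact (?m - 1) k *
        (prod_list (map p (omit i vs)) * prod_list (map p (omit j ws))))"
      by (intro mult_mono c IH(2) ij mult_nonneg_nonneg p_nonneg
          tensor_seminorm_nonneg[OF p_nonneg] \<open>?L (?t i j) \<in> tensor_power scl (?n + ?m - 2 * Suc k)\<close>)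
    also have "\<dots> = ffact (?n - 1) k * ffact (?m - 1) k *
        ((p (vs ! i) * prod_list (map p (omit i vs))) * (p (ws ! j) * prod_list (map p (omit j ws))))"
      by (simp only: mult_ac)
    also have "\<dots> = ffact (?n - 1) k * ffact (?m - 1) k * (prod_list (map p vs) * prod_list (map p ws))"
      by (simp only: prod_list_omit[OF p_nonneg p_graded ij(1)] prod_list_omit[OF p_nonneg p_graded ij(2)])
    finally show "tensor_seminorm scl (?n + ?m - 2 * Suc k) p (tscale (c i j) (?L (?t i j))) \<le> \<dots>" .
  qed (use mem star_range_subset(1) in blast)
  moreover have "(\<Sum>i<?n. \<Sum>j<?m. ffact (?n - 1) k * ffact (?m - 1) k * (prod_list (map p vs) * prod_list (map p ws))) \<le>
      ffact ?n (Suc k) * ffact ?m (Suc k) * (prod_list (map p vs) * prod_list (map p ws))"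
  \<comment> \<open>\<open>ffact_Suc\<close> asks for a nonzero length; with an empty word the
    double sum is empty.\<close>
  proof (cases "?n = 0 \<or> ?m = 0")
    case True
    have "0 \<le> ffact ?n (Suc k) * ffact ?m (Suc k) * (prod_list (map p vs) * prod_list (map p ws))"
      by (intro mult_nonneg_nonneg ffact_nonneg prod_list_nonneg) (auto simp: p_nonneg)
    then show ?thesis using True by (elim disjE) simp_all
  next
    case False
    then show ?thesis by (simp add: ffact_Suc)
  qed
  ultimately show ?case by linarith
qed

text \<open>Pure tensors are in general not symmetric, so the representations behind the projective
  seminorm leave the symmetric algebra. Composing with the symmetrizer gives a map that can be
  bounded on pure tensors and that agrees with \<open>star_coeff\<close> on symmetric
  arguments.\<close>

lemma star_coeff_bound:
  assumes s: "s \<in> tensor_power scl n" and t: "t \<in> tensor_power scl m"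
  shows "star_coeff scl V \<Lambda> k (symmetrize scl V s) (symmetrize scl V t) \<in> star_range n m k"
    and "tensor_seminorm scl (n + m - 2 * k) p (star_coeff scl V \<Lambda> k (symmetrize scl V s) (symmetrize scl V t)) \<le>
      ffact n k * ffact m k * (tensor_seminorm scl n p s * tensor_seminorm scl m p t)"
proof -
  let ?G = "star_coeff scl V \<Lambda> k"
  have bil: "tbilinear (\<lambda>s t. ?G (symmetrize scl V s) (symmetrize scl V t))"
    by (rule tbilinear_precompose[OF tbilinear_star_coeff linear_symmetrize symmetrize_in_algebra])
  have pure: "?G (symmetrize scl V (tens scl xs)) (symmetrize scl V (tens scl ys)) \<in> star_range n m k \<and>
      tensor_seminorm scl (n + m - 2 * k) p (?G (symmetrize scl V (tens scl xs)) (symmetrize scl V (tens scl ys))) \<le>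
      ffact n k * ffact m k * (prod_list (map p xs) * prod_list (map p ys))"
    if l: "length xs = n" "length ys = m" for xs ys
  proof -
    let ?E = "{es :: bool list. length es = n}" and ?D = "{ds :: bool list. length ds = m}"
    let ?g = "\<lambda>es ds. ?G (sym_prod scl V (map2 (hpart V) es xs)) (sym_prod scl V (map2 (hpart V) ds ys))"
    have xs: "sym_prod scl V xs = (\<Sum>es\<in>?E. sym_prod scl V (map2 (hpart V) es xs))"
      and ys: "sym_prod scl V ys = (\<Sum>ds\<in>?D. sym_prod scl V (map2 (hpart V) ds ys))"
      using sym_prod_eq_sum[of xs] sym_prod_eq_sum[of ys] by (simp_all only: l)
    have "?G (sym_prod scl V xs) (sym_prod scl V ys) = (\<Sum>es\<in>?E. \<Sum>ds\<in>?D. ?g es ds)"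
      by (subst xs, subst ys) (rule tbilinear_sum'[OF tbilinear_star_coeff sym_prod_in_algebra sym_prod_in_algebra])
    then have G: "?G (symmetrize scl V (tens scl xs)) (symmetrize scl V (tens scl ys)) = (\<Sum>es\<in>?E. \<Sum>ds\<in>?D. ?g es ds)"
      by (simp only: sym_prod_def)
    have g: "?g es ds \<in> star_range n m k"
      "tensor_seminorm scl (n + m - 2 * k) p (?g es ds) \<le> ffact n k * ffact m k *
        (prod_list (map p (map2 (hpart V) es xs)) * prod_list (map p (map2 (hpart V) ds ys)))"
      if "es \<in> ?E" "ds \<in> ?D" for es ds
      using contraction_power_homs[OF homs_hparts[of es xs] homs_hparts[of ds ys], of k] that l
      by (simp_all add: star_coeff_def)
    have "(\<Sum>es\<in>?E. \<Sum>ds\<in>?D. ?g es ds) \<in> star_range n m k"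
      by (intro tensors.subspace_sum[OF subspace_star_range] g)
    moreover have "tensor_seminorm scl (n + m - 2 * k) p (\<Sum>es\<in>?E. \<Sum>ds\<in>?D. ?g es ds) \<le>
      (\<Sum>es\<in>?E. \<Sum>ds\<in>?D. ffact n k * ffact m k *
        (prod_list (map p (map2 (hpart V) es xs)) * prod_list (map p (map2 (hpart V) ds ys))))"
      using g(1) star_range_subset(1)
      by (intro tensor_seminorm_sum[OF p_nonneg] tensors.subspace_sum[OF subspace_tensor_power] g(2)) blast+
    moreover have "\<dots> = ffact n k * ffact m k * (prod_list (map p xs) * prod_list (map p ys))"
      using sum_prod_hparts[OF p_nonneg p_graded, of xs] sum_prod_hparts[OF p_nonneg p_graded, of ys] l
      by (simp only: sum_distrib_left[symmetric] sum_distrib_right[symmetric])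
    ultimately show ?thesis unfolding G by (simp only:)
  qed
  note bound = tbilinear_bound[OF bil p_nonneg _ subspace_star_range star_range_subset(1) pure s t]
  show "?G (symmetrize scl V s) (symmetrize scl V t) \<in> star_range n m k"
    by (rule bound(1)) (simp_all add: ffact_nonneg)
  show "tensor_seminorm scl (n + m - 2 * k) p (?G (symmetrize scl V s) (symmetrize scl V t)) \<le>
      ffact n k * ffact m k * (tensor_seminorm scl n p s * tensor_seminorm scl m p t)"
    by (rule bound(2)) (simp_all add: ffact_nonneg)
qed

text \<open>The weight estimate separates the two degrees, so the double sum over components factors
  into the two seminorms. Membership and vanishing are read off \<open>star_range\<close> on each
  pair of components.\<close>

lemma
  assumes a: "a \<in> sym_algebra scl V" and b: "b \<in> sym_algebra scl V"
  shows star_coeff_in_sym_algebra: "star_coeff scl V \<Lambda> k a b \<in> sym_algebra scl V"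
    and star_coeff_eventually_zero: "\<exists>N. \<forall>k\<ge>N. star_coeff scl V \<Lambda> k a b = 0"
    and weyl_seminorm_star_coeff: "\<zeta> \<ge> 1 \<Longrightarrow> r \<ge> 1/2 \<Longrightarrow>
      \<zeta> ^ k / fact k * weyl_seminorm scl r p (star_coeff scl V \<Lambda> k a b) \<le>
      weyl_seminorm scl r (\<lambda>v. \<zeta> * 2 powr (r + 1/2) * p v) a * weyl_seminorm scl r (\<lambda>v. \<zeta> * 2 powr (r + 1/2) * p v) b"
proof -
  have aT: "a \<in> tensor_algebra scl" and bT: "b \<in> tensor_algebra scl"
    using a b sym_algebra_subset by auto
  obtain N where N: "\<And>n. n \<ge> N \<Longrightarrow> tcomp scl n a = 0" "a = (\<Sum>n<N. tcomp scl n a)"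
    using tensor_algebra_decompose[OF aT] by blast
  obtain M where M: "\<And>m. m \<ge> M \<Longrightarrow> tcomp scl m b = 0" "b = (\<Sum>m<M. tcomp scl m b)"
    using tensor_algebra_decompose[OF bT] by blast
  let ?a = "\<lambda>n. tcomp scl n a" and ?b = "\<lambda>m. tcomp scl m b"
  let ?g = "\<lambda>k n m. star_coeff scl V \<Lambda> k (symmetrize scl V (?a n)) (symmetrize scl V (?b m))"
  have pw: "?a n \<in> tensor_power scl n" "?b n \<in> tensor_power scl n" for n
    using aT bT by (auto intro: tcomp_in_tensor_power)
  \<comment> \<open>The symmetrizer fixes \<open>a\<close> and \<open>b\<close>, so it may be
    inserted before decomposing into degrees; this brings each summand into the form of
    \<open>star_coeff_bound\<close>.\<close>
  have eq: "star_coeff scl V \<Lambda> k a b = (\<Sum>n<N. \<Sum>m<M. ?g k n m)" for k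
  proof -
    have "star_coeff scl V \<Lambda> k (symmetrize scl V (\<Sum>n<N. ?a n)) (symmetrize scl V (\<Sum>m<M. ?b m)) =
        (\<Sum>n<N. \<Sum>m<M. ?g k n m)"
      by (rule tbilinear_sum'[OF tbilinear_precompose[OF tbilinear_star_coeff linear_symmetrize symmetrize_in_algebra]])
        (use pw tensor_power_subset in blast)+
    then show ?thesis
      by (simp only: N(2)[symmetric] M(2)[symmetric] symmetrize_sym_algebra[OF a] symmetrize_sym_algebra[OF b])
  qed
  have g: "?g k n m \<in> star_range n m k" for k n m by (rule star_coeff_bound(1)[OF pw])
  have gS: "?g k n m \<in> sym_algebra scl V" for k n m using g star_range_subset(2) by blast
  show "star_coeff scl V \<Lambda> k a b \<in> sym_algebra scl V" for k
    unfolding eq by (intro tensors.subspace_sum[OF subspace_sym_algebra] gS)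
  have "star_coeff scl V \<Lambda> k a b = 0" if "k \<ge> N" for k
  proof -
    have z: "?g k n m = 0" if "n < N" for n m
      using g[of k n m] that \<open>k \<ge> N\<close> by (simp add: star_range_def)
    show ?thesis unfolding eq by (intro sum.neutral ballI, rule z) simp
  qed
  then show "\<exists>N. \<forall>k\<ge>N. star_coeff scl V \<Lambda> k a b = 0" by blast
  assume z: "\<zeta> \<ge> 1" and r: "r \<ge> 1/2"
  define K where "K = \<zeta> * 2 powr (r + 1/2)"
  have K: "K > 0" using z by (simp add: K_def)
  have Kp: "0 \<le> K * p v" for v using K p_nonneg by simp
  let ?A = "\<lambda>n. K ^ n * tensor_seminorm scl n p (?a n) * fact n powr r"
  let ?B = "\<lambda>m. K ^ m * tensor_seminorm scl m p (?b m) * fact m powr r"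
  have zk: "\<zeta> ^ k / fact k \<ge> 0" using z by simp
  \<comment> \<open>If \<open>k\<close> exceeds a degree, the term is 0 and
    \<open>n + m - 2 * k\<close> has no meaning as a degree; otherwise the weight estimate
    applies.\<close>
  have term_le: "\<zeta> ^ k / fact k * weyl_seminorm scl r p (?g k n m) \<le> ?A n * ?B m" for n m
  proof (cases "k \<le> n \<and> k \<le> m")
    case False
    then have "?g k n m = 0" using g[of k n m] by (auto simp: star_range_def)
    then have "weyl_seminorm scl r p (?g k n m) = 0"
      by (simp only: weyl_seminorm_zero[OF p_nonneg])
    then show ?thesis
      using K by (simp add: tensor_seminorm_nonneg[OF p_nonneg pw(1)] tensor_seminorm_nonneg[OF p_nonneg pw(2)])
  next
    case True
    have "weyl_seminorm scl r p (?g k n m) = tensor_seminorm scl (n + m - 2 * k) p (?g k n m) * fact (n + m - 2 * k) powr r"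
      using g star_range_subset(1) by (intro weyl_seminorm_tensor_power[OF p_nonneg]) blast
    also have "\<dots> \<le> ffact n k * ffact m k * (tensor_seminorm scl n p (?a n) * tensor_seminorm scl m p (?b m)) *
        fact (n + m - 2 * k) powr r"
      by (intro mult_right_mono star_coeff_bound(2)[OF pw]) simp
    finally have "\<zeta> ^ k / fact k * weyl_seminorm scl r p (?g k n m) \<le> \<zeta> ^ k / fact k *
        (ffact n k * ffact m k * (tensor_seminorm scl n p (?a n) * tensor_seminorm scl m p (?b m)) * fact (n + m - 2 * k) powr r)"
      using zk by (rule mult_left_mono)
    also have "\<dots> = (\<zeta> ^ k / fact k * (ffact n k * ffact m k * fact (n + m - 2 * k) powr r)) *
        (tensor_seminorm scl n p (?a n) * tensor_seminorm scl m p (?b m))"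
      by (simp only: mult_ac)
    also have "\<dots> \<le> ((K ^ n * fact n powr r) * (K ^ m * fact m powr r)) *
        (tensor_seminorm scl n p (?a n) * tensor_seminorm scl m p (?b m))"
      unfolding K_def using True
      by (intro mult_right_mono star_weight_estimate z r mult_nonneg_nonneg tensor_seminorm_nonneg[OF p_nonneg] pw) auto
    also have "\<dots> = ?A n * ?B m" by (simp only: mult_ac)
    finally show ?thesis .
  qed
  have "weyl_seminorm scl r p (star_coeff scl V \<Lambda> k a b) \<le> (\<Sum>n<N. \<Sum>m<M. weyl_seminorm scl r p (?g k n m))"
    unfolding eq using gS sym_algebra_subset
    by (intro weyl_seminorm_sum[OF p_nonneg] tensors.subspace_sum[OF subspace_tensor_algebra] order_refl) blast+
  then have "\<zeta> ^ k / fact k * weyl_seminorm scl r p (star_coeff scl V \<Lambda> k a b) \<le>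
      \<zeta> ^ k / fact k * (\<Sum>n<N. \<Sum>m<M. weyl_seminorm scl r p (?g k n m))"
    using zk by (rule mult_left_mono)
  also have "\<dots> = (\<Sum>n<N. \<Sum>m<M. \<zeta> ^ k / fact k * weyl_seminorm scl r p (?g k n m))"
    by (simp only: sum_distrib_left)
  also have "\<dots> \<le> (\<Sum>n<N. \<Sum>m<M. ?A n * ?B m)"
    by (intro sum_mono term_le)
  also have "\<dots> = (\<Sum>n<N. ?A n) * (\<Sum>m<M. ?B m)" by (simp only: sum_product)
  also have "\<dots> \<le> weyl_seminorm scl r (\<lambda>v. K * p v) a * weyl_seminorm scl r (\<lambda>v. K * p v) b"
  proof -
    have a: "weyl_seminorm scl r (\<lambda>v. K * p v) a =
        (\<Sum>n<N. tensor_seminorm scl n (\<lambda>v. K * p v) (?a n) * fact n powr r)"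
      by (rule weyl_seminorm_finite[OF Kp N(1)])
    have b: "weyl_seminorm scl r (\<lambda>v. K * p v) b =
        (\<Sum>m<M. tensor_seminorm scl m (\<lambda>v. K * p v) (?b m) * fact m powr r)"
      by (rule weyl_seminorm_finite[OF Kp M(1)])
    show ?thesis
      unfolding a b using K
      by (intro mult_mono sum_mono mult_right_mono tensor_seminorm_dilate[OF p_nonneg] pw sum_nonneg
        mult_nonneg_nonneg tensor_seminorm_nonneg[OF Kp] tensor_seminorm_nonneg[OF p_nonneg]) auto
  qed
  finally show "\<zeta> ^ k / fact k * weyl_seminorm scl r p (star_coeff scl V \<Lambda> k a b) \<le>
      weyl_seminorm scl r (\<lambda>v. \<zeta> * 2 powr (r + 1/2) * p v) a * weyl_seminorm scl r (\<lambda>v. \<zeta> * 2 powr (r + 1/2) * p v) b"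
    by (simp only: K_def)
qed

end


section \<open>Convergence in the completion\<close>

lemma continuous_bilinear_form_dominated:
  assumes "continuous_bilinear_form scl \<Lambda>"
  obtains p where "continuous_seminorm scl p" "\<And>v w. norm (\<Lambda> v w) \<le> p v * p w"
proof -
  have cont: "continuous_on UNIV (\<lambda>x. \<Lambda> (fst x) (snd x))"
    using assms by (simp add: continuous_bilinear_form_def case_prod_unfold)
  have scale: "\<Lambda> (scl c v) w = c * \<Lambda> v w" "\<Lambda> v (scl c w) = c * \<Lambda> v w" for c v w
    using lin_\<Lambda>[OF assms] by (auto simp: lin_iff)
  have "\<Lambda> 0 0 = 0" using scale(1)[of 0 0 0] by simp
  moreover have "open {x. norm (\<Lambda> (fst x) (snd x)) < 1}"
    by (intro open_Collect_less continuous_on_norm cont continuous_on_const)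
  ultimately obtain A B where AB: "open A" "open B" "(0, 0) \<in> A \<times> B"
      "A \<times> B \<subseteq> {x. norm (\<Lambda> (fst x) (snd x)) < 1}"
    using open_prod_elim[of "{x. norm (\<Lambda> (fst x) (snd x)) < 1}" "(0, 0)"] by (auto simp only: mem_Collect_eq fst_conv snd_conv norm_zero zero_less_one)
  then obtain p where p: "continuous_seminorm scl p" "{x. p x < 1} \<subseteq> A \<inter> B"
    using locally_convex[of "A \<inter> B"] by (auto simp: open_Int)
  have small: "norm (\<Lambda> v w) < 1" if "p v < 1" "p w < 1" for v w
  proof -
    have "v \<in> A" "w \<in> B" using p(2) that by auto
    then have "(v, w) \<in> {x. norm (\<Lambda> (fst x) (snd x)) < 1}" by (intro subsetD[OF AB(4)] SigmaI)
    then show ?thesis by simp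
  qed
  have s: "seminorm scl p" using p(1) by (simp add: continuous_seminorm_def)
  have p_nonneg: "0 \<le> p v" for v by (rule seminorm_nonneg[OF vector_space_axioms s])
  have ps: "p (scl c v) = norm c * p v" for c v using s by (simp add: seminorm_def)
  have "norm (\<Lambda> v w) \<le> p v * p w" for v w
  proof -
    have "norm (\<Lambda> v w) \<le> (p v + e) * (p w + e)" if e: "e > 0" for e
    proof -
      \<comment> \<open>The summand \<open>e\<close> permits scaling by the inverse even when
        \<open>p v = 0\<close> or \<open>p w = 0\<close>; it is removed by a limit.\<close>
      let ?s = "p v + e" and ?t = "p w + e"
      have st: "?s > 0" "?t > 0" using e p_nonneg by (auto intro: add_nonneg_pos)
      have "p (scl (of_real (1 / ?s)) v) < 1" "p (scl (of_real (1 / ?t)) w) < 1"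
        using st e by (simp_all only: ps norm_of_real) (simp_all add: field_simps)
      from small[OF this] have "norm (of_real (1 / ?s) * (of_real (1 / ?t) * \<Lambda> v w)) < 1"
        by (simp only: scale mult.left_commute)
      then have "1 / ?s * (1 / ?t * norm (\<Lambda> v w)) < 1"
        using st by (simp only: norm_mult norm_of_real) simp
      moreover have "x \<le> s * t" if "1 / s * (1 / t * x) < 1" "s > 0" "t > 0" for s t x :: real
        using that by (simp add: field_simps)
      ultimately show ?thesis using st by blast
    qed
    then have "\<forall>\<^sub>F e in at_right 0. norm (\<Lambda> v w) \<le> (p v + e) * (p w + e)"
      by (intro eventually_at_right_less[THEN eventually_mono])
    moreover have "((\<lambda>e. (p v + e) * (p w + e)) \<longlongrightarrow> (p v + 0) * (p w + 0)) (at_right 0)"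
      by (intro tendsto_intros)
    ultimately have "norm (\<Lambda> v w) \<le> (p v + 0) * (p w + 0)"
      by (intro tendsto_lowerbound[of _ _ "at_right 0"]) auto
    then show ?thesis by simp
  qed
  with p(1) show ?thesis by (rule that)
qed

lemma continuous_seminorm_add:
  assumes "continuous_seminorm scl p" "continuous_seminorm scl q"
  shows "continuous_seminorm scl (\<lambda>v. p v + q v)"
proof -
  have "p (x + y) \<le> p x + p y" "q (x + y) \<le> q x + q y" for x y
    using assms by (auto simp: continuous_seminorm_def seminorm_def)
  from add_mono[OF this] have "p (x + y) + q (x + y) \<le> p x + q x + (p y + q y)" for x y
    by (simp add: algebra_simps)
  then show ?thesis
    using assms by (auto simp: continuous_seminorm_def seminorm_def distrib_left intro!: continuous_on_add)
qed

lemma continuous_seminorm_dilate: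
  assumes "continuous_seminorm scl p" "K > 0" shows "continuous_seminorm scl (\<lambda>v. K * p v)"
proof -
  have "K * p (x + y) \<le> K * p x + K * p y" for x y
  proof -
    have "K * p (x + y) \<le> K * (p x + p y)"
      using assms by (intro mult_left_mono) (auto simp: continuous_seminorm_def seminorm_def)
    then show ?thesis by (simp add: distrib_left)
  qed
  then show ?thesis
    using assms(1) by (auto simp: continuous_seminorm_def seminorm_def intro!: continuous_on_mult_left)
qed

text \<open>The sum of the seminorms of the two parts works, and it is continuous because the
  projections are.\<close>

lemma graded_dominating_seminorm:
  assumes p: "continuous_seminorm scl p"
  obtains q where "continuous_seminorm scl q" "\<And>v. p v \<le> q v" "\<And>v. q v = q (hpart V False v) + q (hpart V True v)"
proof -
  define q where "q v = p (hpart V False v) + p (hpart V True v)" for v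
  have s: "seminorm scl p" and c: "continuous_on UNIV p"
    using p by (auto simp: continuous_seminorm_def)
  have part: "continuous_seminorm scl (\<lambda>v. p (hpart V e v))" for e
    using s continuous_on_compose2[OF c continuous_hpart[of e]]
    by (simp add: continuous_seminorm_def seminorm_def hpart_add hpart_scale)
  have hh: "hpart V e (hpart V e v) = hpart V e v" for e v
    by (rule hpart_same[OF hpart_props(1)])
  have ho: "hpart V e (hpart V d v) = 0" if "e \<noteq> d" for e d v
    by (rule hpart_other[OF hpart_props(1) that])
  have z: "p 0 = 0" by (rule seminorm_zero[OF vector_space_axioms s])
  show ?thesis
  proof (rule that)
    show "continuous_seminorm scl q"
      unfolding q_def[abs_def] by (intro continuous_seminorm_add part)
    have "p (hpart V False v + hpart V True v) \<le> q v" for v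
      using s unfolding seminorm_def q_def by blast
    then show "p v \<le> q v" for v by (simp only: hpart_sum)
    show "q v = q (hpart V False v) + q (hpart V True v)" for v
      by (simp add: q_def hh ho z)
  qed
qed

text \<open>With \<open>E = {R}\<close> this is the topology for \<open>R\<close>, and with all
  exponents below \<open>R\<close> it is the projective limit topology; one argument then covers
  both.\<close>

definition weyl_family :: "real set \<Rightarrow> (('k, 'v) tensor \<Rightarrow> real) set" where
  "weyl_family E = {weyl_seminorm scl r p | r p. r \<in> E \<and> continuous_seminorm scl p}"

lemma continuous_seminorm_nonneg: "continuous_seminorm scl p \<Longrightarrow> 0 \<le> p v"
  using seminorm_nonneg[OF vector_space_axioms] by (simp add: continuous_seminorm_def)

lemma seminormed_completion_weyl_family:
  assumes "is_completion tscale (sym_algebra scl V) (weyl_family E) scl' \<iota>"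
    and E: "E \<noteq> {}" "\<And>r s. r \<in> E \<Longrightarrow> s \<in> E \<Longrightarrow> max r s \<in> E"
  shows "seminormed_completion tscale (sym_algebra scl V) (weyl_family E) scl' \<iota>"
proof (intro seminormed_completion.intro seminormed_completion_axioms.intro)
  note T = subsetD[OF sym_algebra_subset]
  show "vector_space (tscale :: 'k \<Rightarrow> ('k, 'v) tensor \<Rightarrow> ('k, 'v) tensor)"
    by (rule tensors.vector_space_axioms)
  show "is_completion tscale (sym_algebra scl V) (weyl_family E) scl' \<iota>" by (rule assms(1))
  show "tensors.subspace (sym_algebra scl V)" by (rule subspace_sym_algebra)
  have "continuous_seminorm scl (\<lambda>_. 0)"
    by (simp add: continuous_seminorm_def seminorm_def)
  then show "weyl_family E \<noteq> {}" using E(1) by (auto simp: weyl_family_def)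
  show "\<exists>q\<in>weyl_family E. \<forall>x\<in>sym_algebra scl V. q1 x \<le> q x \<and> q2 x \<le> q x"
    if "q1 \<in> weyl_family E" "q2 \<in> weyl_family E" for q1 q2
  proof -
    obtain r1 p1 where 1: "q1 = weyl_seminorm scl r1 p1" "r1 \<in> E" "continuous_seminorm scl p1"
      using \<open>q1 \<in> weyl_family E\<close> by (auto simp: weyl_family_def)
    obtain r2 p2 where 2: "q2 = weyl_seminorm scl r2 p2" "r2 \<in> E" "continuous_seminorm scl p2"
      using \<open>q2 \<in> weyl_family E\<close> by (auto simp: weyl_family_def)
    \<comment> \<open>An upper bound of both, because factorials are at least 1 and projective
      seminorms are monotone in the seminorm on \<open>V\<close>.\<close>
    let ?q = "weyl_seminorm scl (max r1 r2) (\<lambda>v. p1 v + p2 v)"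
    have "?q \<in> weyl_family E"
      unfolding weyl_family_def using E(2)[OF 1(2) 2(2)] continuous_seminorm_add[OF 1(3) 2(3)] by blast
    moreover have "q1 x \<le> ?q x" "q2 x \<le> ?q x" if "x \<in> sym_algebra scl V" for x
      unfolding 1(1) 2(1) using continuous_seminorm_nonneg[OF 1(3)] continuous_seminorm_nonneg[OF 2(3)]
      by (auto intro!: weyl_seminorm_mono T that)
    ultimately show ?thesis by blast
  qed
  fix q x assume q: "q \<in> weyl_family E" and x: "x \<in> sym_algebra scl V"
  then obtain r p where rp: "q = weyl_seminorm scl r p" "continuous_seminorm scl p"
    by (auto simp: weyl_family_def)
  note p = continuous_seminorm_nonneg[OF rp(2)]
  show "q (x + y) \<le> q x + q y" if "y \<in> sym_algebra scl V" for y
    unfolding rp(1) by (rule weyl_seminorm_add[OF p T[OF x] T[OF that]])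
  show "q (tscale c x) = norm c * q x" for c
    unfolding rp(1) by (rule weyl_seminorm_scale[OF p T[OF x]])
qed

text \<open>The last condition on \<open>E\<close> lets each exponent be raised within
  \<open>E\<close> to at least 1/2, where the factorial estimate applies; monotonicity of
  \<open>weyl_seminorm\<close> in the exponent brings the bound back.\<close>

lemma star_converges:
  fixes scl' :: "'k \<Rightarrow> 'w::{uniform_topological_group_add,topological_ab_group_add,t2_space,complete_uniform_space} \<Rightarrow> 'w"
  assumes \<Lambda>: "continuous_bilinear_form scl \<Lambda>"
    and completion: "is_completion tscale (sym_algebra scl V) (weyl_family E) scl' \<iota>"
    and E: "E \<noteq> {}" "\<And>r s. r \<in> E \<Longrightarrow> s \<in> E \<Longrightarrow> max r s \<in> E" "\<And>r. r \<in> E \<Longrightarrow> \<exists>s\<in>E. r \<le> s \<and> 1/2 \<le> s"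
  shows "converges_absolutely_to scl'
      (\<lambda>k. scl' (z ^ k / fact k) (cont_ext scl' (sym_algebra scl V) \<iota> (star_coeff scl V \<Lambda> k) a b))
      (cont_ext scl' (sym_algebra scl V) \<iota> (star scl V \<Lambda> z) a b)"
proof -
  let ?S = "sym_algebra scl V" and ?Q = "weyl_family E"
  interpret C: seminormed_completion tscale ?S ?Q scl' \<iota>
    by (rule seminormed_completion_weyl_family[OF completion E(1,2)])
  note T = subsetD[OF sym_algebra_subset]
  obtain p0 where p0: "continuous_seminorm scl p0" "\<And>v w. norm (\<Lambda> v w) \<le> p0 v * p0 w"
    using continuous_bilinear_form_dominated[OF \<Lambda>] by blast
  have dominate: "\<exists>p'. continuous_seminorm scl p' \<and> (\<forall>v. p v \<le> p' v) \<and>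
      (\<forall>v. p' v = p' (hpart V False v) + p' (hpart V True v)) \<and> (\<forall>v w. norm (\<Lambda> v w) \<le> p' v * p' w)"
    if p: "continuous_seminorm scl p" for p
  proof -
    \<comment> \<open>Adding \<open>p0\<close> before passing to a graded seminorm yields one
      seminorm that dominates \<open>p\<close>, bounds \<open>\<Lambda>\<close> and is additive
      along the grading.\<close>
    obtain p' where p': "continuous_seminorm scl p'" "\<And>v. p v + p0 v \<le> p' v"
      "\<And>v. p' v = p' (hpart V False v) + p' (hpart V True v)"
      using graded_dominating_seminorm[OF continuous_seminorm_add[OF p p0(1)]] by blast
    have le: "p v \<le> p' v" "p0 v \<le> p' v" for v
      using p'(2)[of v] continuous_seminorm_nonneg[OF p, of v] continuous_seminorm_nonneg[OF p0(1), of v]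
      by linarith+
    have "norm (\<Lambda> v w) \<le> p' v * p' w" for v w
      by (rule order_trans[OF p0(2)])
        (intro mult_mono le continuous_seminorm_nonneg[OF p0(1)] continuous_seminorm_nonneg[OF p'(1)])
    then show ?thesis using p'(1,3) le(1) by blast
  qed
  \<comment> \<open>Membership and vanishing of the coefficients are by-products of the quantitative
    bound, so an admissible seminorm is fixed to obtain them.\<close>
  obtain p1 where p1: "\<forall>v. p0 v \<le> p1 v" "continuous_seminorm scl p1"
      "\<forall>v. p1 v = p1 (hpart V False v) + p1 (hpart V True v)" "\<forall>v w. norm (\<Lambda> v w) \<le> p1 v * p1 w"
    using dominate[OF p0(1)] by blast
  note p1_assms = \<Lambda> p1(4)[rule_format] continuous_seminorm_nonneg[OF p1(2)] p1(3)[rule_format]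
  have coeff_S: "star_coeff scl V \<Lambda> k x y \<in> ?S" if "x \<in> ?S" "y \<in> ?S" for k x y
    by (rule star_coeff_in_sym_algebra[OF p1_assms that])
  have zero: "\<exists>N. \<forall>k\<ge>N. star_coeff scl V \<Lambda> k x y = 0" if "x \<in> ?S" "y \<in> ?S" for x y
    by (rule star_coeff_eventually_zero[OF p1_assms that])
  \<comment> \<open>At least 1, as the weight estimate requires, and at least
    \<open>2 * norm z\<close>, so that the coefficients divided by \<open>D k\<close> are powers of
    a ratio at most 1/2.\<close>
  define \<zeta> where "\<zeta> = 2 * max 1 (norm z)"
  have \<zeta>: "\<zeta> \<ge> 1" "norm z / \<zeta> < 1" by (auto simp: \<zeta>_def max_def field_simps)
  show ?thesis
  proof (rule C.converges_absolutely_bilinear_series[where D = "\<lambda>k. \<zeta> ^ k / fact k"])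
    show "C.bilinear_on (star_coeff scl V \<Lambda> k)" for k
      unfolding C.bilinear_on_def
      using tbilinear_star_coeff[of \<Lambda> k] coeff_S T unfolding tbilinear_def by (intro ballI conjI allI) auto
    show "0 < \<zeta> ^ k / fact k" for k using \<zeta>(1) by simp
    have "norm (z ^ k / fact k) / (\<zeta> ^ k / fact k) = (norm z / \<zeta>) ^ k" for k
      by (simp add: norm_divide norm_power norm_fact power_divide)
    then show "summable (\<lambda>k. norm (z ^ k / fact k) / (\<zeta> ^ k / fact k))"
      using \<zeta> by (simp add: summable_geometric)
    show "\<exists>q'\<in>?Q. \<forall>k. \<forall>x\<in>?S. \<forall>y\<in>?S. \<zeta> ^ k / fact k * q (star_coeff scl V \<Lambda> k x y) \<le> q' x * q' y"
      if q: "q \<in> ?Q" for q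
    proof -
      obtain r p where rp: "q = weyl_seminorm scl r p" "r \<in> E" "continuous_seminorm scl p"
        using q by (auto simp: weyl_family_def)
      obtain s where s: "s \<in> E" "r \<le> s" "1/2 \<le> s" using E(3)[OF rp(2)] by blast
      obtain p' where p': "continuous_seminorm scl p'" "\<forall>v. p v \<le> p' v"
        "\<forall>v. p' v = p' (hpart V False v) + p' (hpart V True v)" "\<forall>v w. norm (\<Lambda> v w) \<le> p' v * p' w"
        using dominate[OF rp(3)] by blast
      let ?q = "weyl_seminorm scl s (\<lambda>v. \<zeta> * 2 powr (s + 1/2) * p' v)"
      have "?q \<in> ?Q"
        unfolding weyl_family_def using s(1) continuous_seminorm_dilate[OF p'(1), of "\<zeta> * 2 powr (s + 1/2)"] \<zeta>(1)
        by auto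
      moreover have "\<zeta> ^ k / fact k * q (star_coeff scl V \<Lambda> k x y) \<le> ?q x * ?q y"
        if xy: "x \<in> ?S" "y \<in> ?S" for k x y
      proof -
        have "q (star_coeff scl V \<Lambda> k x y) \<le> weyl_seminorm scl s p' (star_coeff scl V \<Lambda> k x y)"
          unfolding rp(1) by (rule weyl_seminorm_mono[OF continuous_seminorm_nonneg[OF rp(3)] T[OF coeff_S[OF xy]] _ s(2)])
            (use p'(2) in blast)
        then have "\<zeta> ^ k / fact k * q (star_coeff scl V \<Lambda> k x y) \<le>
            \<zeta> ^ k / fact k * weyl_seminorm scl s p' (star_coeff scl V \<Lambda> k x y)"
          using \<zeta>(1) by (intro mult_left_mono) auto
        also have "\<dots> \<le> ?q x * ?q y"
          by (rule weyl_seminorm_star_coeff[OF \<Lambda> p'(4)[rule_format] continuous_seminorm_nonneg[OF p'(1)]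
                p'(3)[rule_format] xy \<zeta>(1) s(3)])
        finally show ?thesis .
      qed
      ultimately show ?thesis by blast
    qed
    show "\<forall>\<^sub>F N in sequentially. star scl V \<Lambda> z x y = (\<Sum>k<N. tscale (z ^ k / fact k) (star_coeff scl V \<Lambda> k x y))"
      if xy: "x \<in> ?S" "y \<in> ?S" for x y
    proof -
      obtain N0 where N0: "\<And>k. k \<ge> N0 \<Longrightarrow> star_coeff scl V \<Lambda> k x y = 0"
        using zero[OF xy] by blast
      have "star scl V \<Lambda> z x y = (\<Sum>k<N. tscale (z ^ k / fact k) (star_coeff scl V \<Lambda> k x y))" if "N \<ge> N0" for N
        unfolding star_def
      \<comment> \<open>\<open>star\<close> sums over the nonzero coefficients only; padding with
        zero terms gives every partial sum from \<open>N0\<close> on.\<close>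
      proof (rule sum.mono_neutral_left)
        show "{k. star_coeff scl V \<Lambda> k x y \<noteq> 0} \<subseteq> {..<N}"
          using N0 that by (force simp: not_less[symmetric])
        show "\<forall>k\<in>{..<N} - {k. star_coeff scl V \<Lambda> k x y \<noteq> 0}. tscale (z ^ k / fact k) (star_coeff scl V \<Lambda> k x y) = 0"
          by (simp add: tensors.scale_zero_right)
      qed simp
      then show ?thesis unfolding eventually_sequentially by blast
    qed
  qed
qed

lemma weyl_seminorms_eq_family: "weyl_seminorms scl R = weyl_family {R}"
  by (auto simp: weyl_seminorms_def weyl_family_def)

lemma weyl_seminorms_minus_eq_family: "weyl_seminorms_minus scl R = weyl_family {..<R}"
proof -
  have "(\<exists>\<epsilon>. r = R - \<epsilon> \<and> \<epsilon> > 0) \<longleftrightarrow> r < R" for r :: real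
  proof
    show "\<exists>\<epsilon>. r = R - \<epsilon> \<and> \<epsilon> > 0" if "r < R" using that by (intro exI[of _ "R - r"]) simp
  qed auto
  then have "(\<exists>\<epsilon>. q = weyl_seminorm scl (R - \<epsilon>) p \<and> \<epsilon> > 0) \<longleftrightarrow> (\<exists>r. q = weyl_seminorm scl r p \<and> r < R)" for q p
    by metis
  then show ?thesis
    unfolding weyl_seminorms_minus_def weyl_family_def lessThan_iff by blast
qed

end

theorem proposition3p21:
  fixes scl :: "'k::real_normed_field \<Rightarrow> 'v::{topological_ab_group_add,t2_space} \<Rightarrow> 'v"
    and V :: "bool \<Rightarrow> 'v set"
    and \<Lambda> :: "'v \<Rightarrow> 'v \<Rightarrow> 'k"
    and z :: 'k
    and R :: real
    and scl' :: "'k \<Rightarrow> 'w::{uniform_topological_group_add,topological_ab_group_add,t2_space,complete_uniform_space} \<Rightarrow> 'w"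
    and \<iota> :: "('k, 'v) tensor \<Rightarrow> 'w"
    and a b :: 'w
  assumes "graded_lcs scl V"
    and "continuous_bilinear_form scl \<Lambda>"
    and "even_form V \<Lambda>"
  shows
    "(R \<ge> 1/2 \<and> is_completion tscale (sym_algebra scl V) (weyl_seminorms scl R) scl' \<iota> \<longrightarrow>
        converges_absolutely_to scl'
          (\<lambda>k. scl' (z ^ k / fact k)
             (cont_ext scl' (sym_algebra scl V) \<iota> (star_coeff scl V \<Lambda> k) a b))
          (cont_ext scl' (sym_algebra scl V) \<iota> (star scl V \<Lambda> z) a b)) \<and>
     (R > 1/2 \<and> is_completion tscale (sym_algebra scl V) (weyl_seminorms_minus scl R) scl' \<iota> \<longrightarrow>
        converges_absolutely_to scl'
          (\<lambda>k. scl' (z ^ k / fact k)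
             (cont_ext scl' (sym_algebra scl V) \<iota> (star_coeff scl V \<Lambda> k) a b))
          (cont_ext scl' (sym_algebra scl V) \<iota> (star scl V \<Lambda> z) a b))"
proof -
  interpret graded_lcs scl V by (rule assms(1))
  show ?thesis
    unfolding weyl_seminorms_eq_family weyl_seminorms_minus_eq_family
  proof (intro conjI impI; elim conjE)
    assume R: "1/2 \<le> R" and "is_completion tscale (sym_algebra scl V) (weyl_family {R}) scl' \<iota>"
    then show "converges_absolutely_to scl'
          (\<lambda>k. scl' (z ^ k / fact k)
             (cont_ext scl' (sym_algebra scl V) \<iota> (star_coeff scl V \<Lambda> k) a b))
          (cont_ext scl' (sym_algebra scl V) \<iota> (star scl V \<Lambda> z) a b)"
      by (intro star_converges[OF assms(2), where E = "{R}"]) auto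
  next
    assume R: "1/2 < R" and c: "is_completion tscale (sym_algebra scl V) (weyl_family {..<R}) scl' \<iota>"
    \<comment> \<open>Strictness of \<open>1/2 < R\<close> leaves room: \<open>max r (1/2)\<close>
      is still below \<open>R\<close>.\<close>
    have "\<exists>s\<in>{..<R}. r \<le> s \<and> 1/2 \<le> s" if "r \<in> {..<R}" for r
      using R that by (intro bexI[of _ "max r (1/2)"]) auto
    then show "converges_absolutely_to scl'
          (\<lambda>k. scl' (z ^ k / fact k)
             (cont_ext scl' (sym_algebra scl V) \<iota> (star_coeff scl V \<Lambda> k) a b))
          (cont_ext scl' (sym_algebra scl V) \<iota> (star scl V \<Lambda> z) a b)"
      by (intro star_converges[OF assms(2) c]) auto
  qed
qed

end
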